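(* The convex hull of any isometric cycle of a Peano partial cube is a quasi-hypertorus.
   Context: Graphs are simple, undirected, possibly infinite. In a connected graph $G$, $I_G(x,y)$ is the set of vertices on shortest $(x,y)$-paths; $A\subseteq V(G)$ is convex if $I_G(x,y)\subseteq A$ for all $x,y\in A$; $co_G(A)$ is the smallest convex set containing $A$, and the convex hull of a subgraph $K$ is $G[co_G(V(K))]$; $\mathcal{I}_G(A)=\bigcup_{x,y\in A}I_G(x,y)$. A partial cube is an isometric subgraph of a (possibly infinite) hypercube. A copoint at $x$ is a convex set maximal with respect to not containing $x$; $ph(G)$ is the least $n$ with $co_G(C\cup\{x\})=\mathcal{I}^n_G(C\cup\{x\})$ for every vertex $x$ and copoint $C$ at $x$. A Peano partial cube is a partial cube all of whose finite convex subgraphs have pre-hull number at most $1$. A hypertorus is a Cartesian product of finitely many even cycles, at least one of length greater than $4$; a quasi-hypertorus is a finite hypercube, a hypertorus, or a prism $T\Box K_2$ over a hypertorus $T$. *)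

theory Defs
  imports Main "HOL-Library.Extended_Nat"
begin

type_synonym 'a graph = "'a set \<times> ('a \<times> 'a) set"

definition verts :: "'a graph \<Rightarrow> 'a set" where "verts G = fst G"
definition edges :: "'a graph \<Rightarrow> ('a \<times> 'a) set" where "edges G = snd G"

definition simple_graph :: "'a graph \<Rightarrow> bool" where
  "simple_graph G \<longleftrightarrow> edges G \<subseteq> verts G \<times> verts G \<and> sym (edges G) \<and> irrefl (edges G)"

text \<open>A walk is a nonempty list of vertices, consecutive ones adjacent;
it has length (number of edges) = length of the list minus one.\<close>
definition gwalk :: "'a graph \<Rightarrow> 'a list \<Rightarrow> bool" where
  "gwalk G xs \<longleftrightarrow> xs \<noteq> [] \<and> set xs \<subseteq> verts G \<and>
     (\<forall>i. Suc i < length xs \<longrightarrow> (xs ! i, xs ! Suc i) \<in> edges G)"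

definition walk_between :: "'a graph \<Rightarrow> 'a \<Rightarrow> 'a \<Rightarrow> 'a list \<Rightarrow> bool" where
  "walk_between G x y xs \<longleftrightarrow> gwalk G xs \<and> hd xs = x \<and> last xs = y"

definition connected_graph :: "'a graph \<Rightarrow> bool" where
  "connected_graph G \<longleftrightarrow> verts G \<noteq> {} \<and>
     (\<forall>x\<in>verts G. \<forall>y\<in>verts G. \<exists>xs. walk_between G x y xs)"

text \<open>Distance (only meaningful for vertices in the same component).\<close>
definition gdist :: "'a graph \<Rightarrow> 'a \<Rightarrow> 'a \<Rightarrow> nat" where
  "gdist G x y = (LEAST n. \<exists>xs. walk_between G x y xs \<and> length xs = Suc n)"

definition interval :: "'a graph \<Rightarrow> 'a \<Rightarrow> 'a \<Rightarrow> 'a set" where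
  "interval G x y = {z. \<exists>xs. walk_between G x y xs \<and> length xs = Suc (gdist G x y) \<and> z \<in> set xs}"

definition convex :: "'a graph \<Rightarrow> 'a set \<Rightarrow> bool" where
  "convex G A \<longleftrightarrow> A \<subseteq> verts G \<and> (\<forall>x\<in>A. \<forall>y\<in>A. interval G x y \<subseteq> A)"

definition co :: "'a graph \<Rightarrow> 'a set \<Rightarrow> 'a set" where
  "co G A = \<Inter> {C. convex G C \<and> A \<subseteq> C}"

definition interval_set :: "'a graph \<Rightarrow> 'a set \<Rightarrow> 'a set" where
  "interval_set G A = (\<Union>x\<in>A. \<Union>y\<in>A. interval G x y)"

definition induced :: "'a graph \<Rightarrow> 'a set \<Rightarrow> 'a graph" where
  "induced G A = (A, edges G \<inter> (A \<times> A))"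

definition copoint :: "'a graph \<Rightarrow> 'a \<Rightarrow> 'a set \<Rightarrow> bool" where
  "copoint G x C \<longleftrightarrow> x \<in> verts G \<and> convex G C \<and> x \<notin> C \<and>
     (\<forall>D. convex G D \<and> x \<notin> D \<and> C \<subseteq> D \<longrightarrow> D = C)"

definition ph_prop :: "'a graph \<Rightarrow> nat \<Rightarrow> bool" where
  "ph_prop G n \<longleftrightarrow> (\<forall>x C. copoint G x C \<longrightarrow>
      co G (C \<union> {x}) = (interval_set G ^^ n) (C \<union> {x}))"

definition ph :: "'a graph \<Rightarrow> enat" where
  "ph G = (if \<exists>n. ph_prop G n then enat (LEAST n. ph_prop G n) else \<infinity>)"

definition hypercube :: "'b set \<Rightarrow> 'b set graph" where
  "hypercube X = ({A. finite A \<and> A \<subseteq> X},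
     {(A, B). finite A \<and> A \<subseteq> X \<and> finite B \<and> B \<subseteq> X \<and> card ((A - B) \<union> (B - A)) = 1})"

definition isometric_embedding :: "'a graph \<Rightarrow> 'b graph \<Rightarrow> ('a \<Rightarrow> 'b) \<Rightarrow> bool" where
  "isometric_embedding G H f \<longleftrightarrow> inj_on f (verts G) \<and> f ` verts G \<subseteq> verts H \<and>
     (\<forall>x\<in>verts G. \<forall>y\<in>verts G. (x, y) \<in> edges G \<longleftrightarrow> (f x, f y) \<in> edges H) \<and>
     (\<forall>x\<in>verts G. \<forall>y\<in>verts G. gdist H (f x) (f y) = gdist G x y)"

definition partial_cube :: "'a graph \<Rightarrow> bool" where
  "partial_cube G \<longleftrightarrow> simple_graph G \<and> connected_graph G \<and>
     (\<exists>(X :: 'a set set) f. isometric_embedding G (hypercube X) f)"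

definition peano_partial_cube :: "'a graph \<Rightarrow> bool" where
  "peano_partial_cube G \<longleftrightarrow> partial_cube G \<and>
     (\<forall>A. finite A \<and> convex G A \<longrightarrow> ph (induced G A) \<le> 1)"

definition cycle_in :: "'a graph \<Rightarrow> 'a list \<Rightarrow> bool" where
  "cycle_in G vs \<longleftrightarrow> distinct vs \<and> length vs \<ge> 3 \<and> set vs \<subseteq> verts G \<and>
     (\<forall>i < length vs. (vs ! i, vs ! ((i + 1) mod length vs)) \<in> edges G)"

definition cycle_subgraph :: "'a list \<Rightarrow> 'a graph" where
  "cycle_subgraph vs = (set vs,
     {(vs ! i, vs ! ((i + 1) mod length vs)) | i. i < length vs} \<union>
     {(vs ! ((i + 1) mod length vs), vs ! i) | i. i < length vs})"

definition isometric_subgraph :: "'a graph \<Rightarrow> 'a graph \<Rightarrow> bool" where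
  "isometric_subgraph G H \<longleftrightarrow> verts H \<subseteq> verts G \<and> edges H \<subseteq> edges G \<and>
     (\<forall>x\<in>verts H. \<forall>y\<in>verts H. gdist H x y = gdist G x y)"

definition isometric_cycle :: "'a graph \<Rightarrow> 'a list \<Rightarrow> bool" where
  "isometric_cycle G vs \<longleftrightarrow> cycle_in G vs \<and> isometric_subgraph G (cycle_subgraph vs)"

definition graph_iso :: "'a graph \<Rightarrow> 'b graph \<Rightarrow> bool" where
  "graph_iso G H \<longleftrightarrow> (\<exists>f. bij_betw f (verts G) (verts H) \<and>
     (\<forall>x\<in>verts G. \<forall>y\<in>verts G. (x, y) \<in> edges G \<longleftrightarrow> (f x, f y) \<in> edges H))"

text \<open>The cycle \<open>C_n\<close> (for \<open>n \<ge> 3\<close>) on \<open>{0..<n}\<close> and the complete graph \<open>K_2\<close>.\<close>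
definition cycle_graph :: "nat \<Rightarrow> nat graph" where
  "cycle_graph n = ({0..<n}, {(i, j). i < n \<and> j < n \<and> (j = (i + 1) mod n \<or> i = (j + 1) mod n)})"

definition K2 :: "nat graph" where
  "K2 = ({0, 1}, {(0, 1), (1, 0)})"

definition cart_prod :: "'a graph list \<Rightarrow> 'a list graph" where
  "cart_prod Gs = ({xs. length xs = length Gs \<and> (\<forall>i < length Gs. xs ! i \<in> verts (Gs ! i))},
     {(xs, ys). length xs = length Gs \<and> length ys = length Gs \<and>
        (\<forall>i < length Gs. xs ! i \<in> verts (Gs ! i) \<and> ys ! i \<in> verts (Gs ! i)) \<and>
        (\<exists>i < length Gs. (xs ! i, ys ! i) \<in> edges (Gs ! i) \<and>
           (\<forall>j < length Gs. j \<noteq> i \<longrightarrow> xs ! j = ys ! j))})"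

definition finite_hypercube :: "nat \<Rightarrow> nat list graph" where
  "finite_hypercube n = cart_prod (replicate n K2)"

definition hypertorus_lengths :: "nat list \<Rightarrow> bool" where
  "hypertorus_lengths ns \<longleftrightarrow> (\<forall>n\<in>set ns. even n \<and> n \<ge> 4) \<and> (\<exists>n\<in>set ns. n > 4)"

definition hypertorus :: "nat list \<Rightarrow> nat list graph" where
  "hypertorus ns = cart_prod (map cycle_graph ns)"

definition hypertorus_prism :: "nat list \<Rightarrow> nat list graph" where
  "hypertorus_prism ns = cart_prod (map cycle_graph ns @ [K2])"

definition quasi_hypertorus :: "'a graph \<Rightarrow> bool" where
  "quasi_hypertorus G \<longleftrightarrow>
     (\<exists>n. graph_iso G (finite_hypercube n)) \<or>
     (\<exists>ns. hypertorus_lengths ns \<and> graph_iso G (hypertorus ns)) \<or>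
     (\<exists>ns. hypertorus_lengths ns \<and> graph_iso G (hypertorus_prism ns))"

end

theory Submission
  imports Defs
begin

text \<open>The hull of the cycle embeds isometrically in a hypercube whose \<open>n\<close> coordinates are exactly those
crossed by the cycle; it becomes a family \<open>H\<close> of subsets of \<open>{..<n}\<close> containing all initial and final segments.
Pre-hull number at most 1 says: if in a convex \<open>K \<subseteq> H\<close> no other coordinate separates a point from the far
side of coordinate \<open>i\<close>, then any geodesic on one side of \<open>i\<close> extends to a point with a neighbour across \<open>i\<close>.
This passes to projections and makes \<open>H\<close> antipodal, so three coordinates project onto either a 6-cycle
(\<open>tri\<close>) or the full cube, and \<open>tri\<close> behaves like collinearity: a pair of coordinates spans a line, onto which
\<open>H\<close> projects as an even cycle. A line \<open>L\<close> with at least three coordinates turns out to be a direct factor: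
otherwise two further coordinates would be nested over a vertex of the cycle, and an innermost such
pair produces two lines that meet twice. Splitting off lines leaves a hypercube, whose coordinates pair up to 4-cycles.\<close>

section \<open>Antipodality\<close>

text \<open>\<open>prehull\<close> yields nothing until its premise is checked, and that premise
  concerns two coordinates at a time: the sign of \<open>j\<close> at any point must also occur
  across \<open>i\<close>. On all of \<open>H\<close> it holds because segments of the cycle realise
  the four sign patterns of any two coordinates. For the fibres of a projection nothing of the kind
  is given, and this is the obstacle: over each vertex of a wide line, any two outer coordinates
  must be shown to take all four patterns. Once they do, every fibre is antipodal. A geodesic
  between antipodes of a fibre cannot be prolonged inside it, so stretching it towards the next
  fibre shows that its very end point has a neighbour there; hence all fibres agree and the line is
  a factor. A coordinate left without a partner when the remaining hypercube is cut into 4-cycles is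
  the source of the factor \<open>K2\<close> of a prism.\<close>

definition flip :: "nat \<Rightarrow> nat set \<Rightarrow> nat set" where
  "flip i x = (if i \<in> x then x - {i} else insert i x)"

lemma in_flip [simp]: "k \<in> flip i x \<longleftrightarrow> (k \<in> x) \<noteq> (k = i)"
  by (auto simp: flip_def)

lemma flip_flip [simp]: "flip i (flip i x) = x"
  by auto

lemma flip_Int: "flip i x \<inter> S = (if i \<in> S then flip i (x \<inter> S) else x \<inter> S)"
  by auto

lemma sub_eqI: "x \<subseteq> N \<Longrightarrow> y \<subseteq> N \<Longrightarrow> (\<And>k. k \<in> N \<Longrightarrow> (k \<in> x) = (k \<in> y)) \<Longrightarrow> x = y"
  by auto

lemma eq_or_flip:
  assumes "\<And>k. k \<noteq> f \<Longrightarrow> (k \<in> y) = (k \<in> x)"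
  shows "y = x \<or> y = flip f x"
proof (cases "(f \<in> y) = (f \<in> x)")
  case True
  then have "k \<in> y \<longleftrightarrow> k \<in> x" for k using assms[of k] by (cases "k = f") auto
  then show ?thesis by blast
next
  case False
  then have "k \<in> y \<longleftrightarrow> k \<in> flip f x" for k using assms[of k] by (cases "k = f") auto
  then show ?thesis by blast
qed

text \<open>The last clause places \<open>y\<close> between \<open>x\<close> and \<open>u\<close> in
  the cube: \<open>u\<close> keeps every change made from \<open>x\<close> to \<open>y\<close>. No
  path occurs in the formulation, which is why it survives projection to fewer coordinates.\<close>

definition stretchable :: "nat set \<Rightarrow> nat set set \<Rightarrow> bool" where
  "stretchable S K \<longleftrightarrow> (\<forall>i\<in>S. \<forall>x\<in>K. \<forall>y\<in>K. (i \<in> x) = (i \<in> y) \<longrightarrow>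
     (\<exists>u\<in>K. flip i u \<in> K \<and> (i \<in> u) = (i \<in> x) \<and> (\<forall>k. (k \<in> x) \<noteq> (k \<in> y) \<longrightarrow> (k \<in> u) = (k \<in> y))))"

lemma stretchableE:
  assumes "stretchable S K" "i \<in> S" "x \<in> K" "y \<in> K" "(i \<in> x) = (i \<in> y)"
  obtains u where "u \<in> K" "flip i u \<in> K" "(i \<in> u) = (i \<in> x)"
    "\<And>k. (k \<in> x) \<noteq> (k \<in> y) \<Longrightarrow> (k \<in> u) = (k \<in> y)"
  using assms unfolding stretchable_def by blast

lemma stretchable_projection:
  assumes "stretchable S K" "T \<subseteq> S"
  shows "stretchable T ((\<lambda>x. x \<inter> T) ` K)"
  unfolding stretchable_def
proof (intro ballI impI)
  fix i x y
  assume i: "i \<in> T" and "x \<in> (\<lambda>x. x \<inter> T) ` K" "y \<in> (\<lambda>x. x \<inter> T) ` K" and e: "(i \<in> x) = (i \<in> y)"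
  then obtain x' y' where x': "x' \<in> K" "x = x' \<inter> T" and y': "y' \<in> K" "y = y' \<inter> T" by auto
  have "i \<in> S" "(i \<in> x') = (i \<in> y')" using i e x' y' assms(2) by auto
  from stretchableE[OF assms(1) this(1) x'(1) y'(1) this(2)] obtain u where
    u: "u \<in> K" "flip i u \<in> K" "(i \<in> u) = (i \<in> x')"
      "\<And>k. (k \<in> x') \<noteq> (k \<in> y') \<Longrightarrow> (k \<in> u) = (k \<in> y')" by blast
  show "\<exists>u\<in>(\<lambda>x. x \<inter> T) ` K. flip i u \<in> (\<lambda>x. x \<inter> T) ` K \<and> (i \<in> u) = (i \<in> x) \<and>
         (\<forall>k. (k \<in> x) \<noteq> (k \<in> y) \<longrightarrow> (k \<in> u) = (k \<in> y))"
  proof (intro bexI[of _ "u \<inter> T"] conjI allI impI)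
    show "flip i (u \<inter> T) \<in> (\<lambda>x. x \<inter> T) ` K"
      using u(2) i flip_Int[of i u T] by (auto intro!: image_eqI[of _ _ "flip i u"])
    show "u \<inter> T \<in> (\<lambda>x. x \<inter> T) ` K" using u(1) by (rule imageI)
    show "(i \<in> u \<inter> T) = (i \<in> x)" using u(3) x'(2) by simp
    show "(k \<in> u \<inter> T) = (k \<in> y)" if "(k \<in> x) \<noteq> (k \<in> y)" for k
    proof -
      have "(k \<in> x') \<noteq> (k \<in> y')" "k \<in> T" using that x'(2) y'(2) by auto
      then show ?thesis using u(4)[of k] y'(2) by blast
    qed
  qed
qed

text \<open>If the complement of \<open>x\<close> were missing, then by induction all its flips would be present;
  stretching from \<open>x\<close> past the \<open>i\<close>-th one produces the complement after all.\<close>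
lemma stretchable_complement:
  assumes "finite S" "K \<subseteq> Pow S" "stretchable S K" "x \<in> K"
  shows "S - x \<in> K"
  using assms
proof (induction "card S" arbitrary: S K x)
  case 0
  then have "S = {}" by simp
  then show ?case using 0 by auto
next
  case (Suc n)
  show ?case
  proof (rule ccontr)
    assume no: "S - x \<notin> K"
    have fl: "flip f (S - x) \<in> K" if f: "f \<in> S" for f
    proof -
      let ?T = "S - {f}"
      have "?T - x \<inter> ?T \<in> (\<lambda>x. x \<inter> ?T) ` K"
      proof (rule Suc.hyps(1))
        show "n = card ?T" using Suc.hyps(2) Suc.prems(1) f by simp
        show "finite ?T" "(\<lambda>x. x \<inter> ?T) ` K \<subseteq> Pow ?T" using Suc.prems(1) by auto
        show "x \<inter> ?T \<in> (\<lambda>x. x \<inter> ?T) ` K" using Suc.prems(4) by (rule imageI)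
        show "stretchable ?T ((\<lambda>x. x \<inter> ?T) ` K)" using stretchable_projection[OF Suc.prems(3)] by auto
      qed
      then obtain z where z: "z \<in> K" "?T - x \<inter> ?T = z \<inter> ?T" by auto
      have "z \<subseteq> S" using z(1) Suc.prems(2) by auto
      have zk: "(k \<in> z) = (k \<in> S - x)" if "k \<in> S" "k \<noteq> f" for k
        using that z(2) by (metis DiffD1 DiffD2 DiffI IntE IntI singletonD)
      have "(k \<in> z) = (k \<in> S - x)" if "k \<noteq> f" for k
        using zk[of k] that \<open>z \<subseteq> S\<close> by blast
      then have "z = S - x \<or> z = flip f (S - x)" by (rule eq_or_flip)
      then show ?thesis using z(1) no by auto
    qed
    obtain i where i: "i \<in> S" using Suc.hyps(2) by (metis card.empty all_not_in_conv nat.distinct(1))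
    let ?y = "flip i (S - x)"
    \<comment> \<open>\<open>x\<close> and \<open>?y\<close> agree in coordinate \<open>i\<close>
      and in no other element of \<open>S\<close>, so \<open>u\<close> is forced to be
      \<open>?y\<close>, and its flip is the complement of \<open>x\<close>.\<close>
    have "(i \<in> x) = (i \<in> ?y)" using i by auto
    from stretchableE[OF Suc.prems(3) i Suc.prems(4) fl[OF i] this] obtain u where
      u: "u \<in> K" "flip i u \<in> K" "(i \<in> u) = (i \<in> x)"
        "\<And>k. (k \<in> x) \<noteq> (k \<in> ?y) \<Longrightarrow> (k \<in> u) = (k \<in> ?y)" by blast
    have "u \<subseteq> S" "x \<subseteq> S" using u(1) Suc.prems by auto
    then have "flip i u = S - x"
      using u(3) u(4) i by (intro sub_eqI[of _ S]) (auto split: if_splits)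
    then show False using u(2) no by simp
  qed
qed

lemma three_elements:
  assumes "i \<in> {e, f, g}" "e \<noteq> f" "e \<noteq> g" "f \<noteq> g"
  obtains f' g' where "{e, f, g} = {i, f', g'}" "f' \<noteq> g'" "f' \<noteq> i" "g' \<noteq> i"
  using assms that[of f g] that[of e g] that[of e f] by (elim insertE emptyE) (simp_all add: insert_commute)

text \<open>For \<open>L\<close> with at least two elements these sets are the vertices of the cycle
  of length \<open>2 * card L\<close> in the cube on \<open>L\<close> that inserts the elements in
  increasing order and deletes them in the same order.\<close>

definition thresholds :: "nat set \<Rightarrow> nat set set" where
  "thresholds L = (\<Union>t. {{i \<in> L. i < t}, {i \<in> L. t \<le> i}})"

text \<open>The hypothesis on single flips provides a geodesic from \<open>x\<close> to
  \<open>y\<close>; \<open>z\<close> is its last point before \<open>i\<close> changes. It stands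
  outside the locale because the images of convex subgraphs need it before any
  \<open>cube_family\<close> is available.\<close>

lemma wg_crossing:
  assumes N: "finite N" and K: "K \<subseteq> Pow N"
    and step: "\<And>x y. x \<in> K \<Longrightarrow> y \<in> K \<Longrightarrow> x \<noteq> y \<Longrightarrow> \<exists>i. (i \<in> x) \<noteq> (i \<in> y) \<and> flip i x \<in> K"
    and "x \<in> K" "y \<in> K" "(i \<in> x) \<noteq> (i \<in> y)"
  shows "\<exists>z\<in>K. flip i z \<in> K \<and> (i \<in> z) = (i \<in> x) \<and> (\<forall>k. (k \<in> x) = (k \<in> y) \<longrightarrow> (k \<in> z) = (k \<in> x))"
  using assms(4-6)
proof (induction "card {k. (k \<in> x) \<noteq> (k \<in> y)}" arbitrary: x rule: less_induct)
  case less
  obtain j where j: "(j \<in> x) \<noteq> (j \<in> y)" "flip j x \<in> K" using step[of x y] less.prems by auto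
  show ?case
  proof (cases "j = i")
    case True
    then show ?thesis using j less.prems by auto
  next
    case False
    let ?x = "flip j x"
    have "{k. (k \<in> x) \<noteq> (k \<in> y)} \<subseteq> N" using less.prems K by auto
    then have fin: "finite {k. (k \<in> x) \<noteq> (k \<in> y)}" using N finite_subset by blast
    have "{k. (k \<in> ?x) \<noteq> (k \<in> y)} \<subset> {k. (k \<in> x) \<noteq> (k \<in> y)}" using j(1) by auto
    then have "card {k. (k \<in> ?x) \<noteq> (k \<in> y)} < card {k. (k \<in> x) \<noteq> (k \<in> y)}"
      by (rule psubset_card_mono[OF fin])
    from less.hyps[OF this j(2) less.prems(2)] less.prems(3) False
    obtain z where z: "z \<in> K" "flip i z \<in> K" "(i \<in> z) = (i \<in> ?x)"
        "\<forall>k. (k \<in> ?x) = (k \<in> y) \<longrightarrow> (k \<in> z) = (k \<in> ?x)" by auto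
    show ?thesis
    proof (intro bexI[of _ z] conjI allI impI)
      fix k assume k: "(k \<in> x) = (k \<in> y)"
      then have "k \<noteq> j" using j by auto
      then show "(k \<in> z) = (k \<in> x)" using z(4) k by (auto split: if_splits)
    qed (use z False in auto)
  qed
qed

section \<open>Set families modelling the hull of an isometric cycle\<close>

text \<open>\<open>step\<close> makes \<open>H\<close> isometric in the cube. The sets
  \<open>K\<close> in \<open>prehull\<close> are the traces of \<open>H\<close> on subcubes; they
  come from finite convex subgraphs. \<open>lower\<close> and \<open>upper\<close> are the vertices
  of the cycle, with coordinates numbered in the order in which it crosses them.\<close>

locale cube_family =
  fixes N :: "nat set" and H :: "nat set set"
  assumes finite_N: "finite N"
    and sub_N: "H \<subseteq> Pow N"
    and step: "\<And>x y. x \<in> H \<Longrightarrow> y \<in> H \<Longrightarrow> x \<noteq> y \<Longrightarrow> \<exists>i. (i \<in> x) \<noteq> (i \<in> y) \<and> flip i x \<in> H"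
    and prehull: "\<And>F A i K. K = {x \<in> H. x \<inter> F = A} \<Longrightarrow>
        (\<And>x j. x \<in> K \<Longrightarrow> j \<noteq> i \<Longrightarrow> \<exists>z\<in>K. (j \<in> z) = (j \<in> x) \<and> (i \<in> z) \<noteq> (i \<in> x)) \<Longrightarrow> stretchable {i} K"
    and lower: "\<And>t. {i \<in> N. i < t} \<in> H"
    and upper: "\<And>t. {i \<in> N. t \<le> i} \<in> H"
begin

lemma outside: "x \<in> H \<Longrightarrow> i \<notin> N \<Longrightarrow> i \<notin> x"
  using sub_N by auto

lemma crossing:
  assumes "x \<in> H" "y \<in> H" "(i \<in> x) \<noteq> (i \<in> y)"
  shows "\<exists>z\<in>H. flip i z \<in> H \<and> (i \<in> z) = (i \<in> x) \<and> (\<forall>k. (k \<in> x) = (k \<in> y) \<longrightarrow> (k \<in> z) = (k \<in> x))"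
  by (rule wg_crossing[OF finite_N sub_N _ assms]) (rule step)

lemma square:
  assumes "x \<in> H" "y \<in> H" "(i \<in> x) \<noteq> (i \<in> y)" "(j \<in> x) \<noteq> (j \<in> y)" "i \<noteq> j"
  shows "\<exists>z\<in>H. ((i \<in> z) = (i \<in> x) \<longleftrightarrow> (j \<in> z) \<noteq> (j \<in> x)) \<and> (\<forall>k. (k \<in> x) = (k \<in> y) \<longrightarrow> (k \<in> z) = (k \<in> x))"
proof -
  obtain z where z: "z \<in> H" "flip i z \<in> H" "(i \<in> z) = (i \<in> x)" "\<forall>k. (k \<in> x) = (k \<in> y) \<longrightarrow> (k \<in> z) = (k \<in> x)"
    using crossing[OF assms(1-3)] by auto
  show ?thesis
  proof (cases "(j \<in> z) = (j \<in> x)")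
    case True
    have "(k \<in> flip i z) = (k \<in> x)" if "(k \<in> x) = (k \<in> y)" for k
      using z(4) that assms(3) by (cases "k = i") auto
    then show ?thesis using z True assms(5) by (intro bexI[of _ "flip i z"]) auto
  next
    case False
    then show ?thesis using z by (intro bexI[of _ z]) auto
  qed
qed

text \<open>A segment cut between the two indices separates them, with either sign, and the empty
  and long initial segments give the equal signs.\<close>

lemma pair_full:
  assumes "i \<in> N" "j \<in> N" "i \<noteq> j"
  shows "\<exists>x\<in>H. (i \<in> x) = a \<and> (j \<in> x) = b"
proof -
  have *: "\<exists>x\<in>H. (i \<in> x) = a \<and> (j \<in> x) = b" if "i < j" "i \<in> N" "j \<in> N" for i j a b
  proof (cases a; cases b)
    show ?thesis if a b using lower[of "Suc j"] \<open>i<j\<close> \<open>i\<in>N\<close> \<open>j\<in>N\<close> that by (intro bexI[of _ "{i \<in> N. i < Suc j}"]) auto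
    show ?thesis if a "\<not> b" using lower[of j] \<open>i<j\<close> \<open>i\<in>N\<close> \<open>j\<in>N\<close> that by (intro bexI[of _ "{i \<in> N. i < j}"]) auto
    show ?thesis if "\<not> a" b using upper[of j] \<open>i<j\<close> \<open>i\<in>N\<close> \<open>j\<in>N\<close> that by (intro bexI[of _ "{i \<in> N. j \<le> i}"]) auto
    show ?thesis if "\<not> a" "\<not> b" using lower[of 0] \<open>i<j\<close> \<open>i\<in>N\<close> \<open>j\<in>N\<close> that by (intro bexI[of _ "{i \<in> N. i < 0}"]) auto
  qed
  show ?thesis using *[of i j a b] *[of j i b a] assms by (cases i j rule: linorder_cases) auto
qed

lemma single_full: "i \<in> N \<Longrightarrow> \<exists>x\<in>H. (i \<in> x) = a"
  using lower[of 0] lower[of "Suc i"] by (cases a) (auto intro: bexI[rotated])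

lemma stretchable: "stretchable N H"
proof -
  have "stretchable {i} H" if i: "i \<in> N" for i
  \<comment> \<open>Fixing no coordinate makes \<open>K\<close> the whole family, where
    \<open>pair_full\<close> verifies the premise.\<close>
  proof (rule prehull[of _ "{}" "{}"])
    fix x j assume x: "x \<in> H" and j: "j \<noteq> i"
    show "\<exists>z\<in>H. (j \<in> z) = (j \<in> x) \<and> (i \<in> z) \<noteq> (i \<in> x)"
    proof (cases "j \<in> N")
      case True
      then show ?thesis using pair_full[OF i True j[symmetric], of "i \<notin> x" "j \<in> x"] by auto
    next
      case False
      then show ?thesis using single_full[OF i, of "i \<notin> x"] x outside[of _ j] by auto
    qed
  qed simp
  then show ?thesis unfolding stretchable_def by blast
qed

lemma antipode: "x \<in> H \<Longrightarrow> N - x \<in> H"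
  using stretchable_complement[OF finite_N sub_N stretchable] .

section \<open>Triples of coordinates and their missing octants\<close>

definition hit3 :: "nat \<Rightarrow> nat \<Rightarrow> nat \<Rightarrow> bool \<Rightarrow> bool \<Rightarrow> bool \<Rightarrow> bool" where
  "hit3 i j k a b c \<longleftrightarrow> (\<exists>x\<in>H. (i \<in> x) = a \<and> (j \<in> x) = b \<and> (k \<in> x) = c)"

definition tri :: "nat \<Rightarrow> nat \<Rightarrow> nat \<Rightarrow> bool" where
  "tri i j k \<longleftrightarrow> i \<in> N \<and> j \<in> N \<and> k \<in> N \<and> i \<noteq> j \<and> i \<noteq> k \<and> j \<noteq> k \<and> (\<exists>a b c. \<not> hit3 i j k a b c)"

lemma hit3_swap: "hit3 j i k b a c = hit3 i j k a b c" "hit3 i k j a c b = hit3 i j k a b c"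
  unfolding hit3_def by blast+

lemma tri_swap12: "tri i j k \<Longrightarrow> tri j i k"
  unfolding tri_def using hit3_swap(1)[of i j k] by blast

lemma tri_swap23: "tri i j k \<Longrightarrow> tri i k j"
  unfolding tri_def using hit3_swap(2)[of i j k] by blast

lemma tri_rot: "tri i j k \<Longrightarrow> tri j k i"
  by (metis tri_swap12 tri_swap23)

lemma triD: "tri i j k \<Longrightarrow> i \<in> N \<and> j \<in> N \<and> k \<in> N \<and> i \<noteq> j \<and> i \<noteq> k \<and> j \<noteq> k"
  unfolding tri_def by auto

lemma hit3_compl:
  assumes "i \<in> N" "j \<in> N" "k \<in> N" "hit3 i j k a b c"
  shows "hit3 i j k (\<not> a) (\<not> b) (\<not> c)"
proof -
  obtain x where "x \<in> H" "(i \<in> x) = a \<and> (j \<in> x) = b \<and> (k \<in> x) = c" using assms unfolding hit3_def by auto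
  then show ?thesis unfolding hit3_def using antipode assms by (intro bexI[of _ "N - x"]) auto
qed

text \<open>With an octant its antipode is missing too, so the sign of \<open>i\<close> in a missing
  octant may be prescribed. Later arguments use this freedom to make two missing octants fit
  together.\<close>

lemma tri_missing:
  assumes "tri i j k"
  obtains b c where "\<not> hit3 i j k a b c" "\<not> hit3 i j k (\<not> a) (\<not> b) (\<not> c)"
proof -
  obtain a' b' c' where m: "\<not> hit3 i j k a' b' c'" using assms unfolding tri_def by blast
  then have m': "\<not> hit3 i j k (\<not> a') (\<not> b') (\<not> c')"
    using hit3_compl[of i j k "\<not> a'" "\<not> b'" "\<not> c'"] assms unfolding tri_def by auto
  show ?thesis
  proof (cases "a = a'")
    case True
    then show ?thesis using that m m' by blast
  next
    case False
    then have "(\<not> a') = a" "(\<not> a) = a'" by auto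
    then show ?thesis using that[of "\<not> b'" "\<not> c'"] m m' by simp
  qed
qed

subsection \<open>Lines of coordinates\<close>

text \<open>The collinearity axiom: two coordinates on the line through \<open>i\<close> and
  \<open>j\<close> are collinear with \<open>i\<close>. If all octants of \<open>i\<close>,
  \<open>k\<close>, \<open>l\<close> were hit, missing octants for \<open>l\<close> and
  \<open>k\<close> with \<open>i\<close> true would constrain \<open>j\<close>: with different signs
  of \<open>j\<close> some point violates both, and with equal signs a point between two others
  violates one of them.\<close>

lemma tri_share:
  assumes t1: "tri i j k" and t2: "tri i j l" and kl: "k \<noteq> l"
  shows "tri i k l"
proof (rule ccontr)
  assume no: "\<not> tri i k l"
  note D = triD[OF t1] triD[OF t2]
  have full: "hit3 i k l a b c" for a b c using no D kl unfolding tri_def by blast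
  obtain b c where bc: "\<not> hit3 i j k True b c" "\<not> hit3 i j k (\<not> True) (\<not> b) (\<not> c)" using tri_missing[OF t1] .
  obtain b' d where d: "\<not> hit3 i j l True b' d" "\<not> hit3 i j l (\<not> True) (\<not> b') (\<not> d)" using tri_missing[OF t2] .
  show False
  proof (cases "b' = b")
    case False
    obtain x where "x \<in> H" "(i \<in> x) = True" "(k \<in> x) = c" "(l \<in> x) = d"
      using full[of True c d] unfolding hit3_def by blast
    moreover have "(j \<in> x) = b \<or> (j \<in> x) = b'" using False by blast
    ultimately show False using bc(1) d(1) unfolding hit3_def by blast
  next
    case True
    obtain x where x: "x \<in> H" "(i \<in> x) = True" "(k \<in> x) = c" "(l \<in> x) = (\<not> d)"
      using full[of True c "\<not> d"] unfolding hit3_def by blast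
    have jx: "(j \<in> x) = (\<not> b)" using bc(1) x unfolding hit3_def by blast
    obtain y' where y': "y' \<in> H" "(i \<in> y') = True" "(k \<in> y') = (\<not> c)" "(l \<in> y') = d"
      using full[of True "\<not> c" d] unfolding hit3_def by blast
    have jy': "(j \<in> y') = (\<not> b)" using d(1) y' True unfolding hit3_def by blast
    \<comment> \<open>The antipode agrees with \<open>x\<close> in \<open>k\<close> and
      \<open>l\<close> and differs in \<open>i\<close> and \<open>j\<close>. A point between them
      that changes just one of \<open>i\<close> and \<open>j\<close> lies in a missing octant
      whichever it is.\<close>
    define y where "y = N - y'"
    have y: "y \<in> H" "(i \<in> y) = False" "(j \<in> y) = b" "(k \<in> y) = c" "(l \<in> y) = (\<not> d)"
      using antipode[OF y'(1)] y' jy' D unfolding y_def by auto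
    obtain z where z: "z \<in> H" "((i \<in> z) = (i \<in> x)) = ((j \<in> z) \<noteq> (j \<in> x))"
      "\<forall>k. (k \<in> x) = (k \<in> y) \<longrightarrow> (k \<in> z) = (k \<in> x)"
      using square[OF x(1) y(1), of i j] x y jx D by auto
    have "(k \<in> z) = c" "(l \<in> z) = (\<not> d)" using z(3) x y by auto
    then show False using z(1,2) x(2) jx bc(1) d(2) True unfolding hit3_def by (cases "i \<in> z") blast+
  qed
qed

text \<open>Flips outside \<open>S\<close> leave the projection in place and bring \<open>x\<close>
  closer to \<open>y\<close>, so the first flip inside \<open>S\<close> on a geodesic gives the
  step. Hence projections of \<open>H\<close> are again isometric in their cubes.\<close>

lemma projection_step:
  assumes "x \<in> H" "y \<in> H" "x \<inter> S \<noteq> y \<inter> S"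
  shows "\<exists>k\<in>S. (k \<in> x) \<noteq> (k \<in> y) \<and> (\<exists>z\<in>H. z \<inter> S = flip k x \<inter> S)"
  using assms
proof (induction "card {k. (k \<in> x) \<noteq> (k \<in> y)}" arbitrary: x rule: less_induct)
  case less
  obtain j where j: "(j \<in> x) \<noteq> (j \<in> y)" "flip j x \<in> H" using step[of x y] less.prems by auto
  show ?case
  proof (cases "j \<in> S")
    case True
    then show ?thesis using j by auto
  next
    case False
    have "{k. (k \<in> x) \<noteq> (k \<in> y)} \<subseteq> N" using less.prems sub_N by auto
    then have fin: "finite {k. (k \<in> x) \<noteq> (k \<in> y)}" using finite_N finite_subset by blast
    have "{k. (k \<in> flip j x) \<noteq> (k \<in> y)} \<subset> {k. (k \<in> x) \<noteq> (k \<in> y)}" using j(1) by auto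
    then have "card {k. (k \<in> flip j x) \<noteq> (k \<in> y)} < card {k. (k \<in> x) \<noteq> (k \<in> y)}"
      by (rule psubset_card_mono[OF fin])
    moreover have *: "flip j x \<inter> S = x \<inter> S" using False by auto
    ultimately obtain k where k: "k \<in> S" "(k \<in> flip j x) \<noteq> (k \<in> y)" "\<exists>z\<in>H. z \<inter> S = flip k (flip j x) \<inter> S"
      using less.hyps[of "flip j x"] j(2) less.prems by metis
    have "flip k (flip j x) \<inter> S = flip k x \<inter> S" using False by auto
    moreover have "k \<noteq> j" using k(1) False by auto
    ultimately show ?thesis using k by (intro bexI[of _ k]) auto
  qed
qed

text \<open>Induction along a geodesic of the projection to \<open>L\<close>. In \<open>adj\<close>
  only the projections of \<open>x\<close> and \<open>z\<close> are adjacent; the two points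
  themselves may be far apart.\<close>

lemma propagate:
  assumes "x \<in> H" "P x" "y \<in> H"
    and same: "\<And>x z. x \<in> H \<Longrightarrow> z \<in> H \<Longrightarrow> P x \<Longrightarrow> z \<inter> L = x \<inter> L \<Longrightarrow> P z"
    and adj: "\<And>a x z. a \<in> L \<Longrightarrow> x \<in> H \<Longrightarrow> z \<in> H \<Longrightarrow> P x \<Longrightarrow> z \<inter> L = flip a x \<inter> L \<Longrightarrow> P z"
  shows "P y"
  using assms(1,2)
proof (induction "card {k \<in> L. (k \<in> x) \<noteq> (k \<in> y)}" arbitrary: x rule: less_induct)
  case less
  show ?case
  proof (cases "x \<inter> L = y \<inter> L")
    case True
    then show ?thesis using same less.prems assms(3) by metis
  next
    case False
    then obtain k z where k: "k \<in> L" "(k \<in> x) \<noteq> (k \<in> y)" "z \<in> H" "z \<inter> L = flip k x \<inter> L"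
      using projection_step[OF less.prems(1) assms(3)] by blast
    have zl: "(l \<in> z) = (l \<in> flip k x)" if "l \<in> L" for l using k(4) that by blast
    have "{l \<in> L. (l \<in> x) \<noteq> (l \<in> y)} \<subseteq> N" using less.prems assms(3) sub_N by auto
    then have fin: "finite {l \<in> L. (l \<in> x) \<noteq> (l \<in> y)}" using finite_N finite_subset by blast
    have "{l \<in> L. (l \<in> z) \<noteq> (l \<in> y)} \<subset> {l \<in> L. (l \<in> x) \<noteq> (l \<in> y)}" using k(1,2) zl by auto
    from psubset_card_mono[OF fin this] show ?thesis
      using less.hyps[of z] k(3) adj[OF k(1) less.prems(1) k(3) less.prems(2) k(4)] by blast
  qed
qed

text \<open>A line: pairwise collinear and closed under collinearity. A pair that is collinear with
  no third coordinate counts as a line and projects onto a 4-cycle.\<close>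

definition flat :: "nat set \<Rightarrow> bool" where
  "flat L \<longleftrightarrow> L \<subseteq> N \<and> (\<exists>i\<in>L. \<exists>j\<in>L. i \<noteq> j) \<and>
     (\<forall>i\<in>L. \<forall>j\<in>L. \<forall>k\<in>L. i \<noteq> j \<longrightarrow> i \<noteq> k \<longrightarrow> j \<noteq> k \<longrightarrow> tri i j k) \<and>
     (\<forall>i\<in>L. \<forall>j\<in>L. \<forall>e. tri i j e \<longrightarrow> e \<in> L)"

text \<open>No coordinate outside \<open>L\<close> is constant on a fibre of the projection to
  \<open>L\<close>. This is what verifies the premise of \<open>prehull\<close> on the union of two
  neighbouring fibres.\<close>

definition splits :: "nat set \<Rightarrow> bool" where
  "splits L \<longleftrightarrow> L \<subseteq> N \<and> (\<forall>x\<in>H. \<forall>e\<in>N - L. \<forall>\<epsilon>. \<exists>y\<in>H. y \<inter> L = x \<inter> L \<and> (e \<in> y) = \<epsilon>)"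

lemma flat_tri: "flat L \<Longrightarrow> i \<in> L \<Longrightarrow> j \<in> L \<Longrightarrow> k \<in> L \<Longrightarrow> i \<noteq> j \<Longrightarrow> i \<noteq> k \<Longrightarrow> j \<noteq> k \<Longrightarrow> tri i j k"
  unfolding flat_def by blast

lemma flat_closed: "flat L \<Longrightarrow> i \<in> L \<Longrightarrow> j \<in> L \<Longrightarrow> tri i j e \<Longrightarrow> e \<in> L"
  unfolding flat_def by blast

lemma splitsE:
  assumes "splits L" "x \<in> H" "e \<in> N" "e \<notin> L"
  obtains y where "y \<in> H" "y \<inter> L = x \<inter> L" "(e \<in> y) = \<epsilon>"
  using assms unfolding splits_def by blast

lemma Int_eqD: "x \<inter> L = y \<inter> L \<Longrightarrow> k \<in> L \<Longrightarrow> (k \<in> x) = (k \<in> y)"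
  by blast

text \<open>A vertex of the cube on \<open>i\<close>, \<open>j\<close>, \<open>k\<close> and its
  three neighbours meet every antipodal pair of octants, whereas a collinear triple misses such a
  pair. So the projection to a line has degree at most two.\<close>

lemma flat_degree:
  assumes "flat L" "x \<in> H" "i \<in> L" "j \<in> L" "k \<in> L" "i \<noteq> j" "i \<noteq> k" "j \<noteq> k"
    and p: "p \<in> H" "p \<inter> L = flip i x \<inter> L" and q: "q \<in> H" "q \<inter> L = flip j x \<inter> L"
    and r: "r \<in> H" "r \<inter> L = flip k x \<inter> L"
  shows False
proof -
  have t: "tri i j k" using flat_tri assms by blast
  obtain b c where m: "\<not> hit3 i j k (i \<in> x) b c" "\<not> hit3 i j k (i \<notin> x) (\<not> b) (\<not> c)" using tri_missing[OF t] .
  note P = Int_eqD[OF p(2)] and Q = Int_eqD[OF q(2)] and R = Int_eqD[OF r(2)]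
  have "hit3 i j k (i \<in> x) (j \<in> x) (k \<in> x)" using assms(2) unfolding hit3_def by blast
  moreover have "hit3 i j k (i \<notin> x) (j \<in> x) (k \<in> x)"
    unfolding hit3_def using p(1) P[of i] P[of j] P[of k] assms by (intro bexI[of _ p]) auto
  moreover have "hit3 i j k (i \<in> x) (j \<notin> x) (k \<in> x)"
    unfolding hit3_def using q(1) Q[of i] Q[of j] Q[of k] assms by (intro bexI[of _ q]) auto
  moreover have "hit3 i j k (i \<in> x) (j \<in> x) (k \<notin> x)"
    unfolding hit3_def using r(1) R[of i] R[of j] R[of k] assms by (intro bexI[of _ r]) auto
  ultimately show False using m by (cases b; cases c; cases "j \<in> x"; cases "k \<in> x") auto
qed

text \<open>A vertex of the cycle \<open>H\<close> projected to \<open>L\<close> is determined by the two coordinates of its incident edges.\<close>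
lemma flat_splits:
  assumes L: "flat L"
  shows "splits L"
  unfolding splits_def
proof (intro conjI ballI allI)
  show LN: "L \<subseteq> N" using L unfolding flat_def by blast
  fix x e \<epsilon> assume x: "x \<in> H" and e: "e \<in> N - L"
  \<comment> \<open>The coordinates of the edges at \<open>x\<close> in the projection to
    \<open>L\<close>; there are at most two of them, so they fit into a pair
    \<open>{i, j}\<close>.\<close>
  define Nb where "Nb = {i \<in> L. \<exists>z\<in>H. z \<inter> L = flip i x \<inter> L}"
  have deg: "i = j \<or> i = k \<or> j = k" if "i \<in> Nb" "j \<in> Nb" "k \<in> Nb" for i j k
    using that flat_degree[OF L x, of i j k] unfolding Nb_def by blast
  obtain i0 j0 where ij0: "i0 \<in> L" "j0 \<in> L" "i0 \<noteq> j0" using L unfolding flat_def by blast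
  obtain i j where ij: "i \<in> L" "j \<in> L" "i \<noteq> j" "Nb \<subseteq> {i, j}"
  proof (cases "Nb = {}")
    case True
    then show ?thesis using ij0 that by blast
  next
    case False
    then obtain i where i: "i \<in> Nb" by blast
    show ?thesis
    proof (cases "Nb \<subseteq> {i}")
      case True
      obtain j where "j \<in> L" "j \<noteq> i" using ij0 by metis
      then show ?thesis using that[of i j] i True unfolding Nb_def by blast
    next
      case False
      then obtain j where "j \<in> Nb" "j \<noteq> i" by blast
      then show ?thesis using that[of i j] i deg unfolding Nb_def by blast
    qed
  qed
  have "\<not> tri i j e" using flat_closed[OF L ij(1,2)] e by blast
  then have "hit3 i j e (i \<in> x) (j \<in> x) \<epsilon>" using ij e LN unfolding tri_def by blast
  then obtain y where y: "y \<in> H" "(i \<in> y) = (i \<in> x)" "(j \<in> y) = (j \<in> x)" "(e \<in> y) = \<epsilon>"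
    unfolding hit3_def by blast
  \<comment> \<open>Otherwise a geodesic of the projection from \<open>x\<close> to \<open>y\<close>
    would leave \<open>x\<close> along an edge in \<open>Nb\<close>, although \<open>y\<close>
    agrees with \<open>x\<close> in \<open>i\<close> and \<open>j\<close>.\<close>
  have "y \<inter> L = x \<inter> L"
  proof (rule ccontr)
    assume "y \<inter> L \<noteq> x \<inter> L"
    then obtain k where "k \<in> Nb" "(k \<in> x) \<noteq> (k \<in> y)"
      using projection_step[OF x y(1), of L] unfolding Nb_def by blast
    then show False using ij(4) y by blast
  qed
  then show "\<exists>y\<in>H. y \<inter> L = x \<inter> L \<and> (e \<in> y) = \<epsilon>" using y by blast
qed

text \<open>\<open>prehull\<close> for the two fibres over the ends of an edge \<open>a\<close> of
  the projection: a geodesic inside one fibre extends within it to a point with a neighbour in the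
  other fibre.\<close>

lemma strip:
  assumes L: "splits L" and a: "a \<in> L" and x: "x \<in> H" and y: "y \<in> H" "y \<inter> L = x \<inter> L"
    and z: "z \<in> H" "z \<inter> L = flip a x \<inter> L"
  obtains u where "u \<in> H" "flip a u \<in> H" "u \<inter> L = x \<inter> L" "\<And>k. (k \<in> x) \<noteq> (k \<in> y) \<Longrightarrow> (k \<in> u) = (k \<in> y)"
proof -
  let ?A = "x \<inter> (L - {a})"
  let ?K = "{w \<in> H. w \<inter> (L - {a}) = ?A}"
  have "stretchable {a} ?K"
  proof (rule prehull[OF refl])
    fix w j assume w: "w \<in> ?K" and j: "j \<noteq> a"
    have zK: "z \<in> ?K" using z by auto
    have za: "(a \<in> z) \<noteq> (a \<in> x)" using Int_eqD[OF z(2) a] by simp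
    obtain p where p: "p \<in> ?K" "(a \<in> p) \<noteq> (a \<in> w)"
      using zK za x by (cases "(a \<in> w) = (a \<in> x)") auto
    consider "j \<in> L" | "j \<notin> N" | "j \<in> N" "j \<notin> L" by blast
    then show "\<exists>z\<in>?K. (j \<in> z) = (j \<in> w) \<and> (a \<in> z) \<noteq> (a \<in> w)"
    proof cases
      case 1
      then have "(j \<in> p) = (j \<in> w)" using p(1) w j by blast
      then show ?thesis using p by blast
    next
      case 2
      then show ?thesis using p w outside[of p j] outside[of w j] by blast
    next
      case 3
      have "p \<in> H" using p(1) by blast
      obtain q where q: "q \<in> H" "q \<inter> L = p \<inter> L" "(j \<in> q) = (j \<in> w)" using splitsE[OF L \<open>p \<in> H\<close> 3] by blast
      then have "q \<in> ?K" "(a \<in> q) = (a \<in> p)" using p(1) a by blast+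
      then show ?thesis using q p(2) by blast
    qed
  qed
  moreover have "x \<in> ?K" "y \<in> ?K" "(a \<in> x) = (a \<in> y)" using x y a by blast+
  ultimately obtain u where u: "u \<in> ?K" "flip a u \<in> ?K" "(a \<in> u) = (a \<in> x)"
      "\<And>k. (k \<in> x) \<noteq> (k \<in> y) \<Longrightarrow> (k \<in> u) = (k \<in> y)"
    using stretchableE[of "{a}" ?K a x y] by blast
  have "u \<inter> L = x \<inter> L" using u(1,3) by blast
  then show ?thesis using that u by blast
qed

section \<open>Nested coordinates in the fibres over a line\<close>

text \<open>The fibre over the vertex \<open>x \<inter> L\<close> meets a quadrant of
  \<open>b\<close> and \<open>b'\<close>. Its failure is a nesting: in that fibre the side \<beta>
  of \<open>b\<close> lies inside the side of \<open>b'\<close> opposite to \<beta>'.\<close>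

definition quad :: "nat set \<Rightarrow> nat \<Rightarrow> nat \<Rightarrow> nat set \<Rightarrow> bool \<Rightarrow> bool \<Rightarrow> bool" where
  "quad L b b' x \<beta> \<beta>' \<longleftrightarrow> (\<exists>y\<in>H. y \<inter> L = x \<inter> L \<and> (b \<in> y) = \<beta> \<and> (b' \<in> y) = \<beta>')"

lemma quad_cong: "x \<inter> L = z \<inter> L \<Longrightarrow> quad L b b' x = quad L b b' z"
  unfolding quad_def by simp

lemma quad_swap: "quad L b' b x \<beta>' \<beta> = quad L b b' x \<beta> \<beta>'"
  unfolding quad_def by blast

text \<open>Stretching from the opposite quadrant to the desired one fixes both signs, because both
  changed on the way; the edge found across \<open>a\<close> then carries them into the fibre over
  \<open>z\<close>.\<close>

lemma quad_full_step:
  assumes L: "splits L" and a: "a \<in> L" and b: "b \<notin> L" "b' \<notin> L"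
    and x: "x \<in> H" and z: "z \<in> H" "z \<inter> L = flip a x \<inter> L" and full: "\<And>\<beta> \<beta>'. quad L b b' x \<beta> \<beta>'"
  shows "quad L b b' z \<beta> \<beta>'"
proof -
  obtain p where p: "p \<in> H" "p \<inter> L = x \<inter> L" "(b \<in> p) = \<beta>" "(b' \<in> p) = \<beta>'"
    using full[of \<beta> \<beta>'] unfolding quad_def by blast
  obtain q where q: "q \<in> H" "q \<inter> L = x \<inter> L" "(b \<in> q) = (\<not> \<beta>)" "(b' \<in> q) = (\<not> \<beta>')"
    using full[of "\<not> \<beta>" "\<not> \<beta>'"] unfolding quad_def by blast
  have "p \<inter> L = q \<inter> L" "z \<inter> L = flip a q \<inter> L" using p q z by auto
  from strip[OF L a q(1) p(1) this(1) z(1) this(2)] obtain u where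
    u: "u \<in> H" "flip a u \<in> H" "u \<inter> L = q \<inter> L" "\<And>k. (k \<in> q) \<noteq> (k \<in> p) \<Longrightarrow> (k \<in> u) = (k \<in> p)" by blast
  have "(b \<in> u) = \<beta>" "(b' \<in> u) = \<beta>'" using u(4)[of b] u(4)[of b'] p q by auto
  moreover have "b \<noteq> a" "b' \<noteq> a" using a b by auto
  moreover have "flip a u \<inter> L = z \<inter> L" using u(3) q z by auto
  ultimately show ?thesis unfolding quad_def using u(2) by (intro bexI[of _ "flip a u"]) auto
qed

text \<open>Two adjacent missing quadrants would make a coordinate constant on the fibre, against
  \<open>splits\<close>. Two opposite ones would disconnect the fibre, against
  \<open>square\<close>, since points between two points of a fibre stay in it.\<close>

lemma quad_missing_unique:
  assumes L: "splits L" and b: "b \<in> N" "b \<notin> L" "b' \<in> N" "b' \<notin> L" "b \<noteq> b'" and x: "x \<in> H"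
    and m: "\<not> quad L b b' x \<beta> \<beta>'" "\<not> quad L b b' x \<gamma> \<gamma>'"
  shows "\<gamma> = \<beta> \<and> \<gamma>' = \<beta>'"
proof (rule ccontr)
  assume ne: "\<not> ?thesis"
  obtain p where p: "p \<in> H" "p \<inter> L = x \<inter> L" "(b \<in> p) = \<beta>" using splitsE[OF L x b(1,2)] by blast
  obtain q where q: "q \<in> H" "q \<inter> L = x \<inter> L" "(b \<in> q) = \<gamma>" using splitsE[OF L x b(1,2)] by blast
  obtain r where r: "r \<in> H" "r \<inter> L = x \<inter> L" "(b' \<in> r) = \<gamma>'" using splitsE[OF L x b(3,4)] by blast
  have p': "(b' \<in> p) = (\<not> \<beta>')" using p m(1) unfolding quad_def by blast
  have q': "(b' \<in> q) = (\<not> \<gamma>')" using q m(2) unfolding quad_def by blast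
  have r': "(b \<in> r) = (\<not> \<gamma>)" using r m(2) unfolding quad_def by blast
  show False
  proof (cases "\<gamma> = \<beta>")
    case True
    then have "(b' \<in> p) = \<gamma>'" using p' ne by blast
    then show False using p True m(2) unfolding quad_def by blast
  next
    case False
    show False
    proof (cases "\<gamma>' = \<beta>'")
      case True
      then show False using r r' False m(1) unfolding quad_def by blast
    next
      case g: False
      obtain z where z: "z \<in> H" "((b \<in> z) = (b \<in> p)) = ((b' \<in> z) \<noteq> (b' \<in> p))"
        "\<forall>k. (k \<in> p) = (k \<in> q) \<longrightarrow> (k \<in> z) = (k \<in> p)"
        using square[OF p(1) q(1), of b b'] p q p' q' False g b by auto
      have "z \<inter> L = x \<inter> L" using z(3) p(2) q(2) by blast
      moreover have "(b \<in> z) = \<beta> \<and> (b' \<in> z) = \<beta>' \<or> (b \<in> z) = \<gamma> \<and> (b' \<in> z) = \<gamma>'"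
        using z(2) p(3) p' False g by blast
      ultimately show False using z(1) m unfolding quad_def by blast
    qed
  qed
qed

text \<open>In an even cycle the edges of a given coordinate \<open>a\<close> form one antipodal
  pair. Were \<open>r\<close> elsewhere, some \<open>j\<close> would agree with both ends of the
  edge while \<open>i\<close> differs, and all four octants with that sign of \<open>j\<close> would
  be hit.\<close>

lemma flat_edge:
  assumes L: "flat L" and a: "a \<in> L" and x: "x \<in> H" and z: "z \<in> H" "z \<inter> L = flip a x \<inter> L"
    and r: "r \<in> H" "flip a r \<in> H" "(a \<in> r) = (a \<in> x)"
  shows "r \<inter> L = x \<inter> L \<or> r \<inter> L = L - z"
proof (rule ccontr)
  assume no: "\<not> ?thesis"
  then obtain i where i: "i \<in> L" "(i \<in> r) \<noteq> (i \<in> x)" by blast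
  obtain j where j: "j \<in> L" "(j \<in> r) = (j \<in> z)" using no by blast
  note Z = Int_eqD[OF z(2)]
  have ia: "i \<noteq> a" using i r by auto
  have ja: "j \<noteq> a" using j r Z[OF a] by auto
  have jx: "(j \<in> x) = (j \<in> r)" using j ja Z[of j] by simp
  have ij: "i \<noteq> j" using i jx by auto
  obtain b c where m: "\<not> hit3 j a i (j \<in> x) b c" using tri_missing[OF flat_tri[OF L j(1) a i(1) ja ij[symmetric] ia[symmetric]]] .
  have "hit3 j a i (j \<in> x) (a \<in> x) (i \<in> x)" unfolding hit3_def using x by blast
  moreover have "hit3 j a i (j \<in> x) (a \<notin> x) (i \<in> x)" unfolding hit3_def using z(1) Z[of j] Z[of a] Z[of i] a i j ia ja
    by (intro bexI[of _ z]) auto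
  moreover have "hit3 j a i (j \<in> x) (a \<in> x) (i \<notin> x)" unfolding hit3_def using r(1,3) jx i by blast
  moreover have "hit3 j a i (j \<in> x) (a \<notin> x) (i \<notin> x)" unfolding hit3_def using r(2,3) jx i ia ja
    by (intro bexI[of _ "flip a r"]) auto
  ultimately show False using m by (cases b; cases c; cases "a \<in> x"; cases "i \<in> x") auto
qed

text \<open>The missing quadrant can only jump across an edge whose coordinate lies on a common line with \<open>b\<close> and \<open>b'\<close>.\<close>
lemma quad_missing_step:
  assumes L: "flat L" and b: "b \<in> N" "b \<notin> L" "b' \<in> N" "b' \<notin> L" "b \<noteq> b'" and a: "a \<in> L" "\<not> tri a b b'"
    and x: "x \<in> H" and z: "z \<in> H" "z \<inter> L = flip a x \<inter> L" and m: "\<not> quad L b b' x \<beta> \<beta>'"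
  shows "\<not> quad L b b' z \<beta> \<beta>'"
proof
  assume present: "quad L b b' z \<beta> \<beta>'"
  note S = flat_splits[OF L]
  have LN: "L \<subseteq> N" using L unfolding flat_def by blast
  have xz: "x \<inter> L = flip a z \<inter> L" using z(2) by auto
  note Z = Int_eqD[OF z(2)]
  have ab: "b \<noteq> a" "b' \<noteq> a" using a b by auto
  \<comment> \<open>The fibre over \<open>z\<close> misses some quadrant as well, since fullness
    would pass back to the fibre over \<open>x\<close>. What remains is to compare the two missing
    quadrants.\<close>
  obtain \<gamma> \<gamma>' where g: "\<not> quad L b b' z \<gamma> \<gamma>'"
    using quad_full_step[OF S a(1) b(2,4) z(1) x xz, of \<beta> \<beta>'] m by blast
  obtain q where q: "q \<in> H" "q \<inter> L = z \<inter> L" "(b \<in> q) = \<beta>" "(b' \<in> q) = \<beta>'"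
    using present unfolding quad_def by blast
  have xq: "(k \<in> q) = (k \<in> x)" if "k \<in> L" "k \<noteq> a" for k using Int_eqD[OF q(2) that(1)] Z[OF that(1)] that by simp
  have xqa: "(a \<in> q) = (a \<notin> x)" using Int_eqD[OF q(2) a(1)] Z[OF a(1)] by simp
  have adjacent: False if g': "(\<gamma> = \<beta>) \<noteq> (\<gamma>' = \<beta>')"
  proof -
    have "quad L b b' x \<gamma> \<gamma>'" using quad_missing_unique[OF S b x m] g' by blast
    then obtain p where p: "p \<in> H" "p \<inter> L = x \<inter> L" "(b \<in> p) = \<gamma>" "(b' \<in> p) = \<gamma>'"
      unfolding quad_def by blast
    \<comment> \<open>The only one of \<open>b\<close> and \<open>b'\<close> in which the two
      missing quadrants differ. \<open>p\<close> and \<open>q\<close> differ in \<open>a\<close> and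
      \<open>c\<close>, and a point between them that changes just one of these lies in the missing
      quadrant over \<open>x\<close> or over \<open>z\<close>.\<close>
    define c where "c = (if \<gamma> = \<beta> then b' else b)"
    have c: "c \<noteq> a" "c \<notin> L" "(c \<in> p) \<noteq> (c \<in> q)" unfolding c_def using ab b g' p q by auto
    have pa: "(a \<in> p) = (a \<in> x)" using Int_eqD[OF p(2) a(1)] .
    obtain r where r: "r \<in> H" "((a \<in> r) = (a \<in> p)) = ((c \<in> r) \<noteq> (c \<in> p))"
      "\<forall>k. (k \<in> p) = (k \<in> q) \<longrightarrow> (k \<in> r) = (k \<in> p)"
      using square[OF p(1) q(1), of a c] pa xqa c by auto
    have rL: "(k \<in> r) = (k \<in> x)" if "k \<in> L" "k \<noteq> a" for k
      using r(3) xq[OF that] Int_eqD[OF p(2) that(1)] by auto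
    show False
    proof (cases "(a \<in> r) = (a \<in> x)")
      case True
      have "r \<inter> L = x \<inter> L" using rL True by blast
      moreover have "(b \<in> r) = \<beta>" "(b' \<in> r) = \<beta>'" using r(2,3) True pa p q g' unfolding c_def by (auto split: if_splits)
      ultimately show False using m r(1) unfolding quad_def by blast
    next
      case False
      have "(k \<in> r) = (k \<in> z)" if "k \<in> L" for k
        using rL[OF that] False Z[OF that] by (cases "k = a") auto
      then have "r \<inter> L = z \<inter> L" by blast
      moreover have "(b \<in> r) = \<gamma>" "(b' \<in> r) = \<gamma>'" using r(2,3) False pa p q g' unfolding c_def by (auto split: if_splits)
      ultimately show False using g r(1) unfolding quad_def by blast
    qed
  qed
  have "\<not> (\<gamma> = \<beta> \<and> \<gamma>' = \<beta>')"
  proof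
    assume "\<gamma> = \<beta> \<and> \<gamma>' = \<beta>'"
    then have "quad L b b' z \<gamma> \<gamma>'" using present by (simp only:)
    then show False using g by blast
  qed
  then have "\<gamma> \<noteq> \<beta> \<and> \<gamma>' \<noteq> \<beta>'" using adjacent by blast
  then have opp: "\<gamma> = (\<not> \<beta>)" "\<gamma>' = (\<not> \<beta>')" by auto
  \<comment> \<open>The case of opposite missing quadrants. The full octants of \<open>a\<close>,
    \<open>b\<close>, \<open>b'\<close> give a point on the side of \<open>x\<close> in the quadrant
    missing there. An edge across \<open>a\<close> from it towards \<open>q\<close> lies over the
    edge at \<open>x\<close> or over the opposite one, where the antipode takes over.\<close>
  have "hit3 a b b' (a \<in> x) \<beta> \<beta>'" using a b ab LN unfolding tri_def by blast
  then obtain w where w: "w \<in> H" "(a \<in> w) = (a \<in> x)" "(b \<in> w) = \<beta>" "(b' \<in> w) = \<beta>'" unfolding hit3_def by blast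
  obtain r where r: "r \<in> H" "flip a r \<in> H" "(a \<in> r) = (a \<in> w)" "\<forall>k. (k \<in> w) = (k \<in> q) \<longrightarrow> (k \<in> r) = (k \<in> w)"
    using crossing[OF w(1) q(1), of a] w xqa by auto
  have rb: "(b \<in> r) = \<beta>" "(b' \<in> r) = \<beta>'" using r(4) w q by auto
  from flat_edge[OF L a(1) x z r(1,2)] r(3) w(2) have "r \<inter> L = x \<inter> L \<or> r \<inter> L = L - z" by auto
  then show False
  proof
    assume "r \<inter> L = x \<inter> L"
    then show False using m r(1) rb unfolding quad_def by blast
  next
    assume "r \<inter> L = L - z"
    then have "(N - r) \<inter> L = z \<inter> L" using LN by blast
    moreover have "(b \<in> N - r) = \<gamma>" "(b' \<in> N - r) = \<gamma>'" using rb opp b by auto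
    ultimately show False using g antipode[OF r(1)] unfolding quad_def by blast
  qed
qed

text \<open>Without a collinear \<open>a\<close> the missing quadrant would be carried unchanged
  round the line to the antipode of \<open>x\<close>. Read back through complements, the fibre over
  \<open>x\<close> would then miss the opposite quadrant as well.\<close>

lemma quad_missing_tri:
  assumes L: "flat L" and b: "b \<in> N" "b \<notin> L" "b' \<in> N" "b' \<notin> L" "b \<noteq> b'"
    and x: "x \<in> H" and m: "\<not> quad L b b' x \<beta> \<beta>'"
  shows "\<exists>a\<in>L. tri a b b'"
proof (rule ccontr)
  assume no: "\<not> ?thesis"
  note S = flat_splits[OF L]
  have "\<not> quad L b b' (N - x) \<beta> \<beta>'"
  proof (rule propagate[of x "\<lambda>x. \<not> quad L b b' x \<beta> \<beta>'"])
    show "\<not> quad L b b' z \<beta> \<beta>'" if "\<not> quad L b b' x \<beta> \<beta>'" "z \<inter> L = x \<inter> L" for x z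
      using that quad_cong[OF that(2)] by simp
    show "\<not> quad L b b' z \<beta> \<beta>'" if "a \<in> L" "x \<in> H" "z \<in> H" "\<not> quad L b b' x \<beta> \<beta>'" "z \<inter> L = flip a x \<inter> L" for a x z
      using quad_missing_step[OF L b that(1) _ that(2,3,5,4)] no that(1) by blast
  qed (use x m antipode in auto)
  moreover have "quad L b b' x (\<not> \<beta>) (\<not> \<beta>')" using quad_missing_unique[OF S b x m] by blast
  then obtain y where y: "y \<in> H" "y \<inter> L = x \<inter> L" "(b \<in> y) = (\<not> \<beta>)" "(b' \<in> y) = (\<not> \<beta>')"
    unfolding quad_def by blast
  have "(N - y) \<inter> L = (N - x) \<inter> L" using y(2) by blast
  moreover have "(b \<in> N - y) = \<beta>" "(b' \<in> N - y) = \<beta>'" using y b by auto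
  ultimately show False using antipode[OF y(1)] unfolding quad_def by blast
qed

lemma flat_two_neighbours:
  assumes L: "flat L" and x: "x \<in> H"
  obtains a d y z where "a \<in> L" "d \<in> L" "a \<noteq> d" "y \<in> H" "y \<inter> L = flip a x \<inter> L" "z \<in> H" "z \<inter> L = flip d x \<inter> L"
proof -
  have LN: "L \<subseteq> N" using L unfolding flat_def by blast
  obtain i j where ij: "i \<in> L" "j \<in> L" "i \<noteq> j" using L unfolding flat_def by blast
  obtain w where w: "w \<in> H" "(i \<in> w) = (i \<notin> x)" using single_full[of i "i \<notin> x"] ij LN by blast
  then have "x \<inter> L \<noteq> w \<inter> L" using ij by blast
  then obtain a y where a: "a \<in> L" "y \<in> H" "y \<inter> L = flip a x \<inter> L"
    using projection_step[OF x w(1)] by blast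
  obtain k where k: "k \<in> L" "k \<noteq> a" using ij by metis
  \<comment> \<open>Heading for a point that agrees with \<open>x\<close> in \<open>a\<close> forces
    the second edge at \<open>x\<close> to use another coordinate.\<close>
  obtain w' where w': "w' \<in> H" "(a \<in> w') = (a \<in> x)" "(k \<in> w') = (k \<notin> x)"
    using pair_full[of a k "a \<in> x" "k \<notin> x"] k a LN by blast
  then have "x \<inter> L \<noteq> w' \<inter> L" using k by blast
  then obtain d z where d: "d \<in> L" "(d \<in> x) \<noteq> (d \<in> w')" "z \<in> H" "z \<inter> L = flip d x \<inter> L"
    using projection_step[OF x w'(1)] by blast
  have "a \<noteq> d" using d w' by blast
  then show ?thesis using that a d by blast
qed

text \<open>If two coordinates \<open>b1, b2\<close> outside \<open>L\<close> were nested in the fibre over a vertex of \<open>L\<close>, take them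
  innermost there. Then \<open>b1\<close> and a coordinate \<open>a\<close> bounding the fibre form a flat \<open>{a, b1}\<close>, and two
  coordinates of \<open>L\<close> other than \<open>a\<close> lie on a common line with \<open>b1\<close> and \<open>b2\<close>.\<close>
lemma wide_flat_quad:
  assumes L: "flat L" and wide: "i0 \<in> L" "j0 \<in> L" "k0 \<in> L" "i0 \<noteq> j0" "i0 \<noteq> k0" "j0 \<noteq> k0"
    and b: "b \<in> N" "b \<notin> L" "b' \<in> N" "b' \<notin> L" "b \<noteq> b'" and x: "x \<in> H"
  shows "quad L b b' x \<beta> \<beta>'"
proof (rule ccontr)
  assume miss: "\<not> quad L b b' x \<beta> \<beta>'"
  note S = flat_splits[OF L]
  have LN: "L \<subseteq> N" using L unfolding flat_def by blast
  \<comment> \<open>Sides of coordinates within the fibre over \<open>x\<close>, given as a pair of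
    coordinate and sign. Missing quadrants correspond to inclusions between these sides.\<close>
  define hs where "hs = (\<lambda>p. {y \<in> H. y \<inter> L = x \<inter> L \<and> (fst p \<in> y) = snd p})"
  define nest where "nest = (\<lambda>p q. fst p \<in> N - L \<and> fst q \<in> N - L \<and> fst p \<noteq> fst q \<and> hs p \<subseteq> hs q)"
  have hsI: "y \<in> hs (e, \<epsilon>) \<longleftrightarrow> y \<in> H \<and> y \<inter> L = x \<inter> L \<and> (e \<in> y) = \<epsilon>" for y e \<epsilon>
    unfolding hs_def by simp
  have hs_subI: "hs (e, \<epsilon>) \<subseteq> hs (e', \<not> \<epsilon>')" if "\<not> quad L e e' x \<epsilon> \<epsilon>'" for e \<epsilon> e' \<epsilon>'
  proof
    fix y assume "y \<in> hs (e, \<epsilon>)"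
    then have "y \<in> H" "y \<inter> L = x \<inter> L" "(e \<in> y) = \<epsilon>" using hsI by simp_all
    moreover from this have "(e' \<in> y) \<noteq> \<epsilon>'" using that unfolding quad_def by blast
    ultimately show "y \<in> hs (e', \<not> \<epsilon>')" using hsI by simp
  qed
  have hs_subD: "\<not> quad L e e' x \<epsilon> (\<not> \<epsilon>')" if "hs (e, \<epsilon>) \<subseteq> hs (e', \<epsilon>')" for e \<epsilon> e' \<epsilon>'
  proof
    assume "quad L e e' x \<epsilon> (\<not> \<epsilon>')"
    then obtain y where y: "y \<in> H" "y \<inter> L = x \<inter> L" "(e \<in> y) = \<epsilon>" "(e' \<in> y) = (\<not> \<epsilon>')" unfolding quad_def by blast
    then have "y \<in> hs (e, \<epsilon>)" using hsI by simp
    then have "y \<in> hs (e', \<epsilon>')" using that by blast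
    then show False using hsI y(4) by simp
  qed
  have fin: "finite (hs p)" for p
    using finite_subset[OF sub_N] finite_N unfolding hs_def by simp
  have nestI: "nest (e, \<epsilon>) (e', \<epsilon>')" if "e \<in> N - L" "e' \<in> N - L" "e \<noteq> e'" "hs (e, \<epsilon>) \<subseteq> hs (e', \<epsilon>')" for e \<epsilon> e' \<epsilon>'
    unfolding nest_def using that by simp
  have "nest (b, \<beta>) (b', \<not> \<beta>')"
  proof (rule nestI)
    show "hs (b, \<beta>) \<subseteq> hs (b', \<not> \<beta>')" by (rule hs_subI[OF miss])
  qed (use b in auto)
  then have "\<exists>q. nest (b, \<beta>) q" by blast
  \<comment> \<open>Innermost is meant in two stages: a smallest side \<open>p\<close> contained in
    a side of another coordinate, and then a smallest such side \<open>q\<close> around it.\<close>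
  from ex_has_least_nat[of "\<lambda>p. \<exists>q. nest p q" "(b, \<beta>)" "\<lambda>p. card (hs p)", OF this]
  obtain p where p: "(\<exists>q. nest p q) \<and> (\<forall>r. (\<exists>q. nest r q) \<longrightarrow> card (hs p) \<le> card (hs r))" ..
  then have pmin: "\<And>r q. nest r q \<Longrightarrow> card (hs p) \<le> card (hs r)" by blast
  from p obtain q0 where "nest p q0" by blast
  from ex_has_least_nat[of "nest p" q0 "\<lambda>q. card (hs q)", OF this]
  obtain q where q': "nest p q \<and> (\<forall>r. nest p r \<longrightarrow> card (hs q) \<le> card (hs r))" ..
  then have q: "nest p q" and qmin: "\<And>r. nest p r \<Longrightarrow> card (hs q) \<le> card (hs r)" by blast+
  obtain b1 \<beta>1 where pe: "p = (b1, \<beta>1)" by (cases p)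
  obtain b2 \<beta>2 where qe: "q = (b2, \<beta>2)" by (cases q)
  have b1: "b1 \<in> N" "b1 \<notin> L" and b2: "b2 \<in> N" "b2 \<notin> L" and b12: "b1 \<noteq> b2" and sub: "hs (b1, \<beta>1) \<subseteq> hs (b2, \<beta>2)"
    using q unfolding nest_def pe qe by auto
  have mx: "\<not> quad L b1 b2 x \<beta>1 (\<not> \<beta>2)" by (rule hs_subD[OF sub])
  \<comment> \<open>Of the two edges of the line at \<open>x\<close>, at most one can be collinear
    with \<open>b1\<close> and \<open>b2\<close>; two would put \<open>b1\<close> on
    \<open>L\<close>. Across the other the nesting persists.\<close>
  obtain a z where a: "a \<in> L" and z: "z \<in> H" "z \<inter> L = flip a x \<inter> L" and nt: "\<not> tri a b1 b2"
  proof -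
    from flat_two_neighbours[OF L x] obtain a d y z where
      n: "a \<in> L" "d \<in> L" "a \<noteq> d" "y \<in> H" "y \<inter> L = flip a x \<inter> L" "z \<in> H" "z \<inter> L = flip d x \<inter> L" .
    have "\<not> (tri a b1 b2 \<and> tri d b1 b2)"
    proof
      assume "tri a b1 b2 \<and> tri d b1 b2"
      then have "tri b1 a d" using tri_share[of b1 b2 a d] n(3) tri_rot by blast
      then have "tri a d b1" using tri_rot by blast
      then show False using flat_closed[OF L n(1,2)] b1 by blast
    qed
    then show ?thesis using that n by blast
  qed
  have aN: "a \<in> N" "a \<noteq> b1" "a \<noteq> b2" using a LN b1 b2 by auto
  have za: "(a \<in> z) = (a \<notin> x)" using Int_eqD[OF z(2) a] by simp
  have mz: "\<not> quad L b1 b2 z \<beta>1 (\<not> \<beta>2)" using quad_missing_step[OF L b1 b2 b12 a nt x z mx] .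
  \<comment> \<open>An edge across \<open>a\<close> in the gap between the nested sides: inside that
    of \<open>b2\<close>, outside that of \<open>b1\<close>. It later separates \<open>q\<close>
    from any side squeezed in between.\<close>
  obtain r where r: "r \<in> H" "flip a r \<in> H" "r \<inter> L = x \<inter> L" "(b1 \<in> r) = (\<not> \<beta>1)" "(b2 \<in> r) = \<beta>2"
  proof -
    have "quad L b1 b2 x (\<not> \<beta>1) \<beta>2" using quad_missing_unique[OF S b1 b2 b12 x mx] by blast
    then obtain u where u: "u \<in> H" "u \<inter> L = x \<inter> L" "(b1 \<in> u) = (\<not> \<beta>1)" "(b2 \<in> u) = \<beta>2" unfolding quad_def by blast
    have "quad L b1 b2 z (\<not> \<beta>1) \<beta>2" using quad_missing_unique[OF S b1 b2 b12 z(1) mz] by blast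
    then obtain v where v: "v \<in> H" "v \<inter> L = z \<inter> L" "(b1 \<in> v) = (\<not> \<beta>1)" "(b2 \<in> v) = \<beta>2" unfolding quad_def by blast
    have ua: "(a \<in> u) = (a \<in> x)" "(a \<in> v) = (a \<notin> x)" using Int_eqD[OF u(2) a] Int_eqD[OF v(2) a] za by auto
    then have "(a \<in> u) \<noteq> (a \<in> v)" by auto
    from crossing[OF u(1) v(1) this] obtain r where r: "r \<in> H" "flip a r \<in> H" "(a \<in> r) = (a \<in> u)"
      "\<forall>k. (k \<in> u) = (k \<in> v) \<longrightarrow> (k \<in> r) = (k \<in> u)" by blast
    have "(k \<in> r) = (k \<in> x)" if k: "k \<in> L" for k
    proof (cases "k = a")
      case True
      then show ?thesis using r(3) ua by simp
    next
      case False
      then have "(k \<in> u) = (k \<in> x)" "(k \<in> v) = (k \<in> x)"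
        using Int_eqD[OF u(2) k] Int_eqD[OF v(2) k] Int_eqD[OF z(2) k] by auto
      then show ?thesis using r(4) by blast
    qed
    then have "r \<inter> L = x \<inter> L" by blast
    then show ?thesis using that r u v by blast
  qed
  \<comment> \<open>A third coordinate \<open>e\<close> on the line through \<open>a\<close> and
    \<open>b1\<close> would have a side nested inside \<open>p\<close> or around \<open>p\<close>,
    according to the sign of \<open>b1\<close> in the missing octant; the two minimalities exclude
    both.\<close>
  have nt1: False if t: "tri a b1 e" for e
  proof -
    have eL: "e \<notin> L"
    proof
      assume "e \<in> L"
      then show False using flat_closed[OF L a, of e b1] tri_swap23[OF t] b1 by blast
    qed
    have e: "e \<in> N" "e \<noteq> b1" "e \<noteq> a" "e \<noteq> b2" using triD[OF t] t nt by auto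
    obtain \<mu> \<epsilon> where m: "\<not> hit3 a b1 e (a \<in> x) \<mu> \<epsilon>" "\<not> hit3 a b1 e (a \<notin> x) (\<not> \<mu>) (\<not> \<epsilon>)" using tri_missing[OF t] .
    show False
    proof (cases "\<mu> = \<beta>1")
      case False
      have s: "hs (e, \<epsilon>) \<subseteq> hs (b1, \<beta>1)"
      proof
        fix y assume "y \<in> hs (e, \<epsilon>)"
        then have y: "y \<in> H" "y \<inter> L = x \<inter> L" "(e \<in> y) = \<epsilon>" using hsI by auto
        have "(a \<in> y) = (a \<in> x)" using Int_eqD[OF y(2) a] .
        then have "(b1 \<in> y) \<noteq> \<mu>" using m(1) y unfolding hit3_def by blast
        then show "y \<in> hs (b1, \<beta>1)" using y False hsI by simp
      qed
      have "nest (e, \<epsilon>) (b1, \<beta>1)" using s e eL b1 by (intro nestI) auto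
      then have "card (hs (b1, \<beta>1)) \<le> card (hs (e, \<epsilon>))" using pmin pe by blast
      then have eq: "hs (e, \<epsilon>) = hs (b1, \<beta>1)" using card_seteq[OF fin s] by blast
      have "\<not> quad L b1 e x \<beta>1 (\<not> \<epsilon>)" using eq hs_subD by simp
      moreover have "\<not> quad L e b1 x \<epsilon> (\<not> \<beta>1)" using eq hs_subD by simp
      then have "\<not> quad L b1 e x (\<not> \<beta>1) \<epsilon>" by (simp add: quad_swap)
      ultimately show False using quad_missing_unique[OF S b1 e(1) eL e(2)[symmetric] x] by blast
    next
      case True
      have s: "hs (b1, \<beta>1) \<subseteq> hs (e, \<not> \<epsilon>)"
      proof
        fix y assume "y \<in> hs (b1, \<beta>1)"
        then have y: "y \<in> H" "y \<inter> L = x \<inter> L" "(b1 \<in> y) = \<beta>1" using hsI by auto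
        have "(a \<in> y) = (a \<in> x)" using Int_eqD[OF y(2) a] .
        then have "(e \<in> y) \<noteq> \<epsilon>" using m(1) y True unfolding hit3_def by blast
        then show "y \<in> hs (e, \<not> \<epsilon>)" using y hsI by simp
      qed
      have "nest (b1, \<beta>1) (e, \<not> \<epsilon>)" using s e eL b1 by (intro nestI) auto
      then have c: "card (hs (b2, \<beta>2)) \<le> card (hs (e, \<not> \<epsilon>))" using qmin pe qe by blast
      \<comment> \<open>The antipodal missing octant reverses the nesting across \<open>a\<close>:
        over \<open>z\<close> the side of \<open>e\<close> lies inside that of \<open>b1\<close>,
        hence inside that of \<open>b2\<close>. Carried back to \<open>x\<close> this squeezes it
        between \<open>p\<close> and \<open>q\<close>.\<close>
      have "\<not> quad L e b2 z (\<not> \<epsilon>) (\<not> \<beta>2)"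
      proof
        assume "quad L e b2 z (\<not> \<epsilon>) (\<not> \<beta>2)"
        then obtain y where y: "y \<in> H" "y \<inter> L = z \<inter> L" "(e \<in> y) = (\<not> \<epsilon>)" "(b2 \<in> y) = (\<not> \<beta>2)" unfolding quad_def by blast
        have "(a \<in> y) = (a \<notin> x)" using Int_eqD[OF y(2) a] za by simp
        then have "(b1 \<in> y) \<noteq> (\<not> \<mu>)" using m(2) y unfolding hit3_def by blast
        then have "(b1 \<in> y) = \<beta>1" using True by blast
        then show False using mz y unfolding quad_def by blast
      qed
      moreover have "\<not> tri a e b2"
      proof
        assume "tri a e b2"
        then have "tri a b1 b2" using tri_share[of a e b1 b2] tri_swap23[OF t] b12 by blast
        then show False using nt by blast
      qed
      moreover have "x \<inter> L = flip a z \<inter> L" using z(2) by auto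
      ultimately have "\<not> quad L e b2 x (\<not> \<epsilon>) (\<not> \<beta>2)"
        using quad_missing_step[OF L e(1) eL b2 e(4) a _ z(1) x] by blast
      then have s': "hs (e, \<not> \<epsilon>) \<subseteq> hs (b2, \<beta>2)" using hs_subI by fastforce
      have eq: "hs (e, \<not> \<epsilon>) = hs (b2, \<beta>2)" using card_seteq[OF fin s' c] .
      have ra: "(a \<in> flip a r) = (a \<notin> x)" "(b1 \<in> flip a r) = (\<not> \<mu>)"
        using Int_eqD[OF r(3) a] r(4) aN True by auto
      have "(e \<in> flip a r) \<noteq> (\<not> \<epsilon>)"
      proof
        assume "(e \<in> flip a r) = (\<not> \<epsilon>)"
        then show False using m(2) r(2) ra unfolding hit3_def by blast
      qed
      then have "(e \<in> r) = \<epsilon>" using e by auto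
      then have "r \<notin> hs (e, \<not> \<epsilon>)" using hsI by simp
      moreover have "r \<in> hs (b2, \<beta>2)" using r hsI by simp
      ultimately show False using eq by blast
    qed
  qed
  have flat1: "flat {a, b1}"
    unfolding flat_def
  proof (intro conjI ballI allI impI)
    show "{a, b1} \<subseteq> N" using aN b1 by auto
    show "\<exists>i\<in>{a, b1}. \<exists>j\<in>{a, b1}. i \<noteq> j" using aN by auto
    show "tri i j k" if "i \<in> {a, b1}" "j \<in> {a, b1}" "k \<in> {a, b1}" "i \<noteq> j" "i \<noteq> k" "j \<noteq> k" for i j k
      using that by auto
    show "e \<in> {a, b1}" if "i \<in> {a, b1}" "j \<in> {a, b1}" "tri i j e" for i j e
      using that triD[OF that(3)] nt1[of e] tri_swap12[OF that(3)] by auto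
  qed
  obtain l where l: "l \<in> L" "tri l b1 b2" using quad_missing_tri[OF L b1 b2 b12 x mx] by blast
  have la: "l \<noteq> a" using l nt by blast
  \<comment> \<open>Here the width of \<open>L\<close> is spent: a third coordinate besides
    \<open>a\<close> and the meeting point \<open>l\<close> with the line of \<open>b1\<close> and
    \<open>b2\<close>.\<close>
  obtain d where d: "d \<in> L" "d \<noteq> a" "d \<noteq> l" using wide by metis
  have dN: "d \<in> N" "d \<noteq> b1" "d \<noteq> b2" "l \<noteq> b1" "l \<noteq> b2" using d l LN b1 b2 by auto
  \<comment> \<open>The two missing octants are taken with opposite signs of \<open>l\<close>.
    Whichever sign \<open>l\<close> has, one of them forbids the prescribed signs of
    \<open>a\<close>, \<open>d\<close>, \<open>b1\<close>, \<open>b2\<close>, so a quadrant of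
    \<open>d\<close> and \<open>b2\<close> is missing over a vertex of the line
    \<open>{a, b1}\<close>.\<close>
  obtain \<gamma> \<gamma>' where g: "\<not> hit3 l b1 b2 True \<gamma> \<gamma>'" using tri_missing[OF l(2)] .
  have "tri l a d" using flat_tri[OF L l(1) a d(1)] la d by blast
  then obtain \<alpha> \<delta> where al: "\<not> hit3 l a d False \<alpha> \<delta>" using tri_missing by blast
  obtain w where w: "w \<in> H" "(a \<in> w) = \<alpha>" "(b1 \<in> w) = \<gamma>" using pair_full[OF aN(1) b1(1) aN(2)] by blast
  have "\<not> quad {a, b1} d b2 w \<delta> \<gamma>'"
  proof
    assume "quad {a, b1} d b2 w \<delta> \<gamma>'"
    then obtain y where y: "y \<in> H" "y \<inter> {a, b1} = w \<inter> {a, b1}" "(d \<in> y) = \<delta>" "(b2 \<in> y) = \<gamma>'" unfolding quad_def by blast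
    have "(a \<in> y) = \<alpha>" "(b1 \<in> y) = \<gamma>" using Int_eqD[OF y(2)] w by auto
    then show False using y g al unfolding hit3_def by (cases "l \<in> y") blast+
  qed
  moreover have "d \<notin> {a, b1}" "b2 \<notin> {a, b1}" using d dN aN b12 by auto
  ultimately obtain a' where "a' \<in> {a, b1}" "tri a' d b2"
    using quad_missing_tri[OF flat1 dN(1) _ b2(1) _ dN(3) w(1)] by blast
  \<comment> \<open>Either collinearity makes \<open>L\<close> and the line of \<open>b1\<close> and
    \<open>b2\<close> share a second point.\<close>
  then consider "tri a d b2" | "tri b1 d b2" by blast
  then show False
  proof cases
    case 1
    then show False using flat_closed[OF L a d(1)] b2 by blast
  next
    case 2
    have "tri b1 b2 l" using l(2) tri_rot by blast
    then have "tri b1 d l" using tri_share[OF tri_swap23[OF 2]] d by blast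
    then have "tri d l b1" using tri_rot by blast
    then show False using flat_closed[OF L d(1) l(1)] b1 by blast
  qed
qed

section \<open>The line through two coordinates\<close>

lemma tri_perm:
  assumes "tri i j k" "{e, f, g} = {i, j, k}" "e \<noteq> f" "e \<noteq> g" "f \<noteq> g"
  shows "tri e f g"
proof -
  have "e \<in> {i, j, k}" "f \<in> {i, j, k}" "g \<in> {i, j, k}" using assms(2) by blast+
  then show ?thesis
    using assms(3-5) assms(1) tri_swap12[OF assms(1)] tri_swap23[OF assms(1)] tri_rot[OF assms(1)]
      tri_rot[OF tri_rot[OF assms(1)]] tri_rot[OF tri_swap12[OF assms(1)]]
      tri_rot[OF tri_rot[OF tri_swap12[OF assms(1)]]]
    by (elim insertE emptyE) simp_all
qed

text \<open>The line is the base pair together with everything collinear with it. Every case comes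
  down to \<open>tri_share\<close>, applied at a pair common to two collinear triples.\<close>

lemma tri_flat:
  assumes t: "tri i j k"
  obtains L where "flat L" "i \<in> L" "j \<in> L" "k \<in> L"
proof -
  let ?L = "{i, j} \<union> {e. tri i j e}"
  note D = triD[OF t]
  have one: "tri i e f" if "tri i j e" "tri i j f" "e \<noteq> f" for e f
    using tri_share that by blast
  have two: "tri j e f" if "tri i j e" "tri i j f" "e \<noteq> f" for e f
    using tri_share[of j i e f] that tri_swap12 by blast
  have three: "tri e f g" if "tri i j e" "tri i j f" "tri i j g" "e \<noteq> f" "e \<noteq> g" "f \<noteq> g" for e f g
    using tri_share[of e i f g] tri_swap12[OF one[of e f]] tri_swap12[OF one[of e g]] that by blast
  have "flat ?L"
    unfolding flat_def
  proof (intro conjI ballI allI impI)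
    show "?L \<subseteq> N" using D triD by blast
    show "\<exists>i'\<in>?L. \<exists>j'\<in>?L. i' \<noteq> j'" using D by blast
    fix e f g assume efg: "e \<in> ?L" "f \<in> ?L" "g \<in> ?L" "e \<noteq> f" "e \<noteq> g" "f \<noteq> g"
    show "tri e f g"
    proof (cases "i \<in> {e, f, g}")
      case True
      obtain f' g' where fg: "{e, f, g} = {i, f', g'}" "f' \<noteq> g'" "f' \<noteq> i" "g' \<noteq> i"
        using three_elements[OF True efg(4-6)] .
      have "f' \<in> {e, f, g}" "g' \<in> {e, f, g}" unfolding fg(1) by simp_all
      then have "f' \<in> ?L" "g' \<in> ?L" using efg(1-3) by (elim insertE emptyE, simp_all)+
      then have "f' = j \<or> tri i j f'" "g' = j \<or> tri i j g'" using fg(3,4) by auto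
      then consider "f' = j" "tri i j g'" | "g' = j" "tri i j f'" | "tri i j f'" "tri i j g'"
        using fg(2) by blast
      then have "tri i f' g'" using one[OF _ _ fg(2)] tri_swap23 by cases blast+
      then show ?thesis by (rule tri_perm[OF _ fg(1) efg(4-6)])
    next
      case ni: False
      show ?thesis
      proof (cases "j \<in> {e, f, g}")
        case True
        obtain f' g' where fg: "{e, f, g} = {j, f', g'}" "f' \<noteq> g'" "f' \<noteq> j" "g' \<noteq> j"
          using three_elements[OF True efg(4-6)] .
        have "f' \<in> {e, f, g}" "g' \<in> {e, f, g}" unfolding fg(1) by simp_all
        then have "f' \<in> ?L" "g' \<in> ?L" "f' \<noteq> i" "g' \<noteq> i"
          using efg(1-3) ni by (elim insertE emptyE, simp_all)+
        then have "tri i j f'" "tri i j g'" using fg(3,4) by simp_all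
        then have "tri j f' g'" using two fg(2) by blast
        then show ?thesis by (rule tri_perm[OF _ fg(1) efg(4-6)])
      next
        case False
        then have "tri i j e" "tri i j f" "tri i j g" using ni efg(1-3) by auto
        then show ?thesis using three efg(4-6) by blast
      qed
    qed
  next
    fix e f g assume ef: "e \<in> ?L" "f \<in> ?L" and g: "tri e f g"
    have fromi: "tri i j g" if "tri i f g" "tri i j f" "g \<noteq> j" for f g
      using tri_share[of i f g j] that tri_swap23 by blast
    have fromj: "tri i j g" if "tri j f g" "tri i j f" "g \<noteq> i" for f g
      using tri_share[of j f g i] that tri_swap23 tri_rot tri_swap12 by blast
    have gn: "tri i j g" if "g \<noteq> i" "g \<noteq> j"
    proof -
      consider "e \<in> {i, j}" "f \<in> {i, j}" | "e \<in> {i, j}" "tri i j f" | "tri i j e" "f \<in> {i, j}" | "tri i j e" "tri i j f"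
        using ef by blast
      then show ?thesis
      proof cases
        case 1
        then show ?thesis using g triD[OF g] tri_swap12[OF g] by auto
      next
        case 2
        then show ?thesis using g fromi fromj that by blast
      next
        case 3
        then show ?thesis using tri_swap12[OF g] fromi fromj that by blast
      next
        case 4
        have "e \<noteq> f" using triD[OF g] by blast
        then have "tri e f i" using one[OF 4] tri_rot by blast
        then have "tri e g i" using tri_share[OF g] that by blast
        then show ?thesis using fromi[OF _ 4(1)] that tri_rot tri_swap23 by blast
      qed
    qed
    then show "g \<in> ?L" by blast
  qed
  then show ?thesis using that t by blast
qed

subsection \<open>Product decomposition\<close>

text \<open>The pair condition that the cycle guarantees for \<open>H\<close>, demanded of each
  fibre over \<open>L\<close>. It makes \<open>prehull\<close> applicable to the fibres
  themselves.\<close>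

definition thick :: "nat set \<Rightarrow> bool" where
  "thick L \<longleftrightarrow> splits L \<and> (\<forall>x\<in>H. \<forall>b\<in>N - L. \<forall>b'\<in>N - L. b \<noteq> b' \<longrightarrow> (\<forall>\<beta> \<beta>'. quad L b b' x \<beta> \<beta>'))"

lemma thick_quad: "thick L \<Longrightarrow> x \<in> H \<Longrightarrow> b \<in> N - L \<Longrightarrow> b' \<in> N - L \<Longrightarrow> b \<noteq> b' \<Longrightarrow> quad L b b' x \<beta> \<beta>'"
  unfolding thick_def by simp

lemma thick_fibre_antipode:
  assumes L: "thick L" and x: "x \<in> H"
  obtains y where "y \<in> H" "y \<inter> L = x \<inter> L" "\<forall>k\<in>N - L. (k \<in> y) = (k \<notin> x)"
proof -
  let ?K = "{w \<in> H. w \<inter> L = x \<inter> L}"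
  have S: "splits L" using L unfolding thick_def by blast
  have "stretchable {i} ?K" if i: "i \<in> N - L" for i
  proof (rule prehull[OF refl])
    fix w j assume w: "w \<in> ?K" and j: "j \<noteq> i"
    then have wH: "w \<in> H" by blast
    show "\<exists>z\<in>?K. (j \<in> z) = (j \<in> w) \<and> (i \<in> z) \<noteq> (i \<in> w)"
    proof (cases "j \<in> N - L")
      case True
      have "quad L i j w (i \<notin> w) (j \<in> w)" by (rule thick_quad[OF L wH i True j[symmetric]])
      then obtain z where "z \<in> H" "z \<inter> L = w \<inter> L" "(i \<in> z) = (i \<notin> w)" "(j \<in> z) = (j \<in> w)"
        unfolding quad_def by blast
      then show ?thesis using w by (intro bexI[of _ z]) simp_all
    next
      case False
      obtain q where q: "q \<in> H" "q \<inter> L = w \<inter> L" "(i \<in> q) = (i \<notin> w)" using splitsE[OF S wH] i by blast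
      have "(j \<in> q) = (j \<in> w)" using False q(1,2) wH outside by blast
      then show ?thesis using q w by (intro bexI[of _ q]) simp_all
    qed
  qed
  then have "stretchable (N - L) ?K" unfolding stretchable_def by blast
  from stretchable_projection[OF this order_refl]
  have "(N - L) - x \<inter> (N - L) \<in> (\<lambda>x. x \<inter> (N - L)) ` ?K"
    using stretchable_complement[of "N - L" "(\<lambda>x. x \<inter> (N - L)) ` ?K" "x \<inter> (N - L)"] finite_N x by auto
  then obtain y where y: "y \<in> ?K" "(N - L) - x \<inter> (N - L) = y \<inter> (N - L)" by blast
  then have "\<forall>k\<in>N - L. (k \<in> y) = (k \<notin> x)" by blast
  then show ?thesis using that y(1) by blast
qed

text \<open>The geodesic from the antipode of \<open>x\<close> in its fibre to \<open>x\<close>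
  changes every coordinate outside \<open>L\<close>, so \<open>strip\<close> can only stop at
  \<open>x\<close> itself, which therefore has the neighbour across \<open>a\<close>.\<close>

lemma thick_flip:
  assumes L: "thick L" and a: "a \<in> L" and x: "x \<in> H" and z: "z \<in> H" "z \<inter> L = flip a x \<inter> L"
  shows "flip a x \<in> H"
proof -
  have S: "splits L" using L unfolding thick_def by blast
  obtain y where y: "y \<in> H" "y \<inter> L = x \<inter> L" "\<forall>k\<in>N - L. (k \<in> y) = (k \<notin> x)"
    using thick_fibre_antipode[OF L x] .
  have "z \<inter> L = flip a y \<inter> L" using y(2) z(2) by auto
  from strip[OF S a y(1) x y(2)[symmetric] z(1) this] obtain u where
    u: "u \<in> H" "flip a u \<in> H" "u \<inter> L = y \<inter> L" "\<And>k. (k \<in> y) \<noteq> (k \<in> x) \<Longrightarrow> (k \<in> u) = (k \<in> x)" by blast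
  have "u = x"
  proof (rule sub_eqI[of _ N])
    show "u \<subseteq> N" "x \<subseteq> N" using u x sub_N by auto
    show "(k \<in> u) = (k \<in> x)" if "k \<in> N" for k
      using u(3) y(2) u(4)[of k] y(3) that by (cases "k \<in> L") blast+
  qed
  then show ?thesis using u by simp
qed

text \<open>\<open>thick_flip\<close> moves the part in \<open>L\<close> along edges of the
  projection while the rest stays fixed. Free recombination of the two parts is the product
  structure.\<close>

lemma thick_swap:
  assumes L: "thick L" and x: "x \<in> H" and y: "y \<in> H"
  shows "(y \<inter> L) \<union> (x - L) \<in> H"
proof (rule propagate[where P = "\<lambda>w. (w \<inter> L) \<union> (x - L) \<in> H" and L = L, OF x])
  show "(x \<inter> L) \<union> (x - L) \<in> H" using x by (simp add: Un_commute Un_Diff_Int Int_Diff_Un)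
  show "(z \<inter> L) \<union> (x - L) \<in> H" if "a \<in> L" "w \<in> H" "z \<in> H" "(w \<inter> L) \<union> (x - L) \<in> H" "z \<inter> L = flip a w \<inter> L" for a w z
  proof -
    have "z \<inter> L = flip a ((w \<inter> L) \<union> (x - L)) \<inter> L" using that(1,5) by auto
    then have "flip a ((w \<inter> L) \<union> (x - L)) \<in> H" using thick_flip[OF L that(1,4,3)] by blast
    moreover have "flip a ((w \<inter> L) \<union> (x - L)) = (z \<inter> L) \<union> (x - L)" using that(1) unfolding that(5) by auto
    ultimately show ?thesis by simp
  qed
qed (simp_all add: y)

lemma empty_mem: "{} \<in> H"
  using lower[of 0] by simp

lemma thick_product:
  assumes L: "thick L" and x: "x \<subseteq> N"
  shows "x \<in> H \<longleftrightarrow> x \<inter> L \<in> H \<and> x - L \<in> H"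
proof
  assume "x \<in> H"
  then show "x \<inter> L \<in> H \<and> x - L \<in> H"
    using thick_swap[OF L empty_mem, of x] thick_swap[OF L _ empty_mem, of x] by simp
next
  assume h: "x \<inter> L \<in> H \<and> x - L \<in> H"
  have "((x \<inter> L) \<inter> L) \<union> ((x - L) - L) = x" by blast
  then show "x \<in> H" using thick_swap[OF L, of "x - L" "x \<inter> L"] h by simp
qed

text \<open>The complementary factor satisfies the same axioms, so the decomposition can be repeated
  on fewer coordinates.\<close>

lemma thick_fibre:
  assumes L: "thick L"
  shows "cube_family (N - L) {x \<in> H. x \<inter> L = {}}"
proof
  show "finite (N - L)" using finite_N by simp
  show "{x \<in> H. x \<inter> L = {}} \<subseteq> Pow (N - L)" using sub_N by blast
  show "\<exists>i. (i \<in> x) \<noteq> (i \<in> y) \<and> flip i x \<in> {x \<in> H. x \<inter> L = {}}"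
    if h: "x \<in> {x \<in> H. x \<inter> L = {}}" "y \<in> {x \<in> H. x \<inter> L = {}}" "x \<noteq> y" for x y
  proof -
    obtain i where i: "(i \<in> x) \<noteq> (i \<in> y)" "flip i x \<in> H" using step[of x y] h by auto
    then have "i \<notin> L" using h by blast
    then have "flip i x \<inter> L = {}" using h by auto
    then show ?thesis using i by blast
  qed
  show "stretchable {i} K" if K: "K = {x \<in> {x \<in> H. x \<inter> L = {}}. x \<inter> F = A}"
    and h: "\<And>x j. x \<in> K \<Longrightarrow> j \<noteq> i \<Longrightarrow> \<exists>z\<in>K. (j \<in> z) = (j \<in> x) \<and> (i \<in> z) \<noteq> (i \<in> x)" for F A i K
  proof (cases "A \<inter> L = {}")
    case True
    \<comment> \<open>Fixing the coordinates of \<open>L\<close> as absent in addition to those of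
      \<open>F\<close> shows \<open>K\<close> as a trace of \<open>H\<close>.\<close>
    then have "K = {x \<in> H. x \<inter> (F \<union> L) = A}" using K by blast
    then show ?thesis using prehull h by blast
  next
    case False
    then have "K = {}" using K by blast
    then show ?thesis unfolding stretchable_def by blast
  qed
  have "\<And>y. y \<in> H \<Longrightarrow> y - L \<in> {x \<in> H. x \<inter> L = {}}"
    using thick_product[OF L] sub_N by blast
  moreover have "{i \<in> N - L. i < t} = {i \<in> N. i < t} - L" "{i \<in> N - L. t \<le> i} = {i \<in> N. t \<le> i} - L" for t by auto
  ultimately show "{i \<in> N - L. i < t} \<in> {x \<in> H. x \<inter> L = {}}" "{i \<in> N - L. t \<le> i} \<in> {x \<in> H. x \<inter> L = {}}" for t
    using lower upper by presburger+
qed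

text \<open>When all octants are hit, every singleton \<open>{g}\<close> is thick, so any single
  coordinate can be flipped freely.\<close>

lemma no_tri_Pow:
  assumes no: "\<And>i j k. \<not> tri i j k"
  shows "H = Pow N"
proof -
  have thick: "thick {g}" if g: "g \<in> N" for g
    unfolding thick_def splits_def
  proof (intro conjI ballI allI impI)
    show "{g} \<subseteq> N" using g by simp
    show "\<exists>y\<in>H. y \<inter> {g} = x \<inter> {g} \<and> (e \<in> y) = \<epsilon>" if "e \<in> N - {g}" for x e \<epsilon>
      using pair_full[of g e "g \<in> x" \<epsilon>] g that by auto
    show "quad {g} b b' x \<beta> \<beta>'" if "b \<in> N - {g}" "b' \<in> N - {g}" "b \<noteq> b'" for x b b' \<beta> \<beta>'
    proof -
      have "hit3 g b b' (g \<in> x) \<beta> \<beta>'" using no[of g b b'] g that unfolding tri_def by blast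
      then show ?thesis unfolding quad_def hit3_def by auto
    qed
  qed
  have "x \<in> H" if "finite x" "x \<subseteq> N" for x
    using that
  proof (induction x rule: finite_induct)
    case empty
    show ?case by (rule empty_mem)
  next
    case (insert g x)
    then have g: "g \<in> N" and x: "x \<in> H" by auto
    obtain z where "z \<in> H" "(g \<in> z) = (g \<notin> x)" using single_full[OF g, of "g \<notin> x"] by blast
    then have "flip g x \<in> H" using thick_flip[OF thick[OF g], of g x z] x by auto
    moreover have "flip g x = insert g x" using insert by auto
    ultimately show ?case by simp
  qed
  then have "Pow N \<subseteq> H" using finite_N by (auto intro: finite_subset)
  then show ?thesis using sub_N by (rule equalityI[rotated])
qed

lemma wide_flat_factor:
  assumes t: "tri i j k"
  obtains L where "L \<subseteq> N" "{i, j, k} \<subseteq> L" "thick L" "{x \<in> H. x \<subseteq> L} = thresholds L"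
proof -
  obtain L where L: "flat L" and ijk: "i \<in> L" "j \<in> L" "k \<in> L" using tri_flat[OF t] .
  note D = triD[OF t]
  have LN: "L \<subseteq> N" using L unfolding flat_def by blast
  have thick: "thick L"
    unfolding thick_def using flat_splits[OF L] wide_flat_quad[OF L ijk] D by blast
  \<comment> \<open>The segments realise the six octants whose signs change at most once along
    \<open>p < q < r\<close>. A collinear triple misses some octant, which must be one of the two
    alternating ones.\<close>
  have alt: "(q \<in> x) = (p \<in> x)" if "p \<in> L" "q \<in> L" "r \<in> L" "p < q" "q < r" "(p \<in> x) = (r \<in> x)" "x \<in> H" for p q r x
  proof (rule ccontr)
    assume ne: "(q \<in> x) \<noteq> (p \<in> x)"
    have t: "tri p q r" using flat_tri[OF L that(1,2,3)] that by auto
    have N: "p \<in> N" "q \<in> N" "r \<in> N" using that LN by auto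
    have "hit3 p q r True True True" unfolding hit3_def using lower[of "Suc r"] that N by (intro bexI[of _ "{i \<in> N. i < Suc r}"]) auto
    moreover have "hit3 p q r True True False" unfolding hit3_def using lower[of r] that N by (intro bexI[of _ "{i \<in> N. i < r}"]) auto
    moreover have "hit3 p q r True False False" unfolding hit3_def using lower[of q] that N by (intro bexI[of _ "{i \<in> N. i < q}"]) auto
    moreover have "hit3 p q r False False False" unfolding hit3_def using empty_mem by (intro bexI[of _ "{}"]) auto
    moreover have "hit3 p q r False False True" unfolding hit3_def using upper[of r] that N by (intro bexI[of _ "{i \<in> N. r \<le> i}"]) auto
    moreover have "hit3 p q r False True True" unfolding hit3_def using upper[of q] that N by (intro bexI[of _ "{i \<in> N. q \<le> i}"]) auto
    moreover have hx: "hit3 p q r (p \<in> x) (q \<in> x) (r \<in> x)" unfolding hit3_def using that by blast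
    moreover have "hit3 p q r (p \<notin> x) (q \<notin> x) (r \<notin> x)" using hit3_compl[OF N hx] .
    moreover obtain b c where "\<not> hit3 p q r True b c" "\<not> hit3 p q r (\<not> True) (\<not> b) (\<not> c)" using tri_missing[OF t] .
    ultimately show False using ne that(6) by (cases b; cases c; cases "p \<in> x") auto
  qed
  have "{x \<in> H. x \<subseteq> L} = thresholds L"
  proof (intro equalityI subsetI)
    fix x assume "x \<in> {x \<in> H. x \<subseteq> L}"
    then have x: "x \<in> H" "x \<subseteq> L" by auto
    have fL: "finite L" using LN finite_N finite_subset by blast
    have fx: "finite x" using x fL finite_subset by blast
    let ?m = "Min L"
    have mL: "?m \<in> L" "\<And>q. q \<in> L \<Longrightarrow> ?m \<le> q" using fL ijk by (auto intro!: Min_in)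
    show "x \<in> thresholds L"
    \<comment> \<open>Signs change at most once along \<open>L\<close>, so the sign at the least
      element decides between an initial and a final segment.\<close>
    proof (cases "?m \<in> x")
      case True
      show ?thesis
      proof (cases "L - x = {}")
        case True
        then have "x = {i \<in> L. 0 \<le> i}" using x by auto
        then show ?thesis unfolding thresholds_def by blast
      next
        case False
        let ?t = "Min (L - x)"
        have t: "?t \<in> L - x" "\<And>q. q \<in> L - x \<Longrightarrow> ?t \<le> q" using fL False Min_in[of "L - x"] by auto
        have mt: "?m < ?t" using mL(2)[of ?t] t(1) True by (metis DiffE le_neq_implies_less)
        have "x = {i \<in> L. i < ?t}"
        proof (intro equalityI subsetI)
          fix q assume q: "q \<in> x"
          have "\<not> ?t < q" using alt[of ?m ?t q x] mL t mt q x True by blast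
          moreover have "q \<noteq> ?t" using q t by blast
          ultimately show "q \<in> {i \<in> L. i < ?t}" using q x by auto
        next
          fix q assume "q \<in> {i \<in> L. i < ?t}"
          then show "q \<in> x" using t(2)[of q] by auto
        qed
        then show ?thesis unfolding thresholds_def by blast
      qed
    next
      case False
      show ?thesis
      proof (cases "x = {}")
        case True
        then have "x = {i \<in> L. i < 0}" by auto
        then show ?thesis unfolding thresholds_def by blast
      next
        case ne: False
        let ?t = "Min x"
        have t: "?t \<in> x" "\<And>q. q \<in> x \<Longrightarrow> ?t \<le> q" using fx ne by auto
        have mt: "?m < ?t" using mL(2)[of ?t] t(1) False x by (metis le_neq_implies_less subsetD)
        have "x = {i \<in> L. ?t \<le> i}"
        proof (intro equalityI subsetI)
          fix q assume q: "q \<in> {i \<in> L. ?t \<le> i}"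
          show "q \<in> x"
          proof (rule ccontr)
            assume n: "q \<notin> x"
            then have "?t \<noteq> q" using t by blast
            then have "?t < q" using q by auto
            then show False using alt[of ?m ?t q x] mL(1) mt q x n t(1) False by blast
          qed
        qed (use t x in auto)
        then show ?thesis unfolding thresholds_def by blast
      qed
    qed
  next
    fix x assume "x \<in> thresholds L"
    then obtain t where "x = {i \<in> L. i < t} \<or> x = {i \<in> L. t \<le> i}"
      unfolding thresholds_def by blast
    moreover have "{i \<in> L. i < t} = {i \<in> N. i < t} \<inter> L" "{i \<in> L. t \<le> i} = {i \<in> N. t \<le> i} \<inter> L"
      using LN by auto
    ultimately obtain y where y: "y \<in> H" "x = y \<inter> L" using lower[of t] upper[of t] by metis
    then have "x \<in> H" using thick_product[OF thick, of y] sub_N by auto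
    then show "x \<in> {x \<in> H. x \<subseteq> L}" using y(2) by simp
  qed
  then show ?thesis using that[of L] LN ijk thick by simp
qed

end

section \<open>Products of cycles\<close>

lemma graph_isoI:
  assumes "bij_betw f (verts G) (verts H)"
    and "\<And>x y. x \<in> verts G \<Longrightarrow> y \<in> verts G \<Longrightarrow> (x, y) \<in> edges G \<longleftrightarrow> (f x, f y) \<in> edges H"
  shows "graph_iso G H"
  unfolding graph_iso_def using assms by blast

lemma graph_iso_sym:
  assumes "graph_iso G H"
  shows "graph_iso H G"
proof -
  obtain f where f: "bij_betw f (verts G) (verts H)"
    "\<forall>x\<in>verts G. \<forall>y\<in>verts G. (x, y) \<in> edges G \<longleftrightarrow> (f x, f y) \<in> edges H"
    using assms unfolding graph_iso_def by blast
  let ?g = "inv_into (verts G) f"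
  show ?thesis
  proof (rule graph_isoI[of ?g])
    show "bij_betw ?g (verts H) (verts G)" using f(1) by (rule bij_betw_inv_into)
    fix x y assume "x \<in> verts H" "y \<in> verts H"
    then have "?g x \<in> verts G" "?g y \<in> verts G" "f (?g x) = x" "f (?g y) = y"
      using f(1) by (auto simp: bij_betw_def inv_into_into f_inv_into_f)
    then show "(x, y) \<in> edges H \<longleftrightarrow> (?g x, ?g y) \<in> edges G" using f(2) by metis
  qed
qed

lemma graph_iso_trans:
  assumes "graph_iso G H" "graph_iso H K"
  shows "graph_iso G K"
proof -
  obtain f where f: "bij_betw f (verts G) (verts H)"
    "\<forall>x\<in>verts G. \<forall>y\<in>verts G. (x, y) \<in> edges G \<longleftrightarrow> (f x, f y) \<in> edges H"
    using assms(1) unfolding graph_iso_def by blast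
  obtain g where g: "bij_betw g (verts H) (verts K)"
    "\<forall>x\<in>verts H. \<forall>y\<in>verts H. (x, y) \<in> edges H \<longleftrightarrow> (g x, g y) \<in> edges K"
    using assms(2) unfolding graph_iso_def by blast
  show ?thesis
  proof (rule graph_isoI[of "g \<circ> f"])
    show "bij_betw (g \<circ> f) (verts G) (verts K)" using f(1) g(1) by (rule bij_betw_trans)
    fix x y assume xy: "x \<in> verts G" "y \<in> verts G"
    then have "f x \<in> verts H" "f y \<in> verts H" using f(1) bij_betwE by blast+
    then show "(x, y) \<in> edges G \<longleftrightarrow> ((g \<circ> f) x, (g \<circ> f) y) \<in> edges K" using f(2) g(2) xy by simp
  qed
qed

section \<open>Set families as graphs, and their products\<close>

definition fam_graph :: "nat set set \<Rightarrow> nat set graph" where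
  "fam_graph H = (H, {(x, y). x \<in> H \<and> y \<in> H \<and> (\<exists>i. y = flip i x)})"

lemma verts_fam_graph [simp]: "verts (fam_graph H) = H"
  unfolding verts_def fam_graph_def by simp

lemma edges_fam_graph: "(x, y) \<in> edges (fam_graph H) \<longleftrightarrow> x \<in> H \<and> y \<in> H \<and> (\<exists>i. y = flip i x)"
  unfolding edges_def fam_graph_def by simp

lemma in_verts_cart_prod_Cons:
  "xs \<in> verts (cart_prod (G # Gs)) \<longleftrightarrow> (\<exists>a as. xs = a # as \<and> a \<in> verts G \<and> as \<in> verts (cart_prod Gs))"
proof (cases xs)
  case Nil
  then show ?thesis by (simp add: cart_prod_def verts_def)
next
  case (Cons a as)
  then show ?thesis by (auto simp: cart_prod_def verts_def All_less_Suc2)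
qed

lemma edges_cart_prod:
  "(xs, ys) \<in> edges (cart_prod Gs) \<longleftrightarrow> xs \<in> verts (cart_prod Gs) \<and> ys \<in> verts (cart_prod Gs) \<and>
     (\<exists>i < length Gs. (xs ! i, ys ! i) \<in> edges (Gs ! i) \<and> (\<forall>j < length Gs. j \<noteq> i \<longrightarrow> xs ! j = ys ! j))"
  unfolding cart_prod_def verts_def edges_def by auto

lemma edges_cart_prod_Cons:
  assumes "a \<in> verts G" "b \<in> verts G" "as \<in> verts (cart_prod Gs)" "bs \<in> verts (cart_prod Gs)"
  shows "(a # as, b # bs) \<in> edges (cart_prod (G # Gs)) \<longleftrightarrow>
    (a, b) \<in> edges G \<and> as = bs \<or> a = b \<and> (as, bs) \<in> edges (cart_prod Gs)"
proof -
  have len: "length as = length Gs" "length bs = length Gs"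
    using assms(3,4) by (simp_all add: cart_prod_def verts_def)
  have v: "a # as \<in> verts (cart_prod (G # Gs))" "b # bs \<in> verts (cart_prod (G # Gs))"
    using assms by (simp_all add: in_verts_cart_prod_Cons)
  have "(a # as, b # bs) \<in> edges (cart_prod (G # Gs)) \<longleftrightarrow>
     (\<exists>i < Suc (length Gs). ((a # as) ! i, (b # bs) ! i) \<in> edges ((G # Gs) ! i) \<and>
        (\<forall>j < Suc (length Gs). j \<noteq> i \<longrightarrow> (a # as) ! j = (b # bs) ! j))"
    using v by (simp add: edges_cart_prod)
  also have "\<dots> \<longleftrightarrow> ((a, b) \<in> edges G \<and> (\<forall>j < length Gs. as ! j = bs ! j)) \<or>
      (\<exists>i < length Gs. (as ! i, bs ! i) \<in> edges (Gs ! i) \<and> a = b \<and> (\<forall>j < length Gs. j \<noteq> i \<longrightarrow> as ! j = bs ! j))"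
    by (simp add: Ex_less_Suc2 All_less_Suc2)
  also have "(\<forall>j < length Gs. as ! j = bs ! j) \<longleftrightarrow> as = bs"
    using len by (auto simp: list_eq_iff_nth_eq)
  finally show ?thesis using assms(3,4) by (auto simp: edges_cart_prod)
qed

text \<open>As \<open>L\<close> and \<open>M\<close> are disjoint, a single flip changes exactly one
  of the two parts, which is adjacency in a Cartesian product.\<close>

lemma fam_graph_product_iso:
  assumes A: "A \<subseteq> Pow L" and B: "B \<subseteq> Pow M" and LM: "L \<inter> M = {}"
    and F: "F = {x. x \<subseteq> L \<union> M \<and> x \<inter> L \<in> A \<and> x \<inter> M \<in> B}"
    and iA: "graph_iso (fam_graph A) G" and iB: "graph_iso (fam_graph B) (cart_prod Gs)"
  shows "graph_iso (fam_graph F) (cart_prod (G # Gs))"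
proof -
  obtain f where f: "bij_betw f A (verts G)"
    "\<And>x y. x \<in> A \<Longrightarrow> y \<in> A \<Longrightarrow> (\<exists>i. y = flip i x) \<longleftrightarrow> (f x, f y) \<in> edges G"
    using iA unfolding graph_iso_def by (auto simp: edges_fam_graph)
  obtain g where g: "bij_betw g B (verts (cart_prod Gs))"
    "\<And>x y. x \<in> B \<Longrightarrow> y \<in> B \<Longrightarrow> (\<exists>i. y = flip i x) \<longleftrightarrow> (g x, g y) \<in> edges (cart_prod Gs)"
    using iB unfolding graph_iso_def by (auto simp: edges_fam_graph)
  let ?h = "\<lambda>x. f (x \<inter> L) # g (x \<inter> M)"
  have fv: "x \<in> A \<Longrightarrow> f x \<in> verts G" for x using f(1) bij_betwE by blast
  have gv: "x \<in> B \<Longrightarrow> g x \<in> verts (cart_prod Gs)" for x using g(1) bij_betwE by blast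
  have finj: "x \<in> A \<Longrightarrow> y \<in> A \<Longrightarrow> f x = f y \<longleftrightarrow> x = y" for x y using f(1) unfolding bij_betw_def inj_on_def by blast
  have ginj: "x \<in> B \<Longrightarrow> y \<in> B \<Longrightarrow> g x = g y \<longleftrightarrow> x = y" for x y using g(1) unfolding bij_betw_def inj_on_def by blast
  have FD: "x \<subseteq> L \<union> M" "x \<inter> L \<in> A" "x \<inter> M \<in> B" if "x \<in> F" for x using that F by auto
  have eqI: "x = y" if "x \<in> F" "y \<in> F" "x \<inter> L = y \<inter> L" "x \<inter> M = y \<inter> M" for x y
    using FD(1)[OF that(1)] FD(1)[OF that(2)] that(3,4) by blast
  show ?thesis
  proof (rule graph_isoI[of ?h])
    show "bij_betw ?h (verts (fam_graph F)) (verts (cart_prod (G # Gs)))"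
    proof (rule bij_betwI')
      fix x y assume "x \<in> verts (fam_graph F)" "y \<in> verts (fam_graph F)"
      then have x: "x \<in> F" and y: "y \<in> F" by auto
      show "(?h x = ?h y) = (x = y)"
        using eqI[OF x y] finj[OF FD(2)[OF x] FD(2)[OF y]] ginj[OF FD(3)[OF x] FD(3)[OF y]] by blast
    next
      fix x assume "x \<in> verts (fam_graph F)"
      then show "?h x \<in> verts (cart_prod (G # Gs))" using FD fv gv by (auto simp: in_verts_cart_prod_Cons)
    next
      fix zs assume "zs \<in> verts (cart_prod (G # Gs))"
      then obtain a as where zs: "zs = a # as" "a \<in> verts G" "as \<in> verts (cart_prod Gs)"
        by (auto simp: in_verts_cart_prod_Cons)
      have "a \<in> f ` A" "as \<in> g ` B" using f(1) g(1) zs(2,3) by (simp_all add: bij_betw_imp_surj_on)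
      then obtain x y where x: "x \<in> A" "f x = a" and y: "y \<in> B" "g y = as" by blast
      have "(x \<union> y) \<inter> L = x" "(x \<union> y) \<inter> M = y" "x \<union> y \<subseteq> L \<union> M" using x y A B LM by blast+
      then show "\<exists>x\<in>verts (fam_graph F). zs = ?h x" using x y zs F by (intro bexI[of _ "x \<union> y"]) auto
    qed
  next
    fix x y assume "x \<in> verts (fam_graph F)" "y \<in> verts (fam_graph F)"
    then have x: "x \<in> F" and y: "y \<in> F" by auto
    note X = FD[OF x] and Y = FD[OF y]
    have "(\<exists>i. y = flip i x) \<longleftrightarrow> (\<exists>i. y \<inter> L = flip i (x \<inter> L)) \<and> x \<inter> M = y \<inter> M \<or>
        x \<inter> L = y \<inter> L \<and> (\<exists>i. y \<inter> M = flip i (x \<inter> M))"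
    proof
      assume "\<exists>i. y = flip i x"
      then obtain i where i: "y = flip i x" by blast
      have "i \<in> y \<or> i \<in> x" using i by simp
      then have "i \<in> L \<or> i \<in> M" using X(1) Y(1) by blast
      then show "(\<exists>i. y \<inter> L = flip i (x \<inter> L)) \<and> x \<inter> M = y \<inter> M \<or> x \<inter> L = y \<inter> L \<and> (\<exists>i. y \<inter> M = flip i (x \<inter> M))"
      proof
        assume "i \<in> L"
        then have "y \<inter> L = flip i (x \<inter> L)" "x \<inter> M = y \<inter> M" using i LM by (auto simp: flip_Int)
        then show ?thesis by blast
      next
        assume "i \<in> M"
        then have "y \<inter> M = flip i (x \<inter> M)" "x \<inter> L = y \<inter> L" using i LM by (auto simp: flip_Int)
        then show ?thesis by blast
      qed
    next
      have one: "y = flip i x" if L': "S \<union> T = L \<union> M" "S \<inter> T = {}" "y \<inter> S = flip i (x \<inter> S)" "x \<inter> T = y \<inter> T" for S T i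
      proof (rule set_eqI)
        fix k
        have "i \<in> y \<inter> S \<or> i \<in> x \<inter> S" using L'(3) by simp
        then have iS: "i \<in> S" by blast
        have kS: "(k \<in> y \<and> k \<in> S) = ((k \<in> x \<and> k \<in> S) \<noteq> (k = i))" using L'(3) by (metis IntD1 IntD2 IntI in_flip)
        consider "k \<in> S" | "k \<in> T" | "k \<notin> L \<union> M" using L'(1) by blast
        then show "(k \<in> y) = (k \<in> flip i x)"
        proof cases
          case 1
          then show ?thesis using kS by simp
        next
          case 2
          then have "(k \<in> y) = (k \<in> x)" "k \<noteq> i" using L'(2,4) iS by blast+
          then show ?thesis by simp
        next
          case 3
          then have "k \<notin> x" "k \<notin> y" "k \<noteq> i" using X(1) Y(1) iS L'(1) by blast+
          then show ?thesis by simp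
        qed
      qed
      assume "(\<exists>i. y \<inter> L = flip i (x \<inter> L)) \<and> x \<inter> M = y \<inter> M \<or> x \<inter> L = y \<inter> L \<and> (\<exists>i. y \<inter> M = flip i (x \<inter> M))"
      then show "\<exists>i. y = flip i x" using one[of L M] one[of M L] LM by blast
    qed
    also have "\<dots> \<longleftrightarrow> (f (x \<inter> L), f (y \<inter> L)) \<in> edges G \<and> g (x \<inter> M) = g (y \<inter> M) \<or>
        f (x \<inter> L) = f (y \<inter> L) \<and> (g (x \<inter> M), g (y \<inter> M)) \<in> edges (cart_prod Gs)"
      using f(2)[OF X(2) Y(2)] g(2)[OF X(3) Y(3)] finj[OF X(2) Y(2)] ginj[OF X(3) Y(3)] by blast
    also have "\<dots> \<longleftrightarrow> (?h x, ?h y) \<in> edges (cart_prod (G # Gs))"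
      using edges_cart_prod_Cons[OF fv[OF X(2)] fv[OF Y(2)] gv[OF X(3)] gv[OF Y(3)]] by blast
    finally show "(x, y) \<in> edges (fam_graph F) \<longleftrightarrow> (?h x, ?h y) \<in> edges (cart_prod (G # Gs))"
      using x y by (simp add: edges_fam_graph)
  qed
qed

lemma fam_graph_point_iso: "graph_iso (fam_graph {{}}) (cart_prod [])"
proof (rule graph_isoI[of "\<lambda>_. []"])
  show "bij_betw (\<lambda>_. []) (verts (fam_graph {{}})) (verts (cart_prod []))"
    by (simp add: bij_betw_def) (simp add: cart_prod_def verts_def)
  have "{} \<noteq> flip i {}" for i by (simp add: flip_def)
  then show "((x, y) \<in> edges (fam_graph {{}})) = (([], []) \<in> edges (cart_prod []))"
    if "x \<in> verts (fam_graph {{}})" "y \<in> verts (fam_graph {{}})" for x y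
    using that by (auto simp: edges_fam_graph edges_cart_prod)
qed

lemma verts_K2: "verts K2 = {0, 1}" and edges_K2: "(a, b) \<in> edges K2 \<longleftrightarrow> a = 0 \<and> b = 1 \<or> a = 1 \<and> b = 0"
  unfolding verts_def edges_def K2_def by auto

lemma fam_graph_K2_iso: "graph_iso (fam_graph (Pow {g})) K2"
proof (rule graph_isoI[of "\<lambda>x. if x = {} then 0 else 1"])
  show "bij_betw (\<lambda>x. if x = {} then 0 else 1) (verts (fam_graph (Pow {g}))) (verts K2)"
    by (auto simp: bij_betw_def inj_on_def verts_K2 Pow_insert)
  fix x y assume "x \<in> verts (fam_graph (Pow {g}))" "y \<in> verts (fam_graph (Pow {g}))"
  then have "x = {} \<or> x = {g}" "y = {} \<or> y = {g}" by auto
  moreover have "{} \<noteq> flip i {}" "{g} \<noteq> flip i {g}" "flip g {} = {g}" "flip g {g} = {}" for i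
    by (auto simp: flip_def)
  ultimately show "((x, y) \<in> edges (fam_graph (Pow {g}))) =
      ((if x = {} then 0 else 1, if y = {} then 0 else 1) \<in> edges K2)"
    by (auto simp: edges_fam_graph edges_K2)
qed


section \<open>Even cycles as families of segments\<close>

lemma verts_cycle_graph: "verts (cycle_graph n) = {0..<n}"
  unfolding verts_def cycle_graph_def by simp

lemma edges_cycle_graph:
  "(i, j) \<in> edges (cycle_graph n) \<longleftrightarrow> i < n \<and> j < n \<and> (j = (i + 1) mod n \<or> i = (j + 1) mod n)"
  unfolding edges_def cycle_graph_def by simp

lemma thresholds_cycle_iso:
  assumes L: "finite L" and two: "2 \<le> card L"
  shows "graph_iso (fam_graph (thresholds L)) (cycle_graph (2 * card L))"
proof -
  define m where "m = card L"
  define xs where "xs = sorted_list_of_set L"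
  have len: "length xs = m" and set: "set xs = L" unfolding xs_def m_def using L by simp_all
  have "sorted_wrt (<) xs" unfolding xs_def by simp
  then have mono: "xs ! i < xs ! j" if "i < j" "j < m" for i j
    using that len by (simp add: sorted_wrt_iff_nth_less)
  have less: "xs ! i < xs ! j \<longleftrightarrow> i < j" if "i < m" "j < m" for i j
    using mono[of i j] mono[of j i] that by (cases i j rule: linorder_cases) auto
  have inj: "xs ! i = xs ! j \<longleftrightarrow> i = j" if "i < m" "j < m" for i j
    using mono[of i j] mono[of j i] that by (cases i j rule: linorder_cases) auto
  have inL: "x \<in> L \<longleftrightarrow> (\<exists>i<m. x = xs ! i)" for x
    using set len by (metis in_set_conv_nth)
  have nthL: "xs ! i \<in> L" if "i < m" for i using inL that by blast
  \<comment> \<open>\<open>\<phi> s\<close> is the \<open>s\<close>-th vertex of the cycle that inserts the elements of \<open>L\<close> in increasing order and then deletes them in the same order.\<close>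
  define \<phi> where "\<phi> s = {x. \<exists>i<m. x = xs ! i \<and> i < s \<and> s \<le> i + m}" for s
  have phi: "xs ! i \<in> \<phi> s \<longleftrightarrow> i < s \<and> s \<le> i + m" if "i < m" for i s
    unfolding \<phi>_def using that inj by auto
  have phi_sub: "\<phi> s \<subseteq> L" for s unfolding \<phi>_def using inL by auto
  have phi_eqI: "\<phi> s = Y" if "Y \<subseteq> L" "\<And>i. i < m \<Longrightarrow> (xs ! i \<in> Y) = (i < s \<and> s \<le> i + m)" for s Y
  proof (rule sub_eqI[OF phi_sub that(1)])
    fix k assume "k \<in> L"
    then obtain i where "i < m" "k = xs ! i" using inL by blast
    then show "(k \<in> \<phi> s) = (k \<in> Y)" using that(2) phi by simp
  qed
  have phi_thr: "\<phi> s \<in> thresholds L" if s: "s < 2 * m" for s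
  proof -
    consider "s < m" | "s = m" | "m < s" by linarith
    then have "\<phi> s = {x \<in> L. x < xs ! s} \<or> \<phi> s = {x \<in> L. 0 \<le> x} \<or> \<phi> s = {x \<in> L. xs ! (s - m) \<le> x}"
    proof cases
      case 1
      then have "\<phi> s = {x \<in> L. x < xs ! s}" by (intro phi_eqI) (auto simp: less nthL)
      then show ?thesis by blast
    next
      case 2
      then have "\<phi> s = {x \<in> L. 0 \<le> x}" by (intro phi_eqI) (auto simp: nthL)
      then show ?thesis by blast
    next
      case 3
      have "xs ! (s - m) \<le> xs ! i \<longleftrightarrow> s - m \<le> i" if "i < m" for i
        using less[of i "s - m"] that s 3 by (simp add: linorder_not_less[symmetric])
      then have "\<phi> s = {x \<in> L. xs ! (s - m) \<le> x}" using 3 by (intro phi_eqI) (auto simp: nthL)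
      then show ?thesis by blast
    qed
    then show ?thesis unfolding thresholds_def by blast
  qed
  have phi_surj: "\<exists>s<2 * m. Y = \<phi> s" if Y: "Y \<in> thresholds L" for Y
  proof -
    obtain t where t: "Y = {x \<in> L. x < t} \<or> Y = {x \<in> L. t \<le> x}" using Y unfolding thresholds_def by blast
    \<comment> \<open>The number of elements of \<open>L\<close> below the cut \<open>t\<close>; the
      alternative \<open>m \<le> i\<close> keeps the least value defined when every element lies
      below.\<close>
    define s where "s = (LEAST i. m \<le> i \<or> t \<le> xs ! i)"
    have sP: "m \<le> s \<or> t \<le> xs ! s" unfolding s_def by (rule LeastI[of _ m]) simp
    have sm: "s \<le> m" unfolding s_def by (rule Least_le) simp
    have lt: "xs ! i < t \<longleftrightarrow> i < s" if "i < m" for i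
    proof (cases "i < s")
      case True
      then have "\<not> (m \<le> i \<or> t \<le> xs ! i)" unfolding s_def by (rule not_less_Least)
      then show ?thesis using True by simp
    next
      case False
      then have "t \<le> xs ! s" "xs ! s \<le> xs ! i" using sP less[of i s] that by auto
      then show ?thesis using False by simp
    qed
    then have ge: "t \<le> xs ! i \<longleftrightarrow> s \<le> i" if "i < m" for i using that by (metis linorder_not_less)
    have m: "0 < m" using two m_def by simp
    from t show ?thesis
    proof
      assume Y: "Y = {x \<in> L. x < t}"
      have "\<phi> s = Y" using Y lt sm by (intro phi_eqI) (auto simp: nthL)
      then show ?thesis using sm m by (intro exI[of _ s]) auto
    next
      assume Y: "Y = {x \<in> L. t \<le> x}"
      show ?thesis
      proof (cases "s = m")
        case True
        \<comment> \<open>Here \<open>Y\<close> is empty. The position \<open>s + m\<close> would be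
          \<open>2 * m\<close>, just past the last vertex, so it wraps to 0.\<close>
        then have "\<phi> 0 = Y" using Y ge by (intro phi_eqI) (auto simp: nthL)
        then show ?thesis using m by (intro exI[of _ 0]) auto
      next
        case False
        then have "\<phi> (s + m) = Y" using Y ge by (intro phi_eqI) (auto simp: nthL)
        then show ?thesis using sm False by (intro exI[of _ "s + m"]) auto
      qed
    qed
  qed
  \<comment> \<open>The index of the element changed between positions \<open>s\<close> and
    \<open>s + 1\<close>. It changes again only half a turn later, so it distinguishes
    \<open>s\<close> from all positions up to \<open>s + m\<close>.\<close>
  define c where "c s = (if s < m then s else s - m)" for s
  have cm: "c s < m" if "s < 2 * m" for s using that unfolding c_def by auto
  have phi_inj: "\<phi> s \<noteq> \<phi> t" if st: "s < t" "t < 2 * m" for s t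
  proof (cases "t \<le> s + m")
    case True
    have "xs ! c s \<in> \<phi> s \<longleftrightarrow> xs ! c s \<notin> \<phi> t"
      using phi[OF cm, of s] st True unfolding c_def by auto
    then show ?thesis by blast
  next
    case False
    have "xs ! c t \<in> \<phi> s \<longleftrightarrow> xs ! c t \<notin> \<phi> t"
      using phi[OF cm, of t] st False unfolding c_def by auto
    then show ?thesis by blast
  qed
  have next_flip: "\<phi> ((s + 1) mod (2 * m)) = flip (xs ! c s) (\<phi> s)" if s: "s < 2 * m" for s
  proof (rule phi_eqI)
    have "xs ! c s \<in> L" using inL cm[OF s] by blast
    then show "flip (xs ! c s) (\<phi> s) \<subseteq> L" using phi_sub[of s] by auto
    show "(xs ! i \<in> flip (xs ! c s) (\<phi> s)) = (i < (s + 1) mod (2 * m) \<and> (s + 1) mod (2 * m) \<le> i + m)"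
      if i: "i < m" for i
    proof -
      have e: "(xs ! i \<in> flip (xs ! c s) (\<phi> s)) = ((i < s \<and> s \<le> i + m) \<noteq> (i = c s))"
        using phi[OF i] inj[OF i cm[OF s]] by simp
      consider "s < m" | "m \<le> s" "s + 1 < 2 * m" | "s + 1 = 2 * m" using s by linarith
      then show ?thesis
      proof cases
        case 1
        then have "(s + 1) mod (2 * m) = s + 1" "c s = s" unfolding c_def by simp_all
        then show ?thesis unfolding e using 1 i by (cases "i = s") auto
      next
        case 2
        then have "(s + 1) mod (2 * m) = s + 1" "c s = s - m" unfolding c_def by simp_all
        then show ?thesis unfolding e using 2 i by (cases "i = s - m") auto
      next
        case 3
        then have "(s + 1) mod (2 * m) = 0" "c s = m - 1" using i unfolding c_def by auto
        then show ?thesis unfolding e using 3 i by (cases "i = m - 1") auto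
      qed
    qed
  qed
  \<comment> \<open>Positions that are not consecutive on the cycle differ in two elements. The
    cases exhibit two such indices, depending on which halves of the turn contain \<open>s\<close>
    and \<open>t\<close>.\<close>
  have far: "\<not> (\<exists>i. \<phi> t = flip i (\<phi> s))" if st: "s + 1 < t" "t < 2 * m" "\<not> (s = 0 \<and> t + 1 = 2 * m)" for s t
  proof
    assume "\<exists>i. \<phi> t = flip i (\<phi> s)"
    then obtain i where i: "\<phi> t = flip i (\<phi> s)" by blast
    have one: "xs ! k = i" if "k < m" "(k < s \<and> s \<le> k + m) \<noteq> (k < t \<and> t \<le> k + m)" for k
    proof -
      have "(xs ! k \<in> \<phi> s) \<noteq> (xs ! k \<in> \<phi> t)" using that phi by simp
      then show ?thesis unfolding i by auto
    qed
    have m: "2 \<le> m" using two m_def by simp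
    have two_changes: False if "k < m" "l < m" "k \<noteq> l" "(k < s \<and> s \<le> k + m) \<noteq> (k < t \<and> t \<le> k + m)"
      "(l < s \<and> s \<le> l + m) \<noteq> (l < t \<and> t \<le> l + m)" for k l
      using one[of k] one[of l] inj[of k l] that by metis
    consider "t \<le> s + m" "s + 1 < m" | "t \<le> s + m" "s + 1 = m" | "t \<le> s + m" "m \<le> s"
      | "s + m < t" "0 < s" | "s + m < t" "s = 0" by linarith
    then show False
    proof cases
      case 1
      then show False using st two_changes[of s "s + 1"] by auto
    next
      case 2
      then show False using st m two_changes[of s 0] by auto
    next
      case 3
      show False by (rule two_changes[of "s - m" "s + 1 - m"]) (use st m 3 in auto)
    next
      case 4
      show False by (rule two_changes[of "t - m" "s - 1"]) (use st m 4 in auto)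
    next
      case 5
      show False by (rule two_changes[of "t - m" "t + 1 - m"]) (use st m 5 in auto)
    qed
  qed
  have "graph_iso (cycle_graph (2 * m)) (fam_graph (thresholds L))"
  proof (rule graph_isoI[of \<phi>])
    show "bij_betw \<phi> (verts (cycle_graph (2 * m))) (verts (fam_graph (thresholds L)))"
    proof (rule bij_betwI')
      fix s t assume "s \<in> verts (cycle_graph (2 * m))" "t \<in> verts (cycle_graph (2 * m))"
      then show "(\<phi> s = \<phi> t) = (s = t)"
        using phi_inj[of s t] phi_inj[of t s] by (cases s t rule: linorder_cases) (auto simp: verts_cycle_graph)
    next
      show "\<phi> s \<in> verts (fam_graph (thresholds L))" if "s \<in> verts (cycle_graph (2 * m))" for s
        using phi_thr that by (simp add: verts_cycle_graph)
      show "\<exists>s\<in>verts (cycle_graph (2 * m)). Y = \<phi> s" if "Y \<in> verts (fam_graph (thresholds L))" for Y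
        using phi_surj[of Y] that unfolding verts_cycle_graph by force
    qed
    fix s t assume "s \<in> verts (cycle_graph (2 * m))" "t \<in> verts (cycle_graph (2 * m))"
    then have st: "s < 2 * m" "t < 2 * m" by (auto simp: verts_cycle_graph)
    have *: "(\<exists>i. \<phi> t = flip i (\<phi> s)) \<longleftrightarrow> t = (s + 1) mod (2 * m) \<or> s = (t + 1) mod (2 * m)"
      if "s < t" "t < 2 * m" for s t
    proof
      assume "\<exists>i. \<phi> t = flip i (\<phi> s)"
      then have "\<not> s + 1 < t \<or> s = 0 \<and> t + 1 = 2 * m" using far[of s t] that(2) by blast
      then have "t = s + 1 \<or> s = 0 \<and> t + 1 = 2 * m" using that(1) by linarith
      then show "t = (s + 1) mod (2 * m) \<or> s = (t + 1) mod (2 * m)" using that by auto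
    next
      assume "t = (s + 1) mod (2 * m) \<or> s = (t + 1) mod (2 * m)"
      then show "\<exists>i. \<phi> t = flip i (\<phi> s)"
      proof
        assume "t = (s + 1) mod (2 * m)"
        then show ?thesis using next_flip[of s] that by auto
      next
        assume s: "s = (t + 1) mod (2 * m)"
        have "\<phi> t = flip (xs ! c t) (\<phi> s)" using next_flip[OF that(2)] s by simp
        then show ?thesis by blast
      qed
    qed
    have sym: "(\<exists>i. x = flip i y) \<longleftrightarrow> (\<exists>i. y = flip i x)" for x y by (metis flip_flip)
    have irr: "\<not> (\<exists>i. x = flip i x)" for x by (metis in_flip)
    show "((s, t) \<in> edges (cycle_graph (2 * m))) = ((\<phi> s, \<phi> t) \<in> edges (fam_graph (thresholds L)))"
    proof (cases s t rule: linorder_cases)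
      case less
      then show ?thesis using *[OF less] st phi_thr by (simp add: edges_cycle_graph edges_fam_graph)
    next
      case equal
      have "s \<noteq> (s + 1) mod (2 * m)" using st two m_def by (cases "s + 1 = 2 * m") auto
      then show ?thesis using equal irr st by (auto simp: edges_cycle_graph edges_fam_graph)
    next
      case greater
      then show ?thesis using *[OF greater] sym[of "\<phi> s" "\<phi> t"] st phi_thr
        by (auto simp: edges_cycle_graph edges_fam_graph)
    qed
  qed
  then show ?thesis using graph_iso_sym m_def by blast
qed

section \<open>Factorisation into cycles and at most one edge\<close>

lemma Pow_product: "N = L \<union> M \<Longrightarrow> Pow N = {x. x \<subseteq> L \<union> M \<and> x \<inter> L \<in> Pow L \<and> x \<inter> M \<in> Pow M}"
  by auto

lemma Pow_finite_hypercube_iso: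
  assumes "finite N"
  shows "graph_iso (fam_graph (Pow N)) (finite_hypercube (card N))"
  using assms
proof (induction N rule: finite_induct)
  case empty
  then show ?case using fam_graph_point_iso by (simp add: finite_hypercube_def)
next
  case (insert g N)
  have "graph_iso (fam_graph (Pow (insert g N))) (cart_prod (K2 # replicate (card N) K2))"
  proof (rule fam_graph_product_iso[OF _ _ _ Pow_product fam_graph_K2_iso])
    show "{g} \<inter> N = {}" using insert by auto
    show "graph_iso (fam_graph (Pow N)) (cart_prod (replicate (card N) K2))"
      using insert.IH by (simp add: finite_hypercube_def)
  qed auto
  then show ?case using insert by (simp add: finite_hypercube_def)
qed

text \<open>A square is the 4-cycle of segments of two coordinates, so the isomorphism for
  thresholds covers it.\<close>

lemma Pow_pair_thresholds:
  assumes "a \<noteq> b"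
  shows "Pow {a, b} = thresholds {a, b}"
proof -
  have *: "Pow {a, b} \<subseteq> thresholds {a, b}" if ab: "a < b" for a b :: nat
  proof
    fix x assume "x \<in> Pow {a, b}"
    then have "x = {} \<or> x = {a} \<or> x = {b} \<or> x = {a, b}" by auto
    moreover have "{} = {i \<in> {a, b}. i < 0}" "{a} = {i \<in> {a, b}. i < b}"
      "{b} = {i \<in> {a, b}. b \<le> i}" "{a, b} = {i \<in> {a, b}. 0 \<le> i}" using ab by auto
    ultimately show "x \<in> thresholds {a, b}" unfolding thresholds_def by blast
  qed
  have "Pow {a, b} \<subseteq> thresholds {a, b}"
    using *[of a b] *[of b a] assms by (cases a b rule: linorder_cases) (auto simp: insert_commute)
  moreover have "thresholds {a, b} \<subseteq> Pow {a, b}" unfolding thresholds_def by auto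
  ultimately show ?thesis by blast
qed

text \<open>Coordinates are removed two at a time, each pair giving a 4-cycle; parity decides
  whether one is left over as \<open>K2\<close>.\<close>

lemma Pow_C4_product_iso:
  assumes "finite N"
  shows "\<exists>k p. p \<le> (1::nat) \<and> graph_iso (fam_graph (Pow N)) (cart_prod (map cycle_graph (replicate k 4) @ replicate p K2))"
  using assms
proof (induction "card N" arbitrary: N rule: less_induct)
  case less
  consider "N = {}" | g where "N = {g}" | a b where "a \<in> N" "b \<in> N" "a \<noteq> b" by (metis is_singletonI' is_singletonE)
  then show ?case
  proof cases
    case 1
    then show ?thesis using fam_graph_point_iso by (intro exI[of _ 0]) simp
  next
    case 2
    have "graph_iso (fam_graph (Pow {g})) (cart_prod (K2 # []))"
      by (rule fam_graph_product_iso[where L = "{g}" and M = "{}", OF _ _ _ _ fam_graph_K2_iso fam_graph_point_iso]) auto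
    then show ?thesis using 2 by (intro exI[of _ 0] exI[of _ 1]) simp
  next
    case 3
    let ?M = "N - {a, b}"
    have "card ?M < card N" using 3 less.prems by (intro psubset_card_mono) auto
    then obtain k p where kp: "p \<le> 1" "graph_iso (fam_graph (Pow ?M)) (cart_prod (map cycle_graph (replicate k 4) @ replicate p K2))"
      using less.hyps[of ?M] less.prems by auto
    have "graph_iso (fam_graph (Pow {a, b})) (cycle_graph (2 * card {a, b}))"
      using thresholds_cycle_iso[of "{a, b}"] 3(3) by (simp add: Pow_pair_thresholds)
    then have c: "graph_iso (fam_graph (Pow {a, b})) (cycle_graph 4)" using 3(3) by simp
    have "graph_iso (fam_graph (Pow N)) (cart_prod (cycle_graph 4 # map cycle_graph (replicate k 4) @ replicate p K2))"
      by (rule fam_graph_product_iso[OF _ _ _ Pow_product c kp(2)]) (use 3 in auto)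
    then show ?thesis using kp(1) by (intro exI[of _ "Suc k"] exI[of _ p]) simp
  qed
qed

text \<open>A collinear triple lies on a line with at least three coordinates, which splits off as a
  cycle of length at least 6; this gives the conditional clause. The fibre is handled by
  induction.\<close>

lemma cube_family_product_iso:
  assumes "cube_family N H"
  shows "\<exists>ns p. p \<le> (1::nat) \<and> (\<forall>n\<in>set ns. even n \<and> 4 \<le> n) \<and>
    ((\<exists>i j k. cube_family.tri N H i j k) \<longrightarrow> (\<exists>n\<in>set ns. 4 < n)) \<and>
    graph_iso (fam_graph H) (cart_prod (map cycle_graph ns @ replicate p K2))"
  using assms
proof (induction "card N" arbitrary: N H rule: less_induct)
  case less
  interpret cube_family N H by (rule less.prems)
  show ?case
  proof (cases "\<exists>i j k. tri i j k")
    case False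
    then have "H = Pow N" using no_tri_Pow by blast
    then obtain k p where "p \<le> (1::nat)"
        "graph_iso (fam_graph H) (cart_prod (map cycle_graph (replicate k 4) @ replicate p K2))"
      using Pow_C4_product_iso[OF finite_N] by blast
    then show ?thesis using False by (intro exI[of _ "replicate k 4"] exI[of _ p]) simp
  next
    case True
    then obtain i j k where t: "tri i j k" by blast
    obtain L where L: "L \<subseteq> N" "{i, j, k} \<subseteq> L" "thick L" "{x \<in> H. x \<subseteq> L} = thresholds L"
      using wide_flat_factor[OF t] .
    let ?R = "{x \<in> H. x \<inter> L = {}}"
    have fL: "finite L" using L(1) finite_N finite_subset by blast
    have "3 = card {i, j, k}" using triD[OF t] by simp
    also have "\<dots> \<le> card L" using L(2) fL by (rule card_mono[rotated])
    finally have cL: "3 \<le> card L" .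
    have "N - L \<subset> N" using L(1,2) by blast
    then have "card (N - L) < card N" using finite_N by (rule psubset_card_mono[rotated])
    from less.hyps[OF this thick_fibre[OF L(3)]] obtain ns p where
      R: "p \<le> (1::nat)" "\<forall>n\<in>set ns. even n \<and> 4 \<le> n"
        "graph_iso (fam_graph ?R) (cart_prod (map cycle_graph ns @ replicate p K2))" by blast
    have "graph_iso (fam_graph H) (cart_prod (cycle_graph (2 * card L) # map cycle_graph ns @ replicate p K2))"
    proof (rule fam_graph_product_iso[OF _ _ _ _ thresholds_cycle_iso R(3)])
      show "thresholds L \<subseteq> Pow L" using L(4) by blast
      show "?R \<subseteq> Pow (N - L)" using sub_N by blast
      show "H = {x. x \<subseteq> L \<union> (N - L) \<and> x \<inter> L \<in> thresholds L \<and> x \<inter> (N - L) \<in> ?R}"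
      proof (intro equalityI subsetI)
        fix x assume x: "x \<in> H"
        then have xN: "x \<subseteq> N" using sub_N by blast
        then have "x \<inter> L \<in> H" "x - L \<in> H" using x thick_product[OF L(3)] by blast+
        moreover have "x \<inter> (N - L) = x - L" using xN by blast
        ultimately show "x \<in> {x. x \<subseteq> L \<union> (N - L) \<and> x \<inter> L \<in> thresholds L \<and> x \<inter> (N - L) \<in> ?R}"
          using xN unfolding L(4)[symmetric] by auto
      next
        fix x assume "x \<in> {x. x \<subseteq> L \<union> (N - L) \<and> x \<inter> L \<in> thresholds L \<and> x \<inter> (N - L) \<in> ?R}"
        then have x: "x \<subseteq> N" "x \<inter> L \<in> H" "x \<inter> (N - L) \<in> H" using L(1) unfolding L(4)[symmetric] by auto
        moreover have "x \<inter> (N - L) = x - L" using x(1) by blast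
        ultimately show "x \<in> H" using thick_product[OF L(3) x(1)] by simp
      qed
    qed (use fL cL in auto)
    then show ?thesis using R(1,2) cL by (intro exI[of _ "2 * card L # ns"] exI[of _ p]) auto
  qed
qed

lemma cube_family_quasi_hypertorus:
  assumes "cube_family N H"
  shows "quasi_hypertorus (fam_graph H)"
proof -
  interpret cube_family N H by (rule assms)
  show ?thesis
  proof (cases "\<exists>i j k. tri i j k")
    \<comment> \<open>A pure hypercube is kept apart: its factorisation into 4-cycles has no factor
      longer than 4 and so would not count as a hypertorus.\<close>
    case False
    then have "H = Pow N" using no_tri_Pow by blast
    then show ?thesis using Pow_finite_hypercube_iso[OF finite_N] unfolding quasi_hypertorus_def by blast
  next
    case True
    then obtain ns p where ns: "p \<le> (1::nat)" "hypertorus_lengths ns"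
      "graph_iso (fam_graph H) (cart_prod (map cycle_graph ns @ replicate p K2))"
      using cube_family_product_iso[OF assms] unfolding hypertorus_lengths_def by blast
    then consider "p = 0" | "p = 1" by linarith
    then show ?thesis
    proof cases
      case 1
      then show ?thesis using ns unfolding quasi_hypertorus_def hypertorus_def by auto
    next
      case 2
      then show ?thesis using ns unfolding quasi_hypertorus_def hypertorus_prism_def by auto
    qed
  qed
qed

section \<open>Graphs embedded in hypercubes\<close>

text \<open>Symmetric difference, with cardinality as hypercube distance. The inclusion
  \<open>sd x z \<subseteq> sd x y\<close> expresses that \<open>z\<close> lies between
  \<open>x\<close> and \<open>y\<close>.\<close>

definition sd :: "'b set \<Rightarrow> 'b set \<Rightarrow> 'b set" where
  "sd x y = (x - y) \<union> (y - x)"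

lemma in_sd [simp]: "k \<in> sd x y \<longleftrightarrow> (k \<in> x) \<noteq> (k \<in> y)"
  unfolding sd_def by blast

lemma sd_commute: "sd x y = sd y x"
  unfolding sd_def by blast

lemma sd_self [simp]: "sd x x = {}"
  unfolding sd_def by blast

lemma sd_empty_iff: "sd x y = {} \<longleftrightarrow> x = y"
  unfolding sd_def by blast

lemma sd_triangle: "sd x z \<subseteq> sd x y \<union> sd y z"
  unfolding sd_def by blast

lemma sd_between: "sd x z \<subseteq> sd x y \<Longrightarrow> sd z y = sd x y - sd x z"
  unfolding sd_def by blast

lemma sd_between_commute: "sd x z \<subseteq> sd x y \<Longrightarrow> sd y z \<subseteq> sd y x"
  unfolding sd_def by blast

lemma card_sd_between:
  assumes "finite (sd x y)" "sd x z \<subseteq> sd x y"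
  shows "card (sd x z) + card (sd z y) = card (sd x y)"
proof -
  have "card (sd z y) = card (sd x y) - card (sd x z)"
    unfolding sd_between[OF assms(2)] using assms by (intro card_Diff_subset) (auto intro: finite_subset)
  then show ?thesis using card_mono[OF assms] by simp
qed

text \<open>A coordinate changed on the way to \<open>z\<close> and changed back on the way to
  \<open>y\<close> would be counted twice on the left and not at all on the right.\<close>

lemma sd_betweenI:
  assumes fin: "finite (sd x z)" "finite (sd z y)" and le: "card (sd x z) + card (sd z y) \<le> card (sd x y)"
  shows "sd x z \<subseteq> sd x y"
proof (rule ccontr)
  assume "\<not> ?thesis"
  then obtain e where e: "e \<in> sd x z" "e \<notin> sd x y" by blast
  then have e': "e \<in> sd z y" by auto
  have "sd x y \<subseteq> (sd x z - {e}) \<union> (sd z y - {e})" using e(2) sd_triangle[of x y z] by blast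
  then have "card (sd x y) \<le> card ((sd x z - {e}) \<union> (sd z y - {e}))" using fin by (intro card_mono) auto
  also have "\<dots> \<le> card (sd x z - {e}) + card (sd z y - {e})" by (rule card_Un_le)
  also have "\<dots> = (card (sd x z) - 1) + (card (sd z y) - 1)" using e(1) e' by (simp add: card_Diff_singleton)
  finally have "card (sd x y) \<le> (card (sd x z) - 1) + (card (sd z y) - 1)" .
  moreover have "0 < card (sd x z)" using e(1) fin(1) card_gt_0_iff by blast
  ultimately show False using le by linarith
qed

lemma card_sd_triangle: "finite (sd x y) \<Longrightarrow> finite (sd y z) \<Longrightarrow> card (sd x z) \<le> card (sd x y) + card (sd y z)"
  using card_mono[OF _ sd_triangle[of x z y]] card_Un_le[of "sd x y" "sd y z"] by (meson finite_UnI le_trans)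

text \<open>Bipartiteness of the hypercube; it forces isometric cycles to have even length.\<close>

lemma card_sd_parity:
  assumes fin: "finite (sd c a)" and one: "card (sd a b) = 1"
  shows "even (card (sd c b)) \<longleftrightarrow> odd (card (sd c a))"
proof -
  obtain e where e: "sd a b = {e}" using one card_1_singletonE by blast
  have b: "(k \<in> b) = ((k \<in> a) \<noteq> (k = e))" for k
  proof -
    have "k \<in> sd a b \<longleftrightarrow> k = e" using e by blast
    then show ?thesis by auto
  qed
  show ?thesis
  proof (cases "e \<in> sd c a")
    case True
    then have "sd c b = sd c a - {e}" using b by (auto simp del: in_sd simp: sd_def)
    then have "card (sd c a) = Suc (card (sd c b))" using True fin by (metis card_Suc_Diff1)
    then show ?thesis by simp
  next
    case False
    then have "sd c b = insert e (sd c a)" using b by (auto simp del: in_sd simp: sd_def)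
    then have "card (sd c b) = Suc (card (sd c a))" using False fin by simp
    then show ?thesis by simp
  qed
qed

lemma nat_all_split: "(\<forall>i. P i) \<longleftrightarrow> P 0 \<and> (\<forall>i. P (Suc i))"
  by (metis not0_implies_Suc)

lemma gwalk_Cons: "gwalk G (x # xs) \<longleftrightarrow> x \<in> verts G \<and> (xs = [] \<or> (x, hd xs) \<in> edges G \<and> gwalk G xs)"
proof (cases xs)
  case (Cons y ys)
  have "(\<forall>i. Suc i < length (x # y # ys) \<longrightarrow> ((x # y # ys) ! i, (x # y # ys) ! Suc i) \<in> edges G) \<longleftrightarrow>
    (x, y) \<in> edges G \<and> (\<forall>i. Suc i < length (y # ys) \<longrightarrow> ((y # ys) ! i, (y # ys) ! Suc i) \<in> edges G)"
    by (subst nat_all_split) simp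
  then show ?thesis unfolding gwalk_def Cons by auto
qed (simp add: gwalk_def)

lemma gwalk_join: "gwalk G xs \<Longrightarrow> gwalk G ys \<Longrightarrow> last xs = hd ys \<Longrightarrow> gwalk G (xs @ tl ys)"
proof (induction xs)
  case (Cons x xs)
  show ?case
  proof (cases xs)
    case Nil
    then have "x # tl ys = ys" using Cons.prems by (cases ys) (auto simp: gwalk_def)
    then show ?thesis using Nil Cons.prems by simp
  next
    case (Cons y zs)
    then show ?thesis using Cons.IH Cons.prems by (auto simp: gwalk_Cons[of G x])
  qed
qed (simp add: gwalk_def)

section \<open>Distances, intervals and convexity read off coordinates\<close>

text \<open>An isometric embedding without distances: the last clause provides a first step towards
  \<open>y\<close>. In this form it passes directly to convex subgraphs and to renamed coordinates.
  Only differences of labels are required to be finite.\<close>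

definition cubic :: "'a graph \<Rightarrow> ('a \<Rightarrow> 'b set) \<Rightarrow> bool" where
  "cubic G f \<longleftrightarrow> inj_on f (verts G) \<and> (\<forall>x\<in>verts G. \<forall>y\<in>verts G. finite (sd (f x) (f y))) \<and>
     (\<forall>x y. (x, y) \<in> edges G \<longleftrightarrow> x \<in> verts G \<and> y \<in> verts G \<and> card (sd (f x) (f y)) = 1) \<and>
     (\<forall>x\<in>verts G. \<forall>y\<in>verts G. x \<noteq> y \<longrightarrow>
        (\<exists>z\<in>verts G. card (sd (f x) (f z)) = 1 \<and> sd (f x) (f z) \<subseteq> sd (f x) (f y)))"

lemma cubic_finite: "cubic G f \<Longrightarrow> x \<in> verts G \<Longrightarrow> y \<in> verts G \<Longrightarrow> finite (sd (f x) (f y))"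
  unfolding cubic_def by blast

lemma cubic_edge: "cubic G f \<Longrightarrow> (x, y) \<in> edges G \<longleftrightarrow> x \<in> verts G \<and> y \<in> verts G \<and> card (sd (f x) (f y)) = 1"
  unfolding cubic_def by blast

lemma cubic_step:
  assumes "cubic G f" "x \<in> verts G" "y \<in> verts G" "x \<noteq> y"
  obtains z where "z \<in> verts G" "card (sd (f x) (f z)) = 1" "sd (f x) (f z) \<subseteq> sd (f x) (f y)"
  using assms unfolding cubic_def by blast

lemma cubic_inj: "cubic G f \<Longrightarrow> x \<in> verts G \<Longrightarrow> y \<in> verts G \<Longrightarrow> f x = f y \<Longrightarrow> x = y"
  unfolding cubic_def inj_on_def by blast

lemma gwalk_card_sd:
  assumes f: "\<And>x y. (x, y) \<in> edges G \<Longrightarrow> card (sd (f x) (f y)) = 1"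
    and w: "gwalk G xs" and "i \<le> j" "j < length xs"
  shows "finite (sd (f (xs ! i)) (f (xs ! j))) \<and> card (sd (f (xs ! i)) (f (xs ! j))) \<le> j - i"
  using assms(3,4)
proof (induction j)
  case (Suc j)
  show ?case
  proof (cases "i = Suc j")
    case False
    then have IH: "finite (sd (f (xs ! i)) (f (xs ! j)))" "card (sd (f (xs ! i)) (f (xs ! j))) \<le> j - i" "i \<le> j"
      using Suc by auto
    have "(xs ! j, xs ! Suc j) \<in> edges G" using w Suc.prems unfolding gwalk_def by blast
    then have e: "card (sd (f (xs ! j)) (f (xs ! Suc j))) = 1" by (rule f)
    then have fe: "finite (sd (f (xs ! j)) (f (xs ! Suc j)))" by (intro card_ge_0_finite) simp
    have "finite (sd (f (xs ! i)) (f (xs ! Suc j)))"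
      by (rule finite_subset[OF sd_triangle[of _ _ "f (xs ! j)"]]) (use IH(1) fe in simp)
    then show ?thesis using card_sd_triangle[OF IH(1) fe] IH(2,3) e by linarith
  qed simp
qed simp

lemma walk_between_card_sd:
  assumes c: "cubic G f" and w: "walk_between G x y xs" and z: "z \<in> set xs"
  shows "card (sd (f x) (f z)) + card (sd (f z) (f y)) \<le> length xs - 1"
proof -
  have w': "gwalk G xs" "xs \<noteq> []" "xs ! 0 = x" "xs ! (length xs - 1) = y"
    using w unfolding walk_between_def gwalk_def by (auto simp: hd_conv_nth last_conv_nth)
  obtain k where k: "k < length xs" "xs ! k = z" using z by (auto simp: in_set_conv_nth)
  have e: "\<And>x y. (x, y) \<in> edges G \<Longrightarrow> card (sd (f x) (f y)) = 1" using cubic_edge[OF c] by blast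
  have "card (sd (f (xs ! 0)) (f (xs ! k))) \<le> k - 0" using gwalk_card_sd[of G f, OF e w'(1)] k by blast
  moreover have "card (sd (f (xs ! k)) (f (xs ! (length xs - 1)))) \<le> (length xs - 1) - k"
    using gwalk_card_sd[of G f xs k "length xs - 1", OF e w'(1)] k by fastforce
  ultimately show ?thesis using k w' by simp
qed

lemma cubic_geodesic:
  assumes c: "cubic G f" and "x \<in> verts G" "y \<in> verts G"
  shows "\<exists>xs. walk_between G x y xs \<and> length xs = Suc (card (sd (f x) (f y)))"
  using assms(2)
proof (induction "card (sd (f x) (f y))" arbitrary: x)
  case 0
  then have "f x = f y" using cubic_finite[OF c 0(2) assms(3)] sd_empty_iff by auto
  then have "x = y" using cubic_inj[OF c 0(2) assms(3)] by blast
  then show ?case using assms(3) by (intro exI[of _ "[x]"]) (auto simp: walk_between_def gwalk_def)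
next
  case (Suc n)
  then have "x \<noteq> y" by auto
  then obtain z where z: "z \<in> verts G" "card (sd (f x) (f z)) = 1" "sd (f x) (f z) \<subseteq> sd (f x) (f y)"
    using cubic_step[OF c Suc.prems assms(3)] by blast
  have "n = card (sd (f z) (f y))"
    using card_sd_between[OF cubic_finite[OF c Suc.prems assms(3)] z(3)] z(2) Suc.hyps(2) by simp
  from Suc.hyps(1)[OF this z(1)] obtain xs where
    xs: "walk_between G z y xs" "length xs = Suc (card (sd (f z) (f y)))" by blast
  have "(x, z) \<in> edges G" using cubic_edge[OF c] Suc.prems z by blast
  then have "walk_between G x y (x # xs)" using xs(1) Suc.prems
    unfolding walk_between_def gwalk_Cons by (auto simp: gwalk_def)
  then show ?case using xs(2) \<open>n = _\<close> Suc.hyps(2) by (intro exI[of _ "x # xs"]) simp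
qed

lemma cubic_gdist:
  assumes c: "cubic G f" and "x \<in> verts G" "y \<in> verts G"
  shows "gdist G x y = card (sd (f x) (f y))"
  unfolding gdist_def
proof (rule Least_equality)
  show "\<exists>xs. walk_between G x y xs \<and> length xs = Suc (card (sd (f x) (f y)))" using cubic_geodesic[OF assms] .
  fix n assume "\<exists>xs. walk_between G x y xs \<and> length xs = Suc n"
  then obtain xs where xs: "walk_between G x y xs" "length xs = Suc n" by blast
  have "y \<in> set xs" using xs unfolding walk_between_def gwalk_def by auto
  from walk_between_card_sd[OF c xs(1) this] show "card (sd (f x) (f y)) \<le> n" using xs(2) by simp
qed

lemma cubic_interval:
  assumes c: "cubic G f" and x: "x \<in> verts G" and y: "y \<in> verts G"
  shows "interval G x y = {z \<in> verts G. sd (f x) (f z) \<subseteq> sd (f x) (f y)}"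
proof (intro equalityI subsetI)
  fix z assume "z \<in> interval G x y"
  then obtain xs where xs: "walk_between G x y xs" "length xs = Suc (card (sd (f x) (f y)))" "z \<in> set xs"
    unfolding interval_def cubic_gdist[OF assms] by blast
  have z: "z \<in> verts G" using xs unfolding walk_between_def gwalk_def by blast
  have "sd (f x) (f z) \<subseteq> sd (f x) (f y)"
    using walk_between_card_sd[OF c xs(1,3)] xs(2) cubic_finite[OF c] x y z by (intro sd_betweenI) auto
  then show "z \<in> {z \<in> verts G. sd (f x) (f z) \<subseteq> sd (f x) (f y)}" using z by blast
next
  fix z assume "z \<in> {z \<in> verts G. sd (f x) (f z) \<subseteq> sd (f x) (f y)}"
  then have z: "z \<in> verts G" "sd (f x) (f z) \<subseteq> sd (f x) (f y)" by auto
  obtain xs where xs: "walk_between G x z xs" "length xs = Suc (card (sd (f x) (f z)))"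
    using cubic_geodesic[OF c x z(1)] by blast
  obtain ys where ys: "walk_between G z y ys" "length ys = Suc (card (sd (f z) (f y)))"
    using cubic_geodesic[OF c z(1) y] by blast
  have ne: "xs \<noteq> []" "ys \<noteq> []" using xs ys by auto
  have g: "gwalk G (xs @ tl ys)" using xs(1) ys(1) gwalk_join unfolding walk_between_def by metis
  have "last (xs @ tl ys) = y" using ne xs(1) ys(1) unfolding walk_between_def
    by (cases ys) (auto split: if_splits)
  then have "walk_between G x y (xs @ tl ys)" using g ne xs(1) unfolding walk_between_def by simp
  moreover have "length (xs @ tl ys) = Suc (card (sd (f x) (f y)))"
    using xs(2) ys(2) card_sd_between[OF cubic_finite[OF c x y] z(2)] by simp
  moreover have "z \<in> set (xs @ tl ys)" using ne xs(1) unfolding walk_between_def by auto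
  ultimately show "z \<in> interval G x y" unfolding interval_def cubic_gdist[OF assms] by blast
qed

lemma cubic_convex:
  assumes c: "cubic G f"
  shows "convex G A \<longleftrightarrow> A \<subseteq> verts G \<and>
    (\<forall>x\<in>A. \<forall>y\<in>A. \<forall>z\<in>verts G. sd (f x) (f z) \<subseteq> sd (f x) (f y) \<longrightarrow> z \<in> A)"
proof -
  have "interval G x y \<subseteq> A \<longleftrightarrow> (\<forall>z\<in>verts G. sd (f x) (f z) \<subseteq> sd (f x) (f y) \<longrightarrow> z \<in> A)"
    if "A \<subseteq> verts G" "x \<in> A" "y \<in> A" for x y
    using that by (subst cubic_interval[OF c]) blast+
  then show ?thesis unfolding convex_def by blast
qed

lemma verts_induced [simp]: "verts (induced G A) = A"
  unfolding verts_def induced_def by simp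

lemma edges_induced: "(x, y) \<in> edges (induced G A) \<longleftrightarrow> (x, y) \<in> edges G \<and> x \<in> A \<and> y \<in> A"
  unfolding edges_def induced_def by auto

lemma cubic_induced:
  assumes c: "cubic G f" and A: "convex G A"
  shows "cubic (induced G A) f"
  unfolding cubic_def verts_induced edges_induced
proof (intro conjI ballI allI impI)
  have V: "A \<subseteq> verts G" using A unfolding convex_def by blast
  show "inj_on f A" using c V unfolding cubic_def by (blast intro: inj_on_subset)
  show "finite (sd (f x) (f y))" if "x \<in> A" "y \<in> A" for x y using that V cubic_finite[OF c] by blast
  show "((x, y) \<in> edges G \<and> x \<in> A \<and> y \<in> A) = (x \<in> A \<and> y \<in> A \<and> card (sd (f x) (f y)) = 1)" for x y
    using V cubic_edge[OF c] by blast
  fix x y assume xy: "x \<in> A" "y \<in> A" "x \<noteq> y"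
  then obtain z where z: "z \<in> verts G" "card (sd (f x) (f z)) = 1" "sd (f x) (f z) \<subseteq> sd (f x) (f y)"
    using cubic_step[OF c, of x y] V by blast
  then have "z \<in> A" using A xy unfolding cubic_convex[OF c] by blast
  then show "\<exists>z\<in>A. card (sd (f x) (f z)) = 1 \<and> sd (f x) (f z) \<subseteq> sd (f x) (f y)" using z by blast
qed

lemma cubic_hypercube: "cubic (hypercube X) (\<lambda>A. A)"
proof -
  have V: "verts (hypercube X) = {A. finite A \<and> A \<subseteq> X}" unfolding verts_def hypercube_def by simp
  have E: "(A, B) \<in> edges (hypercube X) \<longleftrightarrow> finite A \<and> A \<subseteq> X \<and> finite B \<and> B \<subseteq> X \<and> card (sd A B) = 1" for A B
    unfolding edges_def hypercube_def sd_def by simp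
  show ?thesis
    unfolding cubic_def V E
  proof (intro conjI ballI allI impI)
    show "finite (sd A B)" if "A \<in> {A. finite A \<and> A \<subseteq> X}" "B \<in> {A. finite A \<and> A \<subseteq> X}" for A B
      using that unfolding sd_def by auto
    fix A B assume AB: "A \<in> {A. finite A \<and> A \<subseteq> X}" "B \<in> {A. finite A \<and> A \<subseteq> X}" "A \<noteq> B"
    then have "sd A B \<noteq> {}" by (simp add: sd_empty_iff)
    then obtain e where e: "e \<in> sd A B" by blast
    define C where "C = (if e \<in> A then A - {e} else insert e A)"
    have "C \<in> {A. finite A \<and> A \<subseteq> X}" using AB e unfolding C_def by auto
    moreover have "sd A C = {e}" unfolding C_def sd_def by auto
    ultimately show "\<exists>C\<in>{A. finite A \<and> A \<subseteq> X}. card (sd A C) = 1 \<and> sd A C \<subseteq> sd A B"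
      using e by (intro bexI[of _ C]) simp_all
  qed auto
qed

text \<open>The second vertex of a shortest walk supplies the step: the remaining walk is too short
  for its crossed coordinate to be crossed back.\<close>

lemma partial_cube_cubic:
  assumes "partial_cube G"
  obtains f :: "'a \<Rightarrow> 'a set set" where "cubic (G :: 'a graph) f"
proof -
  obtain X :: "'a set set" and f where f: "isometric_embedding G (hypercube X) f"
    and G: "simple_graph G" "connected_graph G" using assms unfolding partial_cube_def by blast
  let ?Q = "hypercube X"
  note Q = cubic_hypercube[of X]
  have fV: "f x \<in> verts ?Q" if "x \<in> verts G" for x using f that unfolding isometric_embedding_def by blast
  have fe: "(x, y) \<in> edges G \<longleftrightarrow> card (sd (f x) (f y)) = 1" if "x \<in> verts G" "y \<in> verts G" for x y
    using f that fV cubic_edge[OF Q] unfolding isometric_embedding_def by blast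
  have E: "(x, y) \<in> edges G \<longleftrightarrow> x \<in> verts G \<and> y \<in> verts G \<and> card (sd (f x) (f y)) = 1" for x y
    using G(1) fe unfolding simple_graph_def by blast
  have d: "gdist G x y = card (sd (f x) (f y))" if "x \<in> verts G" "y \<in> verts G" for x y
    using f that fV cubic_gdist[OF Q, of "f x" "f y"] unfolding isometric_embedding_def by metis
  have fin: "finite (sd (f x) (f y))" if "x \<in> verts G" "y \<in> verts G" for x y
    using cubic_finite[OF Q fV[OF that(1)] fV[OF that(2)]] .
  have "cubic G f"
    unfolding cubic_def
  proof (intro conjI ballI allI impI)
    show "inj_on f (verts G)" using f unfolding isometric_embedding_def by blast
    fix x y assume x: "x \<in> verts G" and y: "y \<in> verts G" and xy: "x \<noteq> y"
    obtain xs0 where "walk_between G x y xs0" using G(2) x y unfolding connected_graph_def by blast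
    then have "walk_between G x y xs0 \<and> length xs0 = Suc (length xs0 - 1)" unfolding walk_between_def gwalk_def by simp
    then have "\<exists>n xs. walk_between G x y xs \<and> length xs = Suc n" by blast
    from LeastI_ex[OF this] have "\<exists>xs. walk_between G x y xs \<and> length xs = Suc (gdist G x y)"
      unfolding gdist_def .
    then obtain xs where xs: "walk_between G x y xs" "length xs = Suc (gdist G x y)" by blast
    have "hd xs = x" "last xs = y" "xs \<noteq> []" using xs(1) unfolding walk_between_def gwalk_def by auto
    then obtain ys where ys: "xs = x # ys" by (cases xs) simp_all
    moreover have "ys \<noteq> []" using \<open>last xs = y\<close> ys xy by auto
    ultimately obtain z zs where zs: "xs = x # z # zs" by (cases ys) simp_all
    have g: "(x, z) \<in> edges G" "gwalk G (z # zs)"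
      using xs(1) unfolding zs walk_between_def gwalk_Cons[of G x] by auto
    have z: "z \<in> verts G" using g(2) unfolding gwalk_def by simp
    have e: "\<And>x y. (x, y) \<in> edges G \<Longrightarrow> card (sd (f x) (f y)) = 1" using E by blast
    have "card (sd (f ((z # zs) ! 0)) (f ((z # zs) ! length zs))) \<le> length zs - 0"
      using gwalk_card_sd[of G f "z # zs" 0 "length zs", OF e g(2)] by simp
    moreover have "(z # zs) ! length zs = y"
      using last_conv_nth[of "z # zs"] \<open>last xs = y\<close> zs by simp
    ultimately have "card (sd (f z) (f y)) \<le> length zs" by simp
    moreover have "card (sd (f x) (f y)) = Suc (length zs)" using xs(2) d[OF x y] zs by simp
    moreover have one: "card (sd (f x) (f z)) = 1" using e g(1) by blast
    ultimately have "sd (f x) (f z) \<subseteq> sd (f x) (f y)"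
      using fin x y z by (intro sd_betweenI) auto
    then show "\<exists>z\<in>verts G. card (sd (f x) (f z)) = 1 \<and> sd (f x) (f z) \<subseteq> sd (f x) (f y)" using z one by blast
  qed (use E fin in auto)
  then show ?thesis using that by blast
qed

text \<open>Labels are measured from a base point \<open>b\<close> and the coordinate
  \<open>d t\<close> is renamed \<open>t\<close>. In a difference of two labels the base point
  cancels, so differences correspond bijectively.\<close>

lemma cubic_relabel:
  assumes c: "cubic G f" and d: "inj_on d T" and D: "\<And>x y. x \<in> verts G \<Longrightarrow> y \<in> verts G \<Longrightarrow> sd (f x) (f y) \<subseteq> d ` T"
    and g: "\<And>x. g x = {t \<in> T. d t \<in> sd (f x) b}"
  shows "cubic G g"
proof -
  have sdg: "sd (g x) (g y) = {t \<in> T. d t \<in> sd (f x) (f y)}" for x y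
    unfolding g sd_def by blast
  have im: "d ` sd (g x) (g y) = sd (f x) (f y)" if "x \<in> verts G" "y \<in> verts G" for x y
    unfolding sdg using D[OF that] by blast
  have inj: "inj_on d (sd (g x) (g y))" for x y unfolding sdg by (rule inj_on_subset[OF d]) blast
  have crd: "card (sd (g x) (g y)) = card (sd (f x) (f y))" if "x \<in> verts G" "y \<in> verts G" for x y
    using card_image[OF inj] im[OF that] by metis
  have fin: "finite (sd (g x) (g y))" if "x \<in> verts G" "y \<in> verts G" for x y
    using finite_image_iff[OF inj] im[OF that] cubic_finite[OF c that] by metis
  show ?thesis
    unfolding cubic_def
  proof (intro conjI ballI allI impI)
    show "inj_on g (verts G)"
    proof (rule inj_onI)
      fix x y assume xy: "x \<in> verts G" "y \<in> verts G" "g x = g y"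
      then have "sd (f x) (f y) = {}" using im[OF xy(1,2)] by simp
      then have "f x = f y" by (simp add: sd_empty_iff)
      then show "x = y" by (rule cubic_inj[OF c xy(1,2)])
    qed
    show "finite (sd (g x) (g y))" if "x \<in> verts G" "y \<in> verts G" for x y using fin that .
    show "((x, y) \<in> edges G) = (x \<in> verts G \<and> y \<in> verts G \<and> card (sd (g x) (g y)) = 1)" for x y
      using cubic_edge[OF c, of x y] crd[of x y] by auto
    fix x y assume xy: "x \<in> verts G" "y \<in> verts G" "x \<noteq> y"
    obtain z where z: "z \<in> verts G" "card (sd (f x) (f z)) = 1" "sd (f x) (f z) \<subseteq> sd (f x) (f y)"
      using cubic_step[OF c xy] .
    have "sd (g x) (g z) \<subseteq> sd (g x) (g y)" unfolding sdg using z(3) by blast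
    then show "\<exists>z\<in>verts G. card (sd (g x) (g z)) = 1 \<and> sd (g x) (g z) \<subseteq> sd (g x) (g y)"
      using z crd[OF xy(1) z(1)] by (intro bexI[of _ z]) simp_all
  qed
qed

lemma card_sd_one_flip: "card (sd x y) = 1 \<longleftrightarrow> (\<exists>i. y = flip i x)"
proof
  assume "card (sd x y) = 1"
  then obtain i where i: "sd x y = {i}" by (rule card_1_singletonE)
  have "(k \<in> y) = (k \<in> flip i x)" for k
  proof -
    have "k \<in> sd x y \<longleftrightarrow> k = i" unfolding i by simp
    then show ?thesis by auto
  qed
  then show "\<exists>i. y = flip i x" by blast
next
  assume "\<exists>i. y = flip i x"
  then obtain i where i: "y = flip i x" by blast
  have "sd x y = {i}" unfolding i by auto
  then show "card (sd x y) = 1" by simp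
qed

lemma cubic_image_step:
  assumes c: "cubic G h" and x: "x \<in> h ` verts G" and y: "y \<in> h ` verts G" and ne: "x \<noteq> y"
  shows "\<exists>i. (i \<in> x) \<noteq> (i \<in> y) \<and> flip i x \<in> h ` verts G"
proof -
  obtain v w where v: "v \<in> verts G" "x = h v" and w: "w \<in> verts G" "y = h w" using x y by blast
  have "v \<noteq> w" using ne v w by blast
  from cubic_step[OF c v(1) w(1) this] obtain z where
    z: "z \<in> verts G" "card (sd (h v) (h z)) = 1" "sd (h v) (h z) \<subseteq> sd (h v) (h w)" .
  obtain i where i: "h z = flip i (h v)" using z(2) card_sd_one_flip by blast
  have "i \<in> sd (h v) (h z)" unfolding i by simp
  then have "(i \<in> x) \<noteq> (i \<in> y)" using z(3) v w by auto
  moreover have "flip i x \<in> h ` verts G" using i v z(1) by (metis imageI)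
  ultimately show ?thesis by blast
qed

text \<open>Take a point \<open>z\<close> of \<open>D\<close> nearest to \<open>v\<close> and the
  coordinate of the first edge from \<open>z\<close> towards \<open>v\<close>. A point of
  \<open>D\<close> on the side of \<open>v\<close> would put the other end of that edge into
  \<open>D\<close>, closer to \<open>v\<close>.\<close>

lemma convex_separation:
  assumes c: "cubic G h" and D: "convex G D" "D \<noteq> {}" and v: "v \<in> verts G" "v \<notin> D"
  obtains j where "\<forall>w\<in>D. (j \<in> h w) \<noteq> (j \<in> h v)"
proof -
  have DV: "D \<subseteq> verts G" using D(1) unfolding convex_def by blast
  obtain z0 where "z0 \<in> D" using D(2) by blast
  from ex_has_least_nat[of "\<lambda>z. z \<in> D" z0 "\<lambda>z. card (sd (h z) (h v))", OF this]
  obtain z where z': "z \<in> D \<and> (\<forall>w. w \<in> D \<longrightarrow> card (sd (h z) (h v)) \<le> card (sd (h w) (h v)))" ..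
  then have z: "z \<in> D" "z \<in> verts G" "z \<noteq> v" using DV v by blast+
  obtain u where u: "u \<in> verts G" "card (sd (h z) (h u)) = 1" "sd (h z) (h u) \<subseteq> sd (h z) (h v)"
    using cubic_step[OF c z(2) v(1) z(3)] .
  obtain j where j: "sd (h z) (h u) = {j}" using u(2) by (rule card_1_singletonE)
  have "card (sd (h u) (h v)) < card (sd (h z) (h v))"
    using card_sd_between[OF cubic_finite[OF c z(2) v(1)] u(3)] u(2) by simp
  then have uD: "u \<notin> D" using z' by (meson linorder_not_less)
  have jv: "(j \<in> h z) \<noteq> (j \<in> h v)" using u(3) unfolding j by simp
  have "(j \<in> h w) \<noteq> (j \<in> h v)" if w: "w \<in> D" for w
  proof
    assume "(j \<in> h w) = (j \<in> h v)"
    then have "sd (h z) (h u) \<subseteq> sd (h z) (h w)" unfolding j using jv by simp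
    then have "u \<in> D" using D(1) z(1) w u(1) unfolding cubic_convex[OF c] by blast
    then show False using uD by blast
  qed
  then show ?thesis using that by blast
qed

section \<open>From pre-hull number at most one to stretchability\<close>

lemma ph_le_one:
  assumes "ph G \<le> 1"
  shows "ph_prop G 0 \<or> ph_prop G 1"
proof -
  have ex: "\<exists>n. ph_prop G n" using assms unfolding ph_def by (auto split: if_splits)
  then have "enat (LEAST n. ph_prop G n) \<le> 1" using assms unfolding ph_def by simp
  then have "(LEAST n. ph_prop G n) \<le> 1" by (simp add: one_enat_def)
  then have "(LEAST n. ph_prop G n) = 0 \<or> (LEAST n. ph_prop G n) = 1" by linarith
  then show ?thesis using LeastI_ex[OF ex] by metis
qed

lemma ph_le_one_co:
  assumes c: "cubic G h" and ph: "ph G \<le> 1" and C: "copoint G x C"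
  shows "co G (C \<union> {x}) \<subseteq> interval_set G (C \<union> {x})"
proof -
  have V: "C \<union> {x} \<subseteq> verts G" using C unfolding copoint_def convex_def by blast
  have "y \<in> interval G y y" if "y \<in> verts G" for y using cubic_interval[OF c that that] that by simp
  then have sub: "C \<union> {x} \<subseteq> interval_set G (C \<union> {x})" using V unfolding interval_set_def by blast
  from ph_le_one[OF ph] show ?thesis
  proof
    assume "ph_prop G 0"
    then have "co G (C \<union> {x}) = C \<union> {x}" using C unfolding ph_prop_def by simp
    then show ?thesis using sub by simp
  next
    assume "ph_prop G 1"
    then have "co G (C \<union> {x}) = interval_set G (C \<union> {x})" using C unfolding ph_prop_def by simp
    then show ?thesis by simp
  qed
qed

text \<open>If no other coordinate separates a point from the far side \<open>C\<close> of \<open>i\<close>, then \<open>C\<close> is a copoint at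
  every point of the near side and its hull with any such point is everything.\<close>
lemma ph_le_one_stretchable:
  fixes h :: "'a \<Rightarrow> nat set"
  assumes c: "cubic G h" and N: "finite N" "h ` verts G \<subseteq> Pow N" and ph: "ph G \<le> 1"
    and both: "\<And>x j. x \<in> h ` verts G \<Longrightarrow> j \<noteq> i \<Longrightarrow> \<exists>z\<in>h ` verts G. (j \<in> z) = (j \<in> x) \<and> (i \<in> z) \<noteq> (i \<in> x)"
  shows "stretchable {i} (h ` verts G)"
  unfolding stretchable_def
proof (intro ballI impI)
  fix i' p q assume i': "i' \<in> {i}" and p: "p \<in> h ` verts G" and q: "q \<in> h ` verts G" and pq: "(i' \<in> p) = (i' \<in> q)"
  obtain x y where x: "x \<in> verts G" "p = h x" and y: "y \<in> verts G" "q = h y" using p q by blast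
  have ixy: "(i \<in> h y) = (i \<in> h x)" using pq i' x y by simp
  define C where "C = {v \<in> verts G. (i \<in> h v) \<noteq> (i \<in> h x)}"
  have convC: "convex G C"
    unfolding cubic_convex[OF c]
  proof (intro conjI ballI impI)
    fix u v w assume u: "u \<in> C" and v: "v \<in> C" and w: "w \<in> verts G" and s: "sd (h u) (h w) \<subseteq> sd (h u) (h v)"
    have "i \<notin> sd (h u) (h v)" using u v unfolding C_def by simp
    then have "i \<notin> sd (h u) (h w)" using s by blast
    then have "(i \<in> h w) = (i \<in> h u)" by simp
    then show "w \<in> C" using u w unfolding C_def by simp
  qed (auto simp: C_def)
  have other: "\<exists>w\<in>C. (j \<in> h w) = (j \<in> h v)" if v: "v \<in> verts G" "(i \<in> h v) = (i \<in> h x)" "j \<noteq> i" for v j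
  proof -
    have "h v \<in> h ` verts G" using v(1) by blast
    from both[OF this v(3)] obtain z where z: "z \<in> verts G" "(j \<in> h z) = (j \<in> h v)" "(i \<in> h z) \<noteq> (i \<in> h v)"
      by blast
    then have "z \<in> C" using v(2) unfolding C_def by simp
    then show ?thesis using z(2) by blast
  qed
  have Cne: "C \<noteq> {}" using other[OF x(1), of "Suc i"] by auto
  \<comment> \<open>A coordinate separating \<open>v\<close> from \<open>D\<close> could not be
    \<open>i\<close>, because \<open>D\<close> has a point on the near side, and no other coordinate
    separates \<open>v\<close> from \<open>C\<close>.\<close>
  have absorb: "v \<in> D" if D: "convex G D" "C \<subseteq> D" "w \<in> D" "(i \<in> h w) = (i \<in> h x)"
    and v: "v \<in> verts G" "(i \<in> h v) = (i \<in> h x)" for D v w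
  proof (rule ccontr)
    assume vD: "v \<notin> D"
    have "D \<noteq> {}" using D(3) by blast
    from convex_separation[OF c D(1) this v(1) vD] obtain j where
      j: "\<forall>w\<in>D. (j \<in> h w) \<noteq> (j \<in> h v)" .
    have "(j \<in> h w) \<noteq> (j \<in> h v)" using j D(3) by blast
    then have "j \<noteq> i" using D(4) v(2) by blast
    then obtain w' where "w' \<in> C" "(j \<in> h w') = (j \<in> h v)" using other[OF v] by blast
    then show False using j D(2) by blast
  qed
  have cop: "copoint G x C"
    unfolding copoint_def
  proof (intro conjI allI impI)
    show "x \<in> verts G" "convex G C" using x convC by auto
    show "x \<notin> C" unfolding C_def by simp
    fix D assume D: "convex G D \<and> x \<notin> D \<and> C \<subseteq> D"
    show "D = C"
    proof (rule ccontr)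
      assume "D \<noteq> C"
      then obtain w where w: "w \<in> D" "w \<notin> C" using D by blast
      then have "(i \<in> h w) = (i \<in> h x)" using D unfolding C_def convex_def by blast
      then have "x \<in> D" using absorb[of D w x] D w x by blast
      then show False using D by blast
    qed
  qed
  have "y \<in> co G (C \<union> {x})"
    unfolding co_def using absorb[of _ x y] y ixy by blast
  then have "y \<in> interval_set G (C \<union> {x})" using ph_le_one_co[OF c ph cop] by blast
  then obtain u v where uv: "u \<in> C \<union> {x}" "v \<in> C \<union> {x}" "y \<in> interval G u v" unfolding interval_set_def by blast
  have V: "C \<union> {x} \<subseteq> verts G" using x unfolding C_def by blast
  have s: "sd (h u) (h y) \<subseteq> sd (h u) (h v)" using uv cubic_interval[OF c, of u v] V by blast
  have yC: "y \<notin> C" using ixy unfolding C_def by simp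
  \<comment> \<open>\<open>y\<close> lies on a geodesic between two points of
    \<open>C \<union> {x}\<close>. Since \<open>C\<close> is convex and misses \<open>y\<close>, one
    end is \<open>x\<close> and the other in \<open>C\<close>, apart from the trivial case
    \<open>y = x\<close>.\<close>
  obtain w where w: "w \<in> C" "sd (h x) (h y) \<subseteq> sd (h x) (h w)"
  proof (cases "u \<in> C")
    case uC: True
    have "v \<notin> C" using convC uC s y(1) yC unfolding cubic_convex[OF c] by blast
    then have "v = x" using uv by blast
    then show ?thesis using that[OF uC] sd_between_commute[OF s] by blast
  next
    case False
    then have ux: "u = x" using uv by blast
    show ?thesis
    proof (cases "v \<in> C")
      case True
      then show ?thesis using that s ux by blast
    next
      case False
      then have "v = x" using uv by blast
      then have "sd (h x) (h y) = {}" using s ux by simp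
      moreover obtain w where "w \<in> C" using Cne by blast
      ultimately show ?thesis using that[of w] by simp
    qed
  qed
  have wV: "h w \<in> h ` verts G" and iw: "(i \<in> q) \<noteq> (i \<in> h w)"
    using w(1) ixy y unfolding C_def by auto
  \<comment> \<open>The geodesic from \<open>x\<close> through \<open>y\<close> to \<open>w\<close>
    crosses \<open>i\<close> after \<open>y\<close>; the point just before the crossing is the
    required one.\<close>
  from wg_crossing[OF N cubic_image_step[OF c] q wV iw] obtain r where
    r: "r \<in> h ` verts G" "flip i r \<in> h ` verts G" "(i \<in> r) = (i \<in> q)"
      "\<forall>k. (k \<in> q) = (k \<in> h w) \<longrightarrow> (k \<in> r) = (k \<in> q)" by blast
  show "\<exists>u\<in>h ` verts G. flip i' u \<in> h ` verts G \<and> (i' \<in> u) = (i' \<in> p) \<and>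
      (\<forall>k. (k \<in> p) \<noteq> (k \<in> q) \<longrightarrow> (k \<in> u) = (k \<in> q))"
  proof (intro bexI[of _ r] conjI allI impI)
    fix k assume k: "(k \<in> p) \<noteq> (k \<in> q)"
    then have "k \<in> sd (h x) (h y)" using x y by simp
    then have "k \<in> sd (h x) (h w)" using w(2) by blast
    then have "(k \<in> q) = (k \<in> h w)" using k x by auto
    then show "(k \<in> r) = (k \<in> q)" using r(4) by blast
  qed (use r i' pq in auto)
qed

section \<open>Coordinates crossed by an isometric cycle\<close>

lemma verts_cycle_subgraph: "verts (cycle_subgraph vs) = set vs"
  unfolding verts_def cycle_subgraph_def by simp

lemma edges_cycle_subgraph:
  "(x, y) \<in> edges (cycle_subgraph vs) \<longleftrightarrow> (\<exists>i<length vs.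
     x = vs ! i \<and> y = vs ! ((i + 1) mod length vs) \<or> y = vs ! i \<and> x = vs ! ((i + 1) mod length vs))"
  unfolding edges_def cycle_subgraph_def by auto

definition circ :: "nat \<Rightarrow> nat \<Rightarrow> nat \<Rightarrow> nat" where
  "circ m i j = (if i \<le> j then min (j - i) (m - (j - i)) else min (i - j) (m - (i - j)))"

lemma circ_next:
  assumes "i < m" "j < m"
  shows "circ m i ((j + 1) mod m) \<le> Suc (circ m i j)" "circ m i j \<le> Suc (circ m i ((j + 1) mod m))"
proof -
  consider "j + 1 < m" | "j + 1 = m" using assms by linarith
  then have "circ m i ((j + 1) mod m) \<le> Suc (circ m i j) \<and> circ m i j \<le> Suc (circ m i ((j + 1) mod m))"
  proof cases
    case 1
    then have "(j + 1) mod m = j + 1" by simp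
    then show ?thesis using assms 1 unfolding circ_def min_def by auto
  next
    case 2
    then have "(j + 1) mod m = 0" by simp
    then show ?thesis using assms 2 unfolding circ_def min_def by auto
  qed
  then show "circ m i ((j + 1) mod m) \<le> Suc (circ m i j)" "circ m i j \<le> Suc (circ m i ((j + 1) mod m))" by auto
qed

text \<open>Each step of a walk in the cycle changes the cyclic distance \<open>circ\<close> from
  the start by at most one.\<close>

lemma cycle_subgraph_gdist:
  assumes dist: "distinct vs" and ij: "i \<le> j" "j < length vs"
  shows "circ (length vs) i j \<le> gdist (cycle_subgraph vs) (vs ! i) (vs ! j)"
proof -
  let ?C = "cycle_subgraph vs" and ?m = "length vs"
  \<comment> \<open>Some walk has to exist for the least length in \<open>gdist\<close> to be
    attained.\<close>
  let ?ws = "map (\<lambda>k. vs ! k) [i..<Suc j]"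
  have "walk_between ?C (vs ! i) (vs ! j) ?ws"
    unfolding walk_between_def gwalk_def verts_cycle_subgraph
  proof (intro conjI allI impI)
    show "?ws \<noteq> []" "last ?ws = vs ! j" using ij by simp_all
    show "hd ?ws = vs ! i" using ij by (simp add: hd_map del: upt_Suc)
    show "set ?ws \<subseteq> set vs" using ij by auto
    fix k assume k: "Suc k < length ?ws"
    then have "?ws ! k = vs ! (i + k)" "?ws ! Suc k = vs ! (i + Suc k)" using nth_upt[of i k "Suc j"] nth_upt[of i "Suc k" "Suc j"]
      by (simp_all del: upt_Suc)
    moreover have "i + Suc k = (i + k + 1) mod ?m" "i + k < ?m" using k ij by simp_all
    ultimately show "(?ws ! k, ?ws ! Suc k) \<in> edges ?C" unfolding edges_cycle_subgraph by metis
  qed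
  moreover have "length ?ws = Suc (j - i)" using ij by simp
  ultimately have "\<exists>n xs. walk_between ?C (vs ! i) (vs ! j) xs \<and> length xs = Suc n" by blast
  from LeastI_ex[OF this] obtain xs where
    xs: "walk_between ?C (vs ! i) (vs ! j) xs" "length xs = Suc (gdist ?C (vs ! i) (vs ! j))"
    unfolding gdist_def by blast
  have eq: "vs ! a = vs ! b \<longleftrightarrow> a = b" if "a < ?m" "b < ?m" for a b
    using nth_eq_iff_index_eq[OF dist that] .
  have ne: "xs \<noteq> []" using xs(2) by auto
  have "\<exists>p<?m. xs ! k = vs ! p \<and> circ ?m i p \<le> k" if "k < length xs" for k
    using that
  proof (induction k)
    case 0
    have "xs ! 0 = vs ! i" using xs(1) ne unfolding walk_between_def by (simp add: hd_conv_nth)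
    then show ?case using ij by (intro exI[of _ i]) (simp add: circ_def)
  next
    case (Suc k)
    then obtain p where p: "p < ?m" "xs ! k = vs ! p" "circ ?m i p \<le> k" by auto
    have "(xs ! k, xs ! Suc k) \<in> edges ?C" using xs(1) Suc.prems unfolding walk_between_def gwalk_def by blast
    then obtain a where a: "a < ?m" "xs ! k = vs ! a \<and> xs ! Suc k = vs ! ((a + 1) mod ?m) \<or>
        xs ! Suc k = vs ! a \<and> xs ! k = vs ! ((a + 1) mod ?m)" unfolding edges_cycle_subgraph by blast
    have am: "(a + 1) mod ?m < ?m" using a(1) by (intro mod_less_divisor) linarith
    have im: "i < ?m" using ij by simp
    from a(2) show ?case
    proof
      assume h: "xs ! k = vs ! a \<and> xs ! Suc k = vs ! ((a + 1) mod ?m)"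
      then have "vs ! a = vs ! p" using p(2) by (metis (no_types))
      then have "a = p" using eq[OF a(1) p(1)] by blast
      then have "circ ?m i ((a + 1) mod ?m) \<le> Suc k" using circ_next(1)[OF im a(1)] p(3) by simp
      then show ?thesis using h am by blast
    next
      assume h: "xs ! Suc k = vs ! a \<and> xs ! k = vs ! ((a + 1) mod ?m)"
      then have "vs ! ((a + 1) mod ?m) = vs ! p" using p(2) by (metis (no_types))
      then have "(a + 1) mod ?m = p" using eq[OF am p(1)] by blast
      then have "circ ?m i a \<le> Suc k" using circ_next(2)[OF im a(1)] p(3) by simp
      then show ?thesis using h a(1) by blast
    qed
  qed
  from this[of "length xs - 1"] obtain p where p: "p < ?m" "xs ! (length xs - 1) = vs ! p" "circ ?m i p \<le> length xs - 1"
    using ne by auto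
  have "xs ! (length xs - 1) = vs ! j" using xs(1) ne unfolding walk_between_def by (simp add: last_conv_nth)
  then have "vs ! p = vs ! j" using p(2) by (metis (no_types))
  then have "p = j" using eq[OF p(1) ij(2)] by blast
  then show ?thesis using p(3) xs(2) by simp
qed

text \<open>Opposite vertices are at distance \<open>n\<close>, so the first half of the cycle
  crosses \<open>n\<close> distinct coordinates. Each vertex of the second half differs from its
  opposite in exactly these, so they are crossed again in the same order.\<close>

lemma isometric_cycle_coordinates:
  fixes f :: "'a \<Rightarrow> 'b set"
  assumes c: "cubic G f" and iso: "isometric_cycle G vs"
  obtains n and d :: "nat \<Rightarrow> 'b" where "length vs = 2 * n" "0 < n" "inj_on d {..<n}"
    "\<And>t. t \<le> n \<Longrightarrow> sd (f (vs ! t)) (f (vs ! 0)) = d ` {..<t}"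
    "\<And>t. t < n \<Longrightarrow> sd (f (vs ! (n + t))) (f (vs ! 0)) = d ` {t..<n}"
proof -
  let ?m = "length vs"
  define F where "F = (\<lambda>k. f (vs ! k))"
  define n where "n = ?m div 2"
  have cyc: "distinct vs" "3 \<le> ?m" "set vs \<subseteq> verts G" "\<And>i. i < ?m \<Longrightarrow> (vs ! i, vs ! ((i + 1) mod ?m)) \<in> edges G"
    using iso unfolding isometric_cycle_def cycle_in_def by auto
  have V: "vs ! k \<in> verts G" if "k < ?m" for k using cyc(3) that nth_mem by blast
  have fin: "finite (sd (F a) (F b))" if "a < ?m" "b < ?m" for a b
    unfolding F_def using cubic_finite[OF c] V that by blast
  have one: "card (sd (F i) (F ((i + 1) mod ?m))) = 1" if "i < ?m" for i
    using cyc(4)[OF that] cubic_edge[OF c] unfolding F_def by blast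
  have low: "circ ?m a b \<le> card (sd (F a) (F b))" if "a \<le> b" "b < ?m" for a b
  proof -
    have "gdist (cycle_subgraph vs) (vs ! a) (vs ! b) = gdist G (vs ! a) (vs ! b)"
      using iso that unfolding isometric_cycle_def isometric_subgraph_def verts_cycle_subgraph by auto
    also have "\<dots> = card (sd (F a) (F b))" unfolding F_def using cubic_gdist[OF c] V that by simp
    finally show ?thesis using cycle_subgraph_gdist[OF cyc(1) that] by simp
  qed
  have up: "card (sd (F a) (F b)) \<le> b - a" if "a \<le> b" "b < ?m" for a b
    using that
  proof (induction b)
    case (Suc b)
    show ?case
    proof (cases "a = Suc b")
      case False
      have "(b + 1) mod ?m = Suc b" using Suc.prems by simp
      then have "card (sd (F b) (F (Suc b))) = 1" using one[of b] Suc.prems by simp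
      then show ?thesis
        using Suc False card_sd_triangle[of "F a" "F b" "F (Suc b)"] fin[of a b] fin[of b "Suc b"] by simp
    qed simp
  qed simp
  have m1: "(?m - 1 + 1) mod ?m = 0"
  proof -
    have "?m - 1 + 1 = ?m" using cyc(2) by linarith
    then show ?thesis by (simp only: mod_self)
  qed
  have wrap: "card (sd (F b) (F 0)) \<le> ?m - b" if "b < ?m" for b
  proof -
    have "card (sd (F (?m - 1)) (F 0)) = 1" using one[of "?m - 1"] m1 cyc(2) by simp
    moreover have "card (sd (F b) (F (?m - 1))) \<le> ?m - 1 - b" using up[of b "?m - 1"] that by simp
    moreover have "?m - 1 < ?m" "0 < ?m" using that by linarith+
    then have "finite (sd (F b) (F (?m - 1)))" "finite (sd (F (?m - 1)) (F 0))" using fin that by blast+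
    note card_sd_triangle[OF this]
    ultimately show ?thesis using that by linarith
  qed
  have par: "even (card (sd (F 0) (F t))) \<longleftrightarrow> even t" if "t < ?m" for t
    using that
  proof (induction t)
    case (Suc t)
    have "(t + 1) mod ?m = Suc t" using Suc.prems by simp
    then have "card (sd (F t) (F (Suc t))) = 1" using one[of t] Suc.prems by simp
    moreover have "0 < ?m" "t < ?m" using Suc.prems by linarith+
    then have "finite (sd (F 0) (F t))" by (rule fin)
    ultimately show ?case using card_sd_parity[of "F 0" "F t" "F (Suc t)"] Suc by simp
  qed simp
  have "card (sd (F 0) (F (?m - 1))) = 1" using one[of "?m - 1"] m1 cyc(2) sd_commute[of "F 0" "F (?m - 1)"] by simp
  then have "odd (?m - 1)" using par[of "?m - 1"] cyc(2) by simp
  then have "even ?m" using cyc(2) by simp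
  then have m: "?m = 2 * n" unfolding n_def by simp
  have n0: "0 < n" using cyc(2) m by simp
  have dist0: "card (sd (F 0) (F t)) = t" if "t \<le> n" for t
  proof -
    have "t < ?m" using that m n0 by simp
    then show ?thesis using low[of 0 t] up[of 0 t] that m unfolding circ_def by simp
  qed
  define d where "d t = (THE e. sd (F t) (F (Suc t)) = {e})" for t
  have d: "sd (F t) (F (Suc t)) = {d t}" if t: "t < n" for t
  proof -
    have "(t + 1) mod ?m = Suc t" using t m by simp
    then have "card (sd (F t) (F (Suc t))) = 1" using one[of t] t m by simp
    then obtain e where "sd (F t) (F (Suc t)) = {e}" by (rule card_1_singletonE)
    then show ?thesis unfolding d_def by simp
  qed
  have pre: "sd (F 0) (F t) = d ` {..<t}" if "t \<le> n" for t
    using that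
  proof (induction t)
    case (Suc t)
    have s: "sd (F 0) (F (Suc t)) \<subseteq> d ` {..<Suc t}"
      using sd_triangle[of "F 0" "F (Suc t)" "F t"] d[of t] Suc by (auto simp: lessThan_Suc simp del: in_sd)
    have "card (d ` {..<Suc t}) \<le> Suc t" using card_image_le[of "{..<Suc t}" d] by simp
    then show ?case using s dist0[OF Suc.prems] by (intro card_seteq) simp_all
  qed simp
  have inj: "inj_on d {..<n}" using pre[of n] dist0[of n] by (intro eq_card_imp_inj_on) simp_all
  have first: "sd (F t) (F 0) = d ` {..<t}" if "t \<le> n" for t
    using pre[OF that] sd_commute by metis
  have second: "sd (F (n + t)) (F 0) = d ` {t..<n}" if t: "t < n" for t
  proof -
    have tm: "n + t < ?m" and m0: "0 < ?m" and nm: "n < ?m" using t m by simp_all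
    have "card (sd (F (n + t)) (F 0)) \<le> n - t" using wrap[OF tm] m by simp
    moreover have "card (sd (F n) (F (n + t))) \<le> t" using up[of n "n + t"] tm by simp
    \<comment> \<open>Both arcs bound the distances from above, so the vertex at position
      \<open>n + t\<close> lies between those at \<open>0\<close> and \<open>n\<close> and involves
      only the coordinates already named.\<close>
    ultimately have "card (sd (F 0) (F (n + t))) + card (sd (F (n + t)) (F n)) \<le> card (sd (F 0) (F n))"
      using dist0[of n] t sd_commute[of "F 0" "F (n + t)"] sd_commute[of "F n" "F (n + t)"] by simp
    then have s0: "sd (F 0) (F (n + t)) \<subseteq> d ` {..<n}"
      using sd_betweenI[of "F 0" "F (n + t)" "F n"] fin[OF m0 tm] fin[OF tm nm] pre[of n] by simp
    have "sd (F t) (F (n + t)) \<subseteq> sd (F t) (F 0) \<union> sd (F 0) (F (n + t))" by (rule sd_triangle)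
    also have "\<dots> \<subseteq> d ` {..<n}" using first[of t] s0 t by auto
    finally have s: "sd (F t) (F (n + t)) \<subseteq> d ` {..<n}" .
    have "circ ?m t (n + t) = n" using m unfolding circ_def by simp
    then have "n \<le> card (sd (F t) (F (n + t)))" using low[of t "n + t"] tm by simp
    then have eq: "sd (F t) (F (n + t)) = d ` {..<n}"
      using card_image_le[of "{..<n}" d] by (intro card_seteq[OF _ s]) simp_all
    have "sd (F (n + t)) (F 0) = sd (sd (F t) (F (n + t))) (sd (F t) (F 0))" by auto
    also have "\<dots> = sd (d ` {..<n}) (d ` {..<t})" using eq first[of t] t by simp
    also have "\<dots> = d ` {..<n} - d ` {..<t}"
      using image_mono[of "{..<t}" "{..<n}" d] t unfolding sd_def by auto
    also have "\<dots> = d ` ({..<n} - {..<t})" using inj t by (intro inj_on_image_set_diff[symmetric]) auto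
    also have "{..<n} - {..<t} = {t..<n}" by auto
    finally show ?thesis .
  qed
  show ?thesis using that[OF m n0 inj] first second unfolding F_def by blast
qed

section \<open>The hull of the cycle as a set family\<close>

theorem theorem4p28:
  fixes G :: "'a graph" and vs :: "'a list"
  assumes "peano_partial_cube G"
    and "isometric_cycle G vs"
  shows "quasi_hypertorus (induced G (co G (set vs)))"
proof -
  have "partial_cube G" and peano: "\<And>A. finite A \<Longrightarrow> convex G A \<Longrightarrow> ph (induced G A) \<le> 1"
    using assms(1) unfolding peano_partial_cube_def by auto
  then obtain f :: "'a \<Rightarrow> 'a set set" where f: "cubic G f" using partial_cube_cubic by blast
  obtain n d where n: "length vs = 2 * n" "0 < n" and inj: "inj_on d {..<n}"
    and first: "\<And>t. t \<le> n \<Longrightarrow> sd (f (vs ! t)) (f (vs ! 0)) = d ` {..<t}"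
    and second: "\<And>t. t < n \<Longrightarrow> sd (f (vs ! (n + t))) (f (vs ! 0)) = d ` {t..<n}"
    using isometric_cycle_coordinates[OF f assms(2)] by metis
  let ?A = "co G (set vs)" and ?b = "f (vs ! 0)"
  \<comment> \<open>A convex set around the cycle with at most \<open>2 ^ n\<close> vertices. It
    makes the hull finite even when \<open>G\<close> is infinite, as the Peano condition requires,
    and confines it to the coordinates crossed by the cycle.\<close>
  let ?B = "{x \<in> verts G. sd (f x) ?b \<subseteq> d ` {..<n}}"
  have vsV: "set vs \<subseteq> verts G" using assms(2) unfolding isometric_cycle_def cycle_in_def by blast
  have v0: "vs ! 0 \<in> verts G" using vsV n by (auto intro: nth_mem)
  have convB: "convex G ?B"
    unfolding cubic_convex[OF f]
  proof (intro conjI ballI impI)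
    fix x y z assume x: "x \<in> ?B" and y: "y \<in> ?B" and z: "z \<in> verts G" "sd (f x) (f z) \<subseteq> sd (f x) (f y)"
    have "sd (f z) ?b \<subseteq> sd (f x) ?b \<union> sd (f y) ?b"
      using z(2) unfolding sd_def by blast
    then show "z \<in> ?B" using x y z(1) by blast
  qed blast
  have vsB: "set vs \<subseteq> ?B"
  proof
    fix x assume x: "x \<in> set vs"
    then obtain k where k: "k < 2 * n" "x = vs ! k" using n by (auto simp: in_set_conv_nth)
    have "sd (f x) ?b \<subseteq> d ` {..<n}"
    proof (cases "k \<le> n")
      case True
      then show ?thesis using first k by auto
    next
      case False
      then show ?thesis using second[of "k - n"] k by auto
    qed
    then show "x \<in> ?B" using x vsV by blast
  qed
  have AB: "?A \<subseteq> ?B" unfolding co_def using convB vsB by blast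
  have vsA: "set vs \<subseteq> ?A" unfolding co_def by blast
  have "finite ?B"
  proof (rule inj_on_finite[of "\<lambda>x. sd (f x) ?b" _ "Pow (d ` {..<n})"])
    show "inj_on (\<lambda>x. sd (f x) ?b) ?B"
    proof (rule inj_onI)
      fix x y assume xy: "x \<in> ?B" "y \<in> ?B" "sd (f x) ?b = sd (f y) ?b"
      have "f x = f y" using xy(3) unfolding sd_def by blast
      then show "x = y" using cubic_inj[OF f, of x y] xy(1,2) by simp
    qed
  qed auto
  then have finA: "finite ?A" using AB finite_subset by blast
  have AV: "?A \<subseteq> verts G" using AB by blast
  have convA: "convex G ?A"
    using AV unfolding convex_def co_def by blast
  define h where "h x = {t \<in> {..<n}. d t \<in> sd (f x) ?b}" for x
  have sdA: "sd (f x) (f y) \<subseteq> d ` {..<n}" if "x \<in> ?A" "y \<in> ?A" for x y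
  proof -
    have "sd (f x) (f y) \<subseteq> sd (f x) ?b \<union> sd (f y) ?b" unfolding sd_def by blast
    then show ?thesis using AB that by blast
  qed
  have cubic_h: "cubic (induced G A') h" if "convex G A'" "A' \<subseteq> ?A" for A'
    using cubic_relabel[OF cubic_induced[OF f that(1)] inj, of h ?b] sdA that(2) h_def by auto
  let ?H = "h ` ?A"
  have hN: "h x \<subseteq> {..<n}" for x unfolding h_def by blast
  have fam: "cube_family {..<n} ?H"
  proof
    show "finite {..<n}" "?H \<subseteq> Pow {..<n}" using hN by auto
    show "\<exists>i. (i \<in> x) \<noteq> (i \<in> y) \<and> flip i x \<in> ?H" if "x \<in> ?H" "y \<in> ?H" "x \<noteq> y" for x y
      using cubic_image_step[OF cubic_h[OF convA order_refl]] that by simp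
    show "stretchable {i} K" if K: "K = {x \<in> ?H. x \<inter> F = A}"
      and both: "\<And>x j. x \<in> K \<Longrightarrow> j \<noteq> i \<Longrightarrow> \<exists>z\<in>K. (j \<in> z) = (j \<in> x) \<and> (i \<in> z) \<noteq> (i \<in> x)" for F A i K
    proof -
      \<comment> \<open>The trace of the hull on a subcube is convex in \<open>G\<close>, so the
        Peano condition applies to it directly.\<close>
      let ?A' = "{x \<in> ?A. h x \<inter> F = A}"
      have "convex G ?A'"
        unfolding cubic_convex[OF f]
      proof (intro conjI ballI impI)
        show "?A' \<subseteq> verts G" using AV by blast
        fix x y z assume x: "x \<in> ?A'" and y: "y \<in> ?A'" and z: "z \<in> verts G" "sd (f x) (f z) \<subseteq> sd (f x) (f y)"
        have "x \<in> ?A" "y \<in> ?A" using x y by auto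
        then have zA: "z \<in> ?A" using convA z unfolding cubic_convex[OF f] by blast
        have "(t \<in> h z) = (t \<in> h x)" if t: "t \<in> F" for t
        proof -
          have "(t \<in> h x) = (t \<in> h y)" using x y t by blast
          then have "t < n \<Longrightarrow> d t \<notin> sd (f x) (f y)" unfolding h_def by auto
          then have "t < n \<Longrightarrow> d t \<notin> sd (f x) (f z)" using z(2) by blast
          then show ?thesis unfolding h_def by auto
        qed
        then have "h z \<inter> F = h x \<inter> F" by blast
        then show "z \<in> ?A'" using zA x by simp
      qed
      note conv = this
      have img: "h ` ?A' = K" unfolding K by blast
      have "ph (induced G ?A') \<le> 1" using peano[OF _ conv] finA by simp
      then show ?thesis
        using ph_le_one_stretchable[OF cubic_h[OF conv], of "{..<n}" i] hN img both by auto
    qed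
    have nth: "vs ! k \<in> ?A" if "k < 2 * n" for k using vsA n that nth_mem by auto
    have pull: "{u \<in> {..<n}. d u \<in> d ` S} = S" if "S \<subseteq> {..<n}" for S
      using that inj_on_image_mem_iff[OF inj] by blast
    have h1: "h (vs ! t) = {i \<in> {..<n}. i < t}" if "t \<le> n" for t
      unfolding h_def first[OF that] using pull[of "{..<t}"] that by auto
    have h2: "h (vs ! (n + t)) = {i \<in> {..<n}. t \<le> i}" if "t < n" for t
    proof -
      have "h (vs ! (n + t)) = {t..<n}" unfolding h_def second[OF that] by (rule pull) auto
      also have "\<dots> = {i \<in> {..<n}. t \<le> i}" by auto
      finally show ?thesis .
    qed
    show "{i \<in> {..<n}. i < t} \<in> ?H" for t
    proof -
      \<comment> \<open>Cuts beyond \<open>n\<close> give the same segment as \<open>n\<close>, the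
        vertex opposite to the start.\<close>
      have "vs ! min t n \<in> ?A" using nth[of "min t n"] n by simp
      then have "h (vs ! min t n) \<in> ?H" by (rule imageI)
      moreover have "h (vs ! min t n) = {i \<in> {..<n}. i < min t n}" by (rule h1) simp
      moreover have "{i \<in> {..<n}. i < min t n} = {i \<in> {..<n}. i < t}" by auto
      ultimately show ?thesis by (simp only:)
    qed
    show "{i \<in> {..<n}. t \<le> i} \<in> ?H" for t
    proof (cases "t < n")
      case True
      then have "vs ! (n + t) \<in> ?A" using nth[of "n + t"] by simp
      then have "h (vs ! (n + t)) \<in> ?H" by (rule imageI)
      then show ?thesis by (simp only: h2[OF True])
    next
      case False
      \<comment> \<open>For \<open>t\<close> at least \<open>n\<close> the final segment is empty,
        which is the label of the base vertex.\<close>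
      have "vs ! 0 \<in> ?A" using nth[of 0] n by simp
      then have "h (vs ! 0) \<in> ?H" by (rule imageI)
      moreover have "h (vs ! 0) = {i \<in> {..<n}. i < 0}" by (rule h1) simp
      moreover have "{i \<in> {..<n}. i < 0} = {i \<in> {..<n}. t \<le> i}" using False by auto
      ultimately show ?thesis by (simp only:)
    qed
  qed
  have "graph_iso (induced G ?A) (fam_graph ?H)"
  proof (rule graph_isoI[of h])
    note c = cubic_h[OF convA order_refl]
    show "bij_betw h (verts (induced G ?A)) (verts (fam_graph ?H))"
      using c unfolding cubic_def bij_betw_def by simp
    show "((x, y) \<in> edges (induced G ?A)) = ((h x, h y) \<in> edges (fam_graph ?H))"
      if "x \<in> verts (induced G ?A)" "y \<in> verts (induced G ?A)" for x y
      using cubic_edge[OF c, of x y] that by (simp add: edges_fam_graph card_sd_one_flip[symmetric])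
  qed
  from graph_iso_trans[OF this] show ?thesis
    using cube_family_quasi_hypertorus[OF fam] unfolding quasi_hypertorus_def by blast
qed

end
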